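(* There is $n_0$ such that the following holds for all $n\ge n_0$. Let $k\in\mathbb{N}$ satisfy $k\ge 10^3\log^3 n$ and $k\mid n$. Let $G$ be a directed graph on $n$ vertices containing $n/k$ pairwise disjoint vertex pairs $(x_i,y_i)$, $1\le i\le n/k$, and let $W=V(G)\setminus\bigcup_i\{x_i,y_i\}$. Suppose $G$ has the following two properties: (1) for every $A\subset V(G)$ with $|A|\le n/(2\log^5 n)$, $|N^+(A,W)|\ge |A|\log^5 n$ and $|N^-(A,W)|\ge |A|\log^5 n$; (2) for any two disjoint $A,B\subset V(G)$ with $|A|,|B|\ge n/(2\log^5 n)$, there is an edge directed from a vertex of $A$ to a vertex of $B$. Then $V(G)$ can be covered by $n/k$ vertex-disjoint directed paths $P_1,\dots,P_{n/k}$, each of length $k-1$, such that for each $i$ the path $P_i$ is a directed path from $x_i$ to $y_i$.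
   Context: For a set $A$ of vertices of a directed graph, $N^+(A)$ is the set of vertices $y\notin A$ such that there is an edge directed from some $x\in A$ to $y$, and $N^-(A)$ is the set of vertices $y\notin A$ such that there is an edge directed from $y$ to some $x\in A$; $N^{\pm}(A,W)=N^{\pm}(A)\cap W$. The length of a path is its number of edges. $\log$ is the natural logarithm. *)

theory Defs
  imports Complex_Main "Graph_Theory.Digraph" "Graph_Theory.Vertex_Walk"
begin

text \<open>
  Directed graphs are those of the locale \<^locale>\<open>digraph\<close>: finite, without loops and
  without parallel arcs; a pair of opposite arcs is allowed.
\<close>

definition out_nbhd :: "('a, 'b) pre_digraph \<Rightarrow> 'a set \<Rightarrow> 'a set" where
  "out_nbhd G A = {y \<in> verts G. y \<notin> A \<and> (\<exists>x\<in>A. x \<rightarrow>\<^bsub>G\<^esub> y)}"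

definition in_nbhd :: "('a, 'b) pre_digraph \<Rightarrow> 'a set \<Rightarrow> 'a set" where
  "in_nbhd G A = {y \<in> verts G. y \<notin> A \<and> (\<exists>x\<in>A. y \<rightarrow>\<^bsub>G\<^esub> x)}"

text \<open>
  The vertices x i and y i of one pair are required to differ, so that the pairs consist of
  2m distinct vertices.
\<close>

definition disjoint_vertex_pairs ::
  "('a, 'b) pre_digraph \<Rightarrow> nat \<Rightarrow> (nat \<Rightarrow> 'a) \<Rightarrow> (nat \<Rightarrow> 'a) \<Rightarrow> bool" where
  "disjoint_vertex_pairs G m x y \<longleftrightarrow>
    (\<forall>i\<in>{1..m}. x i \<in> verts G \<and> y i \<in> verts G \<and> x i \<noteq> y i) \<and>
    (\<forall>i\<in>{1..m}. \<forall>j\<in>{1..m}. i \<noteq> j \<longrightarrow> {x i, y i} \<inter> {x j, y j} = {})"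

text \<open>
  A threshold that is quantified inside a statement about graphs with vertices in 'a may
  formally depend on 'a. The instance with natural numbers as vertices and pairs of them
  as arcs gives one threshold for all finite directed graphs, since each is isomorphic to such a
  graph.
\<close>

end

theory Submission
  imports Defs "HOL-Combinatorics.Permutations" "HOL-Library.FuncSet"
    "HOL-Real_Asymp.Real_Asymp"
begin

text \<open>
  Cut every required path into segments of about \<open>1000 log\<^sup>3 n\<close> vertices, so that only
  \<open>M \<approx> n / (1000 log\<^sup>3 n)\<close> short connections are needed. A random partition of \<open>W\<close> yields layers of
  at most \<open>M\<close> vertices and a set \<open>Z\<close>, into all of which small sets still expand. After padding the layers to
  \<open>M\<close> vertices each, Hall's theorem gives a perfect matching between consecutive layers, hence paths that cover
  the layers but join the first layer to the last one by a permutation that we cannot control. The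
  permutation is repaired by a Benes network embedded beforehand into \<open>Z\<close>: its switches are subgraphs
  that can be covered by two paths of equal length in the straight and in the crossed way, so all vertices of
  the network are covered whatever permutation is routed. Whatever the network leaves of \<open>Z\<close> pads the layers.

  A switch consists of an alternating cycle \<open>v\<^sub>1 \<rightarrow> u\<^sub>1 \<leftarrow> v\<^sub>2 \<rightarrow> u\<^sub>2 \<leftarrow> \<dots>\<close>, whose two perfect matchings give the
  two states, together with directed paths from \<open>u\<^sub>i\<close> to \<open>v\<^sub>i\<^sub>+\<^sub>2\<close>. All cycles and paths are found one after the
  other by the extendability method of Friedman, Pippenger and Haxell.
\<close>

section \<open>Hall's theorem and rearrangeable networks\<close>

text \<open>The exponents come from the network. A switch is joined together by growing binary trees
  of depth of order log n, so each of its segments has that many vertices, and it has order log n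
  segments. It thus costs each of its two paths log^2 n vertices, and the order log n levels of the
  Benes network cost log^3 n. A segment of a required path must be longer than that, which fixes the
  order log^3 n for the lengths of segments and for the number of colours. A colour class then
  receives about log^5 n / log^3 n = log^2 n neighbours per vertex of a small set, enough for a
  union bound over all small sets, which costs log n per vertex.

  The other obstacle is exact counting. The matchings have to use precisely the vertices that the
  network leaves, so the network and its connections to the first and last layer come first. Hence
  these two layers are completed in advance, from a reserve, and only the inner layers are padded at
  the end.\<close>

lemma hall:
  assumes "finite A" and "\<And>a. a \<in> A \<Longrightarrow> finite (S a)"
    and "\<And>X. X \<subseteq> A \<Longrightarrow> card X \<le> card (\<Union>(S ` X))"
  shows "\<exists>f. inj_on f A \<and> (\<forall>a\<in>A. f a \<in> S a)"
  using assms
proof (induction "card A" arbitrary: A S rule: less_induct)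
  case less
  show ?case
  proof (cases "A = {}")
    case True
    then show ?thesis by auto
  next
    case False
    then obtain a where a: "a \<in> A" by auto
    have fU: "finite (\<Union>(S ` X))" if "X \<subseteq> A" for X
      using that less.prems(1,2) finite_subset by blast
    \<comment> \<open>Induction of Halmos and Vaughan: a proper tight set splits the problem into
      two smaller ones; if there is none, every proper nonempty set has a surplus, which pays for
      any choice made for one element.\<close>
    show ?thesis
    proof (cases "\<exists>X. X \<subset> A \<and> X \<noteq> {} \<and> card (\<Union>(S ` X)) = card X")
      case True
      then obtain X where X: "X \<subset> A" "X \<noteq> {}" "card (\<Union>(S ` X)) = card X" by auto
      let ?U = "\<Union>(S ` X)"
      have fX: "finite X" using X less.prems(1) finite_subset by blast
      have cX: "card X < card A" using X(1) less.prems(1) by (simp add: psubset_card_mono)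
      have "\<exists>f. inj_on f X \<and> (\<forall>a\<in>X. f a \<in> S a)"
        using X(1) by (intro less.hyps[OF cX fX] less.prems(2,3)) auto
      then obtain f where f: "inj_on f X" "\<forall>a\<in>X. f a \<in> S a" by blast
      let ?S = "\<lambda>a. S a - ?U"
      have h: "card Y \<le> card (\<Union>(?S ` Y))" if Y: "Y \<subseteq> A - X" for Y
      proof -
        have fY: "finite Y" using Y less.prems(1) finite_subset by blast
        have "card (X \<union> Y) = card X + card Y"
          using fX fY Y by (intro card_Un_disjoint) auto
        moreover have "card (X \<union> Y) \<le> card (\<Union>(S ` (X \<union> Y)))"
          using X(1) Y by (intro less.prems(3)) auto
        moreover have "\<Union>(S ` (X \<union> Y)) = ?U \<union> \<Union>(?S ` Y)" by auto
        moreover have "card (?U \<union> \<Union>(?S ` Y)) \<le> card ?U + card (\<Union>(?S ` Y))"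
          by (rule card_Un_le)
        ultimately show ?thesis using X(3) by simp
      qed
      have "card (A - X) < card A"
        using X fX less.prems(1) by (intro psubset_card_mono) auto
      then have "\<exists>g. inj_on g (A - X) \<and> (\<forall>a\<in>A - X. g a \<in> ?S a)"
        by (rule less.hyps) (use less.prems(1,2) h in \<open>simp_all\<close>)
      then obtain g where g: "inj_on g (A - X)" "\<forall>a\<in>A - X. g a \<in> ?S a" by blast
      let ?h = "\<lambda>a. if a \<in> X then f a else g a"
      have "inj_on ?h A"
      proof -
        have "f ` X \<inter> g ` (A - X) = {}" using f g by fastforce
        then have "inj_on ?h (X \<union> (A - X))" using f g by (intro inj_on_disjoint_Un) auto
        then show ?thesis using X(1) by (metis Un_Diff_cancel psubset_imp_subset sup.absorb_iff2)
      qed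
      moreover have "\<forall>a\<in>A. ?h a \<in> S a" using f g by auto
      ultimately show ?thesis by blast
    next
      case False
      have "card {a} \<le> card (\<Union>(S ` {a}))" using a by (intro less.prems(3)) auto
      then have "S a \<noteq> {}" by auto
      then obtain b where b: "b \<in> S a" by auto
      let ?S = "\<lambda>a. S a - {b}"
      have h: "card Y \<le> card (\<Union>(?S ` Y))" if Y: "Y \<subseteq> A - {a}" for Y
      proof (cases "Y = {}")
        case True
        then show ?thesis by simp
      next
        case ne: False
        have "Y \<subset> A" using Y a by blast
        then have "card Y \<noteq> card (\<Union>(S ` Y))" using False ne by metis
        moreover have "card Y \<le> card (\<Union>(S ` Y))" using Y by (intro less.prems(3)) auto
        ultimately have "card Y < card (\<Union>(S ` Y))" by simp
        moreover have eq: "\<Union>(?S ` Y) = \<Union>(S ` Y) - {b}" by auto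
        moreover have "card (\<Union>(S ` Y)) \<le> card (\<Union>(S ` Y) - {b}) + 1"
          using card_Diff_singleton_if[of "\<Union>(S ` Y)" b] by (auto split: if_splits)
        ultimately show ?thesis unfolding eq by linarith
      qed
      have "card (A - {a}) < card A" by (rule card_Diff1_less[OF less.prems(1) a])
      then have "\<exists>g. inj_on g (A - {a}) \<and> (\<forall>x\<in>A - {a}. g x \<in> ?S x)"
        by (rule less.hyps) (use less.prems(1,2) h in \<open>simp_all\<close>)
      then obtain g where g: "inj_on g (A - {a})" "\<forall>x\<in>A - {a}. g x \<in> ?S x" by blast
      have "b \<notin> g ` (A - {a})" using g(2) by blast
      then have "inj_on (g(a := b)) (insert a (A - {a}))"
        unfolding inj_on_insert using inj_on_fun_updI[OF g(1), of b a] by auto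
      then have "inj_on (g(a := b)) A" using a by (simp add: insert_absorb)
      moreover have "\<forall>x\<in>A. (g(a := b)) x \<in> S x" using g b by auto
      ultimately show ?thesis by blast
    qed
  qed
qed

section \<open>Permutations realized by networks of switches\<close>

definition switchings :: "'i set \<Rightarrow> ('i \<Rightarrow> 'i) \<Rightarrow> ('i \<Rightarrow> 'i) set" where
  "switchings I \<mu> = {\<sigma>. \<sigma> permutes I \<and> (\<forall>x. \<sigma> x = x \<or> \<sigma> x = \<mu> x)}"

text \<open>A list entry is one level of the network: an involution whose 2-cycles are the switches
  and whose fixed points are wires without a partner. Bijectivity in \<open>switchings\<close>
  forces the two wires of a pair to be swapped together. The head of the list is the level passed
  first, hence the innermost factor.\<close>

fun realizable :: "'i set \<Rightarrow> ('i \<Rightarrow> 'i) list \<Rightarrow> ('i \<Rightarrow> 'i) set" where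
  "realizable I [] = {id}"
| "realizable I (\<mu> # Ms) = {\<tau> \<circ> \<sigma> | \<tau> \<sigma>. \<sigma> \<in> switchings I \<mu> \<and> \<tau> \<in> realizable I Ms}"

lemma realizable_ConsI:
  "\<sigma> \<in> switchings I \<mu> \<Longrightarrow> \<tau> \<in> realizable I Ms \<Longrightarrow> \<tau> \<circ> \<sigma> \<in> realizable I (\<mu> # Ms)"
  unfolding realizable.simps mem_Collect_eq by blast

lemma realizable_ConsE:
  assumes "\<pi> \<in> realizable I (\<mu> # Ms)"
  obtains \<tau> \<sigma> where "\<pi> = \<tau> \<circ> \<sigma>" "\<sigma> \<in> switchings I \<mu>" "\<tau> \<in> realizable I Ms"
  using assms unfolding realizable.simps mem_Collect_eq by blast

lemma realizable_append:
  assumes "\<tau> \<in> realizable I Ms" "\<sigma> \<in> switchings I \<mu>"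
  shows "\<sigma> \<circ> \<tau> \<in> realizable I (Ms @ [\<mu>])"
  using assms
proof (induction Ms arbitrary: \<tau>)
  case Nil
  then show ?case using realizable_ConsI[of \<sigma> I \<mu> id "[]"] by simp
next
  case (Cons \<nu> Ms)
  from Cons.prems(1) obtain \<tau>' \<sigma>' where *: "\<tau> = \<tau>' \<circ> \<sigma>'" "\<sigma>' \<in> switchings I \<nu>" "\<tau>' \<in> realizable I Ms"
    by (rule realizable_ConsE)
  have "\<sigma> \<circ> \<tau>' \<in> realizable I (Ms @ [\<mu>])" by (rule Cons.IH[OF *(3) Cons.prems(2)])
  from realizable_ConsI[OF *(2) this] show ?case unfolding *(1) append_Cons comp_assoc .
qed

lemma realizable_permutes: "\<tau> \<in> realizable I Ms \<Longrightarrow> \<tau> permutes I"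
  by (induction Ms arbitrary: \<tau>) (auto simp: switchings_def permutes_id intro: permutes_compose)

lemma permutes_disjoint_commute:
  assumes f: "f permutes A" and g: "g permutes B" and AB: "A \<inter> B = {}"
  shows "f \<circ> g = g \<circ> f"
proof
  fix x
  consider "x \<in> A" "x \<notin> B" "f x \<in> A" "f x \<notin> B" | "x \<in> B" "x \<notin> A" "g x \<in> B" "g x \<notin> A" | "x \<notin> A" "x \<notin> B"
    using AB permutes_in_image[OF f, of x] permutes_in_image[OF g, of x] by blast
  then show "(f \<circ> g) x = (g \<circ> f) x"
    by cases (simp_all add: permutes_not_in[OF f] permutes_not_in[OF g])
qed

lemma involution_Un:
  assumes "\<mu> permutes A" "\<nu> permutes B" "\<mu> \<circ> \<mu> = id" "\<nu> \<circ> \<nu> = id" "A \<inter> B = {}"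
  shows "(\<mu> \<circ> \<nu>) permutes (A \<union> B)" "(\<mu> \<circ> \<nu>) \<circ> (\<mu> \<circ> \<nu>) = id"
proof -
  show "(\<mu> \<circ> \<nu>) permutes (A \<union> B)"
    using assms by (intro permutes_compose) (auto intro: permutes_subset)
  have "(\<mu> \<circ> \<nu>) \<circ> (\<mu> \<circ> \<nu>) = \<mu> \<circ> (\<nu> \<circ> \<mu>) \<circ> \<nu>" by (simp add: comp_assoc)
  also have "\<dots> = \<mu> \<circ> (\<mu> \<circ> \<nu>) \<circ> \<nu>" using permutes_disjoint_commute[OF assms(1,2,5)] by simp
  also have "\<dots> = (\<mu> \<circ> \<mu>) \<circ> (\<nu> \<circ> \<nu>)" by (simp add: comp_assoc)
  finally show "(\<mu> \<circ> \<nu>) \<circ> (\<mu> \<circ> \<nu>) = id" using assms by simp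
qed

lemma switchings_Un:
  assumes "\<sigma> \<in> switchings A \<mu>" "\<tau> \<in> switchings B \<nu>" "\<mu> permutes A" "\<nu> permutes B" "A \<inter> B = {}"
  shows "\<sigma> \<circ> \<tau> \<in> switchings (A \<union> B) (\<mu> \<circ> \<nu>)"
proof -
  have p: "\<sigma> permutes A" "\<tau> permutes B" using assms by (auto simp: switchings_def)
  have "(\<sigma> \<circ> \<tau>) permutes (A \<union> B)"
    using p by (intro permutes_compose) (auto intro: permutes_subset)
  moreover have "(\<sigma> \<circ> \<tau>) x = x \<or> (\<sigma> \<circ> \<tau>) x = (\<mu> \<circ> \<nu>) x" for x
  proof (cases "x \<in> B")
    case True
    then have "\<tau> x \<in> B" "\<nu> x \<in> B" using p assms by (auto simp: permutes_in_image)
    then have "\<sigma> (\<tau> x) = \<tau> x" "\<mu> (\<nu> x) = \<nu> x"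
      using p assms by (auto intro!: permutes_not_in)
    then show ?thesis using assms(2) by (auto simp: switchings_def)
  next
    case False
    then have "\<tau> x = x" "\<nu> x = x" using p assms by (auto intro!: permutes_not_in)
    then show ?thesis using assms(1) by (auto simp: switchings_def)
  qed
  ultimately show ?thesis by (auto simp: switchings_def)
qed

text \<open>Two networks of equal depth side by side form one network: permutations with disjoint
  supports commute, so the levels of both can be interleaved. This is the parallel step of the
  recursion.\<close>

lemma realizable_Un:
  assumes "A \<inter> B = {}" "length Ms = length Ns"
    "\<forall>\<mu>\<in>set Ms. \<mu> permutes A" "\<forall>\<mu>\<in>set Ns. \<mu> permutes B"
    "\<sigma> \<in> realizable A Ms" "\<tau> \<in> realizable B Ns"
  shows "\<sigma> \<circ> \<tau> \<in> realizable (A \<union> B) (map2 (\<circ>) Ms Ns)"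
  using assms(2-)
proof (induction Ms Ns arbitrary: \<sigma> \<tau> rule: list_induct2)
  case Nil
  then have "\<sigma> = id" "\<tau> = id" by simp_all
  then show ?case unfolding \<open>\<sigma> = id\<close> \<open>\<tau> = id\<close> by (simp add: id_def)
next
  case (Cons \<mu> Ms \<nu> Ns)
  from Cons.prems(3) obtain \<sigma>1 \<sigma>2 where s: "\<sigma> = \<sigma>2 \<circ> \<sigma>1" "\<sigma>1 \<in> switchings A \<mu>" "\<sigma>2 \<in> realizable A Ms"
    by (rule realizable_ConsE)
  from Cons.prems(4) obtain \<tau>1 \<tau>2 where t: "\<tau> = \<tau>2 \<circ> \<tau>1" "\<tau>1 \<in> switchings B \<nu>" "\<tau>2 \<in> realizable B Ns"
    by (rule realizable_ConsE)
  have "\<sigma>1 \<circ> \<tau>2 = \<tau>2 \<circ> \<sigma>1"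
    using s t assms(1) by (intro permutes_disjoint_commute[of _ A _ B])
      (auto simp: switchings_def intro: realizable_permutes)
  then have "\<sigma> \<circ> \<tau> = (\<sigma>2 \<circ> \<tau>2) \<circ> (\<sigma>1 \<circ> \<tau>1)"
    unfolding s(1) t(1) by (metis comp_assoc)
  moreover have "\<sigma>2 \<circ> \<tau>2 \<in> realizable (A \<union> B) (map2 (\<circ>) Ms Ns)"
    using Cons.prems(1,2) s t by (intro Cons.IH) simp_all
  moreover have "\<sigma>1 \<circ> \<tau>1 \<in> switchings (A \<union> B) (\<mu> \<circ> \<nu>)"
    using Cons s t assms(1) by (intro switchings_Un) auto
  ultimately show ?case unfolding zip_Cons_Cons list.map prod.case
    by (metis realizable_ConsI)
qed

text \<open>Hall's theorem picks one element from every class \<open>{a, \<mu> a}\<close> so that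
  the images under the given permutation again meet every class exactly once.\<close>

lemma transversal_of_classes:
  assumes fA: "finite A" and inv: "\<mu> \<circ> \<mu> = id" and mu: "\<mu> permutes I" and pi: "\<pi> permutes I"
    and I: "I = A \<union> \<mu> ` A" and fix1: "\<And>a b. a \<in> A \<Longrightarrow> b \<in> A \<Longrightarrow> \<mu> a \<in> A \<Longrightarrow> \<mu> b \<in> A \<Longrightarrow> a = b"
  shows "\<exists>g f. (\<forall>a\<in>A. g a \<in> {a, \<mu> a} \<and> f a \<in> A \<and> \<pi> (g a) \<in> {f a, \<mu> (f a)}) \<and> bij_betw f A A"
proof -
  have mm: "\<mu> (\<mu> x) = x" for x using inv by (metis comp_apply id_apply)
  have minj: "inj \<mu>" using mu by (rule permutes_inj)
  let ?cl = "\<lambda>X. X \<union> \<mu> ` X"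
  define S where "S a = {b\<in>A. \<exists>x\<in>{a, \<mu> a}. \<pi> x \<in> {b, \<mu> b}}" for a
  have H: "card X \<le> card (\<Union>(S ` X))" if X: "X \<subseteq> A" for X
  proof -
    let ?Y = "\<Union>(S ` X)"
    have fX: "finite X" using X fA finite_subset by blast
    have YA: "?Y \<subseteq> A" by (auto simp: S_def)
    then have fY: "finite ?Y" using fA finite_subset by blast
    have i: "X \<inter> \<mu> ` X \<subseteq> {a\<in>X. \<mu> a \<in> A}"
    proof
      fix a assume "a \<in> X \<inter> \<mu> ` X"
      then obtain b where "a \<in> X" "b \<in> X" "a = \<mu> b" by blast
      then show "a \<in> {a\<in>X. \<mu> a \<in> A}" using X mm[of b] by auto
    qed
    have "card {a\<in>X. \<mu> a \<in> A} \<le> 1"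
      using fX fix1 X by (intro card_le_Suc0_iff_eq[THEN iffD2, unfolded One_nat_def[symmetric]]) auto
    moreover have "card (X \<inter> \<mu> ` X) \<le> card {a\<in>X. \<mu> a \<in> A}"
      using i fX by (intro card_mono) auto
    ultimately have "card (X \<inter> \<mu> ` X) \<le> 1" by linarith
    moreover have "card (X \<union> \<mu> ` X) + card (X \<inter> \<mu> ` X) = card X + card (\<mu> ` X)"
      using fX card_Un_Int[of X "\<mu> ` X"] by simp
    moreover have "card (\<mu> ` X) = card X" using minj by (simp add: card_image inj_on_subset)
    ultimately have 1: "2 * card X \<le> card (?cl X) + 1" by linarith
    have "\<pi> ` ?cl X \<subseteq> ?cl ?Y"
    proof
      fix z assume "z \<in> \<pi> ` ?cl X"
      then obtain a x where a: "a \<in> X" "x \<in> {a, \<mu> a}" "z = \<pi> x" by auto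
      then have "x \<in> I" using X I by auto
      then have "z \<in> I" using a(3) permutes_in_image[OF pi] by auto
      then obtain b where "b \<in> A" "z \<in> {b, \<mu> b}" using I by auto
      then have "b \<in> S a" using a by (auto simp: S_def)
      then show "z \<in> ?cl ?Y" using \<open>z \<in> {b, \<mu> b}\<close> a by auto
    qed
    then have "card (\<pi> ` ?cl X) \<le> card (?cl ?Y)" using fY by (intro card_mono) auto
    moreover have "card (\<pi> ` ?cl X) = card (?cl X)"
      using permutes_inj[OF pi] by (simp add: card_image inj_on_subset)
    moreover have "card (?cl ?Y) \<le> card ?Y + card ?Y"
      by (meson add_left_mono card_Un_le card_image_le fY le_trans)
    ultimately show ?thesis using 1 by linarith
  qed
  obtain f where f: "inj_on f A" "\<forall>a\<in>A. f a \<in> S a"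
    using hall[of A S] fA H by (auto simp: S_def)
  have "f ` A \<subseteq> A" using f by (auto simp: S_def)
  then have bij: "bij_betw f A A" using f(1) fA by (simp add: bij_betw_def endo_inj_surj)
  have "\<forall>a\<in>A. \<exists>x\<in>{a, \<mu> a}. \<pi> x \<in> {f a, \<mu> (f a)}" using f by (auto simp: S_def)
  then obtain g where "\<forall>a\<in>A. g a \<in> {a, \<mu> a} \<and> \<pi> (g a) \<in> {f a, \<mu> (f a)}" by metis
  moreover have "\<forall>a\<in>A. f a \<in> A" using \<open>f ` A \<subseteq> A\<close> by blast
  ultimately show ?thesis using bij by (intro exI[of _ g] exI[of _ f]) blast
qed

text \<open>If both elements of a class were chosen, they would be chosen by different elements of
  \<open>A\<close> in the same class, and \<open>A\<close> has only one there. So a new choice of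
  representatives again has the two properties A1 and A2.\<close>

lemma transversal_exactly_one:
  assumes inv: "\<mu> \<circ> \<mu> = id" and mu: "\<mu> permutes I"
    and A1: "\<And>x. x \<in> I \<Longrightarrow> \<mu> x \<noteq> x \<Longrightarrow> x \<in> A \<longleftrightarrow> \<mu> x \<notin> A"
    and A2: "\<And>x. x \<in> I \<Longrightarrow> \<mu> x = x \<Longrightarrow> x \<in> A"
    and g: "\<And>a. a \<in> A \<Longrightarrow> g a \<in> {a, \<mu> a}" and x: "x \<in> I"
  shows "\<mu> x \<noteq> x \<Longrightarrow> x \<in> g ` A \<longleftrightarrow> \<mu> x \<notin> g ` A" and "\<mu> x = x \<Longrightarrow> x \<in> g ` A"
proof -
  have mm: "\<mu> (\<mu> x) = x" for x using inv by (metis comp_apply id_apply)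
  show "x \<in> g ` A" if "\<mu> x = x"
    using A2[OF x that] g[of x] that by force
  show "x \<in> g ` A \<longleftrightarrow> \<mu> x \<notin> g ` A" if ne: "\<mu> x \<noteq> x"
  proof
    assume "x \<in> g ` A"
    then obtain a where a: "a \<in> A" "x = g a" by auto
    then have a': "a = x \<or> a = \<mu> x" using g[of a] mm by auto
    show "\<mu> x \<notin> g ` A"
    proof
      assume "\<mu> x \<in> g ` A"
      then obtain b where b: "b \<in> A" "\<mu> x = g b" by auto
      then have "b = x \<or> b = \<mu> x" using g[of b] mm by (metis insertE singletonD)
      then show False using a a' b A1[OF x ne] ne by auto
    qed
  next
    assume *: "\<mu> x \<notin> g ` A"
    show "x \<in> g ` A"
    proof (cases "x \<in> A")
      case True
      then show ?thesis using g[of x] * by (metis imageI insertE singletonD)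
    next
      case False
      then have "\<mu> x \<in> A" using A1[OF x ne] by simp
      then show ?thesis using g[of "\<mu> x"] * mm by (metis imageI insertE singletonD)
    qed
  qed
qed

text \<open>Cross the switch of a class exactly when \<open>A\<close> and \<open>C\<close> pick
  different elements of it. Such a setting is its own inverse, so it can be moved to the other side
  of an equation.\<close>

lemma switching_between_transversals:
  assumes inv: "\<mu> \<circ> \<mu> = id" and mu: "\<mu> permutes I"
    and A1: "\<And>x. x \<in> I \<Longrightarrow> \<mu> x \<noteq> x \<Longrightarrow> x \<in> A \<longleftrightarrow> \<mu> x \<notin> A"
    and A2: "\<And>x. x \<in> I \<Longrightarrow> \<mu> x = x \<Longrightarrow> x \<in> A"
    and C1: "\<And>x. x \<in> I \<Longrightarrow> \<mu> x \<noteq> x \<Longrightarrow> x \<in> C \<longleftrightarrow> \<mu> x \<notin> C"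
    and C2: "\<And>x. x \<in> I \<Longrightarrow> \<mu> x = x \<Longrightarrow> x \<in> C"
  shows "\<exists>\<sigma>\<in>switchings I \<mu>. \<sigma> \<circ> \<sigma> = id \<and> (\<forall>x\<in>I. \<sigma> x \<in> A \<longleftrightarrow> x \<in> C)"
proof -
  have mm: "\<mu> (\<mu> x) = x" for x using inv by (metis comp_apply id_apply)
  have mI: "\<mu> x \<in> I \<longleftrightarrow> x \<in> I" for x using mu by (rule permutes_in_image)
  define \<sigma> where "\<sigma> x = (if x \<in> I \<and> (x \<in> C) \<noteq> (x \<in> A) then \<mu> x else x)" for x
  have ss: "\<sigma> (\<sigma> x) = x" for x
    using A1[of x] A2[of x] C1[of x] C2[of x] mm mI[of x] unfolding \<sigma>_def by (cases "\<mu> x = x") auto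
  then have "\<sigma> permutes I"
    unfolding permutes_def by (metis \<sigma>_def)
  then have "\<sigma> \<in> switchings I \<mu>" by (auto simp: switchings_def \<sigma>_def)
  moreover have "\<sigma> x \<in> A \<longleftrightarrow> x \<in> C" if "x \<in> I" for x
    using A1[of x] A2[of x] C1[of x] C2[of x] that unfolding \<sigma>_def by (cases "\<mu> x = x") auto
  ultimately show ?thesis using ss by (intro bexI[of _ \<sigma>]) auto
qed

lemma permutes_split:
  assumes p: "\<pi> permutes I" and I: "I = A \<union> B" "A \<inter> B = {}"
    and pres: "\<And>x. x \<in> I \<Longrightarrow> \<pi> x \<in> A \<longleftrightarrow> x \<in> A"
  shows "\<exists>\<alpha> \<beta>. \<alpha> permutes A \<and> \<beta> permutes B \<and> \<pi> = \<alpha> \<circ> \<beta>"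
proof (intro exI conjI)
  let ?r = "\<lambda>S x. if x \<in> S then \<pi> x else x"
  have presB: "\<pi> x \<in> B \<longleftrightarrow> x \<in> B" if "x \<in> I" for x
    using pres[OF that] permutes_in_image[OF p, of x] that I by auto
  have r: "?r S permutes S" if S: "S \<subseteq> I" "\<And>x. x \<in> I \<Longrightarrow> \<pi> x \<in> S \<longleftrightarrow> x \<in> S" for S
    unfolding permutes_def
  proof (intro conjI allI impI)
    show "\<And>x. x \<notin> S \<Longrightarrow> ?r S x = x" by simp
    fix y
    show "\<exists>!x. ?r S x = y"
    proof (cases "y \<in> S")
      case True
      then obtain x where x: "\<pi> x = y" "x \<in> I" using p S(1)
        by (metis permutes_in_image permutes_def subsetD)
      then have "x \<in> S" using S(2) True by auto
      then show ?thesis using x True S permutes_inj[OF p]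
        by (intro ex1I[of _ x]) (auto split: if_splits simp: inj_def)
    next
      case False
      then show ?thesis using S by (intro ex1I[of _ y]) (auto split: if_splits)
    qed
  qed
  show "?r A permutes A" using I pres by (intro r) auto
  show "?r B permutes B" using I presB by (intro r) auto
  show "\<pi> = ?r A \<circ> ?r B"
    using presB I permutes_not_in[OF p] by (auto simp: fun_eq_iff)
qed

text \<open>Elements are paired off two at a time. For odd size one element stays fixed and is put
  into \<open>A\<close>, which explains why \<open>A\<close> may be larger than its complement by
  one.\<close>

lemma halving_involution:
  assumes "finite I"
  shows "\<exists>\<mu> A. \<mu> permutes I \<and> \<mu> \<circ> \<mu> = id \<and> A \<subseteq> I \<and> 2 * card A \<le> card I + 1 \<and> 2 * card (I - A) \<le> card I
    \<and> (\<forall>x\<in>I. \<mu> x \<noteq> x \<longrightarrow> (x \<in> A \<longleftrightarrow> \<mu> x \<notin> A)) \<and> (\<forall>x\<in>I. \<mu> x = x \<longrightarrow> x \<in> A)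
    \<and> (\<forall>x\<in>I. \<forall>y\<in>I. \<mu> x = x \<longrightarrow> \<mu> y = y \<longrightarrow> x = y)"
  using assms
proof (induction "card I" arbitrary: I rule: less_induct)
  case less
  consider "I = {}" | a where "I = {a}" | a b J where "I = insert a (insert b J)" "a \<noteq> b" "a \<notin> J" "b \<notin> J"
    by (metis insertCI mk_disjoint_insert subsetI subset_singletonD subset_singleton_iff ex_in_conv)
  then show ?case
  proof cases
    case 1
    then show ?thesis by (intro exI[of _ id] exI[of _ "{}"]) (auto simp: permutes_id)
  next
    case (2 a)
    then show ?thesis by (intro exI[of _ id] exI[of _ "{a}"]) (auto simp: permutes_id)
  next
    case (3 a b J)
    have fJ: "finite J" using 3 less.prems by auto
    have cI: "card I = card J + 2" using 3 fJ by auto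
    obtain \<mu> A where h: "\<mu> permutes J" "\<mu> \<circ> \<mu> = id" "A \<subseteq> J" "2 * card A \<le> card J + 1" "2 * card (J - A) \<le> card J"
      "\<forall>x\<in>J. \<mu> x \<noteq> x \<longrightarrow> (x \<in> A \<longleftrightarrow> \<mu> x \<notin> A)" "\<forall>x\<in>J. \<mu> x = x \<longrightarrow> x \<in> A"
      "\<forall>x\<in>J. \<forall>y\<in>J. \<mu> x = x \<longrightarrow> \<mu> y = y \<longrightarrow> x = y"
      using less.hyps[of J] fJ cI by auto
    let ?\<mu> = "\<mu> \<circ> transpose a b"
    have d: "J \<inter> {a, b} = {}" using 3 by auto
    have tp: "transpose a b permutes {a, b}" by (simp add: permutes_swap_id)
    have I: "J \<union> {a, b} = I" using 3 by auto
    have m: "?\<mu> permutes I" "?\<mu> \<circ> ?\<mu> = id"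
      using involution_Un[OF h(1) tp h(2) _ d] I by simp_all
    have ma: "?\<mu> a = b" "?\<mu> b = a" using 3 permutes_not_in[OF h(1)] by auto
    have mJ: "?\<mu> x = \<mu> x" if "x \<in> J" for x using that 3 by (auto simp: transpose_def)
    have muJ: "\<mu> x \<in> J" if "x \<in> J" for x using that h(1) by (simp add: permutes_in_image)
    have fA: "finite A" using h(3) fJ finite_subset by blast
    have cA: "card (insert a A) = card A + 1" using fA h(3) 3 by (subst card_insert_disjoint) auto
    have "I - insert a A = insert b (J - A)" using 3 h(3) by auto
    then have cB: "card (I - insert a A) = card (J - A) + 1" using fJ 3 by (auto simp: card_insert_if)
    show ?thesis
    proof (intro exI[of _ ?\<mu>] exI[of _ "insert a A"] conjI m ballI)
      show "insert a A \<subseteq> I" using h(3) 3 by auto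
      show "2 * card (insert a A) \<le> card I + 1" using cA cI h(4) by simp
      show "2 * card (I - insert a A) \<le> card I" using cB cI h(5) by simp
      fix x assume x: "x \<in> I"
      then consider "x = a" | "x = b" | "x \<in> J" using 3 by auto
      note xc = this
      then show "?\<mu> x \<noteq> x \<longrightarrow> (x \<in> insert a A \<longleftrightarrow> ?\<mu> x \<notin> insert a A)"
      proof cases
        case 1
        then show ?thesis using ma 3 h(3) by auto
      next
        case 2
        then show ?thesis using ma 3 h(3) by auto
      next
        case xJ: 3
        then have "x \<noteq> a" "\<mu> x \<noteq> a" using 3 muJ by auto
        then show ?thesis using h(6) mJ xJ by auto
      qed
      from xc show "?\<mu> x = x \<longrightarrow> x \<in> insert a A"
        using ma 3 h(7) mJ by cases auto
      fix y assume y: "y \<in> I"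
      show "?\<mu> x = x \<longrightarrow> ?\<mu> y = y \<longrightarrow> x = y"
        using x y ma h(8) mJ 3(1,2) by (metis insertE)
    qed
  qed
qed

text \<open>The first and the last layer switch so that the permutation left for the middle preserves both halves;
  the halves are then routed recursively and in parallel.\<close>

lemma benes_network:
  assumes "finite I" "card I \<le> 2 ^ d"
  shows "\<exists>Ms. length Ms = 2 * d \<and> (\<forall>\<mu>\<in>set Ms. \<mu> permutes I \<and> \<mu> \<circ> \<mu> = id)
    \<and> (\<forall>\<pi>. \<pi> permutes I \<longrightarrow> \<pi> \<in> realizable I Ms)"
  using assms
proof (induction d arbitrary: I)
  case 0
  have "\<pi> = id" if "\<pi> permutes I" for \<pi>
  proof
    fix x
    have "\<pi> x \<in> I" if "x \<in> I" using that \<open>\<pi> permutes I\<close> by (simp add: permutes_in_image)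
    moreover have "\<forall>x\<in>I. \<forall>y\<in>I. x = y" using 0 by (simp add: card_le_Suc0_iff_eq)
    ultimately show "\<pi> x = id x" using permutes_not_in[OF that, of x] by (cases "x \<in> I") auto
  qed
  then show ?case by (intro exI[of _ "[]"]) auto
next
  case (Suc d)
  obtain \<mu> A where mu: "\<mu> permutes I" "\<mu> \<circ> \<mu> = id" and A: "A \<subseteq> I" "2 * card A \<le> card I + 1" "2 * card (I - A) \<le> card I"
    and A1: "\<And>x. x \<in> I \<Longrightarrow> \<mu> x \<noteq> x \<Longrightarrow> x \<in> A \<longleftrightarrow> \<mu> x \<notin> A" and A2: "\<And>x. x \<in> I \<Longrightarrow> \<mu> x = x \<Longrightarrow> x \<in> A"
    and A3: "\<And>x y. x \<in> I \<Longrightarrow> y \<in> I \<Longrightarrow> \<mu> x = x \<Longrightarrow> \<mu> y = y \<Longrightarrow> x = y"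
    using halving_involution[OF Suc.prems(1)] by blast
  have mI: "\<mu> x \<in> I \<longleftrightarrow> x \<in> I" for x using mu(1) by (rule permutes_in_image)
  have mm: "\<mu> (\<mu> x) = x" for x using mu(2) by (metis comp_apply id_apply)
  let ?B = "I - A"
  have AB: "A \<union> ?B = I" "A \<inter> ?B = {}" using A by auto
  have fA: "finite A" "finite ?B" using A Suc.prems finite_subset by blast+
  have c: "card A \<le> 2 ^ d" "card ?B \<le> 2 ^ d" using A Suc.prems(2) by auto
  obtain Ms where Ms: "length Ms = 2 * d" "\<forall>\<mu>\<in>set Ms. \<mu> permutes A \<and> \<mu> \<circ> \<mu> = id"
    "\<forall>\<pi>. \<pi> permutes A \<longrightarrow> \<pi> \<in> realizable A Ms"
    using Suc.IH[OF fA(1) c(1)] by blast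
  obtain Ns where Ns: "length Ns = 2 * d" "\<forall>\<mu>\<in>set Ns. \<mu> permutes ?B \<and> \<mu> \<circ> \<mu> = id"
    "\<forall>\<pi>. \<pi> permutes ?B \<longrightarrow> \<pi> \<in> realizable ?B Ns"
    using Suc.IH[OF fA(2) c(2)] by blast
  let ?L = "map2 (\<circ>) Ms Ns"
  have inv: "\<nu> permutes I \<and> \<nu> \<circ> \<nu> = id" if "\<nu> \<in> set ?L" for \<nu>
  proof -
    obtain \<alpha> \<beta> where ab: "\<nu> = \<alpha> \<circ> \<beta>" "\<alpha> \<in> set Ms" "\<beta> \<in> set Ns"
      using \<open>\<nu> \<in> set ?L\<close> by (auto dest: set_zip_leftD set_zip_rightD)
    then have "\<alpha> permutes A" "\<alpha> \<circ> \<alpha> = id" "\<beta> permutes ?B" "\<beta> \<circ> \<beta> = id" using Ms Ns by auto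
    then show ?thesis using involution_Un[of \<alpha> A \<beta> ?B] AB ab by simp
  qed
  have real: "\<pi> \<in> realizable I (\<mu> # ?L @ [\<mu>])" if pi: "\<pi> permutes I" for \<pi>
  proof -
    have IA: "I = A \<union> \<mu> ` A"
    proof
      show "I \<subseteq> A \<union> \<mu> ` A"
      proof
        fix x assume "x \<in> I"
        then show "x \<in> A \<union> \<mu> ` A" using A1[of x] A2[of x] mm[of x] by (metis UnI1 UnI2 imageI)
      qed
      show "A \<union> \<mu> ` A \<subseteq> I" using A mI by auto
    qed
    have fix1: "a = b" if "a \<in> A" "b \<in> A" "\<mu> a \<in> A" "\<mu> b \<in> A" for a b
      using that A1[of a] A1[of b] A3[of a b] A(1) by blast
    obtain g f where gf: "\<forall>a\<in>A. g a \<in> {a, \<mu> a} \<and> f a \<in> A \<and> \<pi> (g a) \<in> {f a, \<mu> (f a)}" "bij_betw f A A"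
      using transversal_of_classes[OF fA(1) mu(2) mu(1) pi IA fix1] by blast
    let ?C = "g ` A"
    \<comment> \<open>The chosen images under \<pi>, indexed by the class into which they fall: this
      exhibits the image of \<open>?C\<close> under \<pi> as a transversal too.\<close>
    let ?k = "\<lambda>b. \<pi> (g (inv_into A f b))"
    have k: "?k b \<in> {b, \<mu> b}" if "b \<in> A" for b
    proof -
      have "inv_into A f b \<in> A" "f (inv_into A f b) = b"
        using that gf(2) by (auto simp: bij_betw_def inv_into_into f_inv_into_f)
      then show ?thesis using gf(1) by metis
    qed
    have "inv_into A f ` A = A" using gf(2) by (metis bij_betw_def bij_betw_inv_into)
    then have D: "?k ` A = \<pi> ` ?C" by (metis image_image)
    have g: "g a \<in> {a, \<mu> a}" if "a \<in> A" for a using gf(1) that by blast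
    obtain \<sigma> where s: "\<sigma> \<in> switchings I \<mu>" "\<sigma> \<circ> \<sigma> = id" "\<forall>x\<in>I. \<sigma> x \<in> A \<longleftrightarrow> x \<in> ?C"
      using switching_between_transversals[of \<mu> I A ?C, OF mu(2,1) A1 A2]
        transversal_exactly_one[OF mu(2,1) A1 A2 g] by blast
    obtain \<tau> where t: "\<tau> \<in> switchings I \<mu>" "\<tau> \<circ> \<tau> = id" "\<forall>x\<in>I. \<tau> x \<in> A \<longleftrightarrow> x \<in> ?k ` A"
      using switching_between_transversals[of \<mu> I A "?k ` A", OF mu(2,1) A1 A2]
        transversal_exactly_one[OF mu(2,1) A1 A2 k] by blast
    have sp: "\<sigma> permutes I" "\<tau> permutes I" using s t by (auto simp: switchings_def)
    let ?\<pi> = "\<tau> \<circ> \<pi> \<circ> \<sigma>"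
    have p': "?\<pi> permutes I" using sp pi by (intro permutes_compose)
    have pres: "?\<pi> x \<in> A \<longleftrightarrow> x \<in> A" if "x \<in> I" for x
    proof -
      have i: "\<sigma> x \<in> I" "\<pi> (\<sigma> x) \<in> I" using that sp pi by (simp_all add: permutes_in_image)
      have "x \<in> A \<longleftrightarrow> \<sigma> x \<in> ?C" using s(2,3) i(1) by (metis comp_apply id_apply)
      also have "\<dots> \<longleftrightarrow> \<pi> (\<sigma> x) \<in> \<pi> ` ?C" using permutes_inj[OF pi] by (simp add: inj_image_mem_iff)
      also have "\<dots> \<longleftrightarrow> ?\<pi> x \<in> A" using t(3) i(2) D by simp
      finally show ?thesis by simp
    qed
    obtain \<alpha> \<beta> where ab: "\<alpha> permutes A" "\<beta> permutes ?B" "?\<pi> = \<alpha> \<circ> \<beta>"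
      using permutes_split[OF p' _ AB(2) pres] AB(1) by metis
    have "\<alpha> \<circ> \<beta> \<in> realizable (A \<union> ?B) ?L"
      using ab Ms Ns AB by (intro realizable_Un) auto
    then have "\<tau> \<circ> ?\<pi> \<in> realizable I (?L @ [\<mu>])"
      using t(1) ab(3) AB by (intro realizable_append) auto
    then have "(\<tau> \<circ> ?\<pi>) \<circ> \<sigma> \<in> realizable I (\<mu> # ?L @ [\<mu>])" using s(1) by auto
    moreover have "(\<tau> \<circ> ?\<pi>) \<circ> \<sigma> = (\<tau> \<circ> \<tau>) \<circ> \<pi> \<circ> (\<sigma> \<circ> \<sigma>)" by (simp add: comp_assoc)
    ultimately show ?thesis using s(2) t(2) by simp
  qed
  have "length (\<mu> # ?L @ [\<mu>]) = 2 * Suc d" using Ms(1) Ns(1) by simp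
  moreover have "\<forall>\<nu>\<in>set (\<mu> # ?L @ [\<mu>]). \<nu> permutes I \<and> \<nu> \<circ> \<nu> = id"
    using inv mu unfolding set_simps set_append by blast
  ultimately show ?case using real by blast
qed

section \<open>Extendability\<close>

text \<open>
  \<open>S\<close> is the set of vertices used so far and \<open>c u\<close> the number of further neighbours reserved for \<open>u\<close>. The elements
  of \<open>P\<close> are ports rather than vertices: later every vertex has an outgoing and an incoming port, so that directed
  and alternating paths are treated alike.
\<close>

definition extendable :: "('p \<Rightarrow> 'a set) \<Rightarrow> 'p set \<Rightarrow> nat \<Rightarrow> 'a set \<Rightarrow> ('p \<Rightarrow> int) \<Rightarrow> bool" where
  "extendable N P p S c \<longleftrightarrow> (\<forall>U\<subseteq>P. card U \<le> 2 * p \<longrightarrow> sum c U \<le> int (card (\<Union>(N ` U) - S)))"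

lemma extendable_mono:
  assumes "extendable N P p S c" "\<And>u. u \<in> P \<Longrightarrow> c' u \<le> c u"
  shows "extendable N P p S c'"
  unfolding extendable_def
proof (intro allI impI)
  fix U assume U: "U \<subseteq> P" "card U \<le> 2 * p"
  have "sum c' U \<le> sum c U" using U assms(2) by (intro sum_mono) auto
  also have "\<dots> \<le> int (card (\<Union>(N ` U) - S))" using assms(1) U by (auto simp: extendable_def)
  finally show "sum c' U \<le> int (card (\<Union>(N ` U) - S))" .
qed

text \<open>If no \<open>y\<close> works, then each \<open>y\<close> is adjacent to a tight set of ports avoiding \<open>s\<close>. Tight sets are closed under
  union by submodularity, and a tight set that sees all of \<open>N s - S\<close> is violated after adding \<open>s\<close>.\<close>

lemma extendable_add:
  assumes fP: "finite P" and fN: "\<And>u. u \<in> P \<Longrightarrow> finite (N u)" and ext: "extendable N P p S c" and p: "1 \<le> p"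
    and slack: "\<And>U. U \<subseteq> P \<Longrightarrow> p \<le> card U \<Longrightarrow> card U \<le> 2 * p \<Longrightarrow> sum c U < int (card (\<Union>(N ` U) - S))"
    and s: "s \<in> P" "1 \<le> c s"
  shows "\<exists>y\<in>N s - S. extendable N P p (insert y S) (c(s := c s - 1))"
proof (rule ccontr)
  assume no: "\<not> ?thesis"
  let ?\<Gamma> = "\<lambda>U. \<Union>(N ` U) - S"
  define tight where "tight U \<longleftrightarrow> U \<subseteq> P \<and> card U < p \<and> int (card (?\<Gamma> U)) \<le> sum c U \<and> s \<notin> U" for U
  have fU: "finite U" if "U \<subseteq> P" for U using that fP finite_subset by blast
  have fG: "finite (?\<Gamma> U)" if "U \<subseteq> P" for U using that fU[OF that] fN by auto
  have extU: "sum c U \<le> int (card (?\<Gamma> U))" if "U \<subseteq> P" "card U \<le> 2 * p" for U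
    using ext that by (auto simp: extendable_def)
  have bad: "\<exists>U. tight U \<and> y \<in> ?\<Gamma> U" if y: "y \<in> N s - S" for y
  proof -
    let ?c = "c(s := c s - 1)"
    have "\<not> extendable N P p (insert y S) ?c" using no y by blast
    then obtain U where U: "U \<subseteq> P" "card U \<le> 2 * p" "int (card (\<Union>(N ` U) - insert y S)) < sum ?c U"
      by (auto simp: extendable_def not_le)
    have e: "\<Union>(N ` U) - insert y S = ?\<Gamma> U - {y}" by auto
    have cd: "card (?\<Gamma> U) \<le> card (?\<Gamma> U - {y}) + 1"
      using card_Diff_singleton_if[of "?\<Gamma> U" y] by (auto split: if_splits)
    \<comment> \<open>When \<open>s\<close> belongs to \<open>U\<close>, the demand of
      \<open>U\<close> drops by one while its neighbourhood loses at most \<open>y\<close>; such a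
      set cannot become violated.\<close>
    have sU: "s \<notin> U"
    proof
      assume sU: "s \<in> U"
      have "sum ?c U = ?c s + sum ?c (U - {s})" using fU[OF U(1)] sU by (rule sum.remove)
      also have "sum ?c (U - {s}) = sum c (U - {s})" by (intro sum.cong) auto
      also have "?c s + sum c (U - {s}) = sum c U - 1" using sum.remove[OF fU[OF U(1)] sU, of c] by simp
      finally show False using U(3) extU[OF U(1,2)] cd unfolding e by linarith
    qed
    then have sc: "sum ?c U = sum c U" by (intro sum.cong) auto
    have yG: "y \<in> ?\<Gamma> U"
    proof (rule ccontr)
      assume "y \<notin> ?\<Gamma> U"
      then have "?\<Gamma> U - {y} = ?\<Gamma> U" by blast
      then have "card (?\<Gamma> U - {y}) = card (?\<Gamma> U)" by (rule arg_cong)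
      then show False using U(3) extU[OF U(1,2)] sc unfolding e by linarith
    qed
    have t: "int (card (?\<Gamma> U)) \<le> sum c U" using U(3) cd sc unfolding e by linarith
    then have "card U < p" using slack[OF U(1) _ U(2)] by fastforce
    then show ?thesis using U t sU yG unfolding tight_def by blast
  qed
  have closed: "tight (U \<union> U')" if t: "tight U" "tight U'" for U U'
  proof -
    have P: "U \<subseteq> P" "U' \<subseteq> P" "U \<union> U' \<subseteq> P" "U \<inter> U' \<subseteq> P" using t by (auto simp: tight_def)
    have 1: "sum c (U \<union> U') = sum c U + sum c U' - sum c (U \<inter> U')"
      using fU P by (intro sum_Un) auto
    have 2: "?\<Gamma> (U \<union> U') = ?\<Gamma> U \<union> ?\<Gamma> U'" by auto
    have 3: "card (?\<Gamma> U) + card (?\<Gamma> U') = card (?\<Gamma> U \<union> ?\<Gamma> U') + card (?\<Gamma> U \<inter> ?\<Gamma> U')"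
      using fG P by (intro card_Un_Int) auto
    have "card (U \<inter> U') \<le> card U" using fU P by (intro card_mono) auto
    then have "sum c (U \<inter> U') \<le> int (card (?\<Gamma> (U \<inter> U')))"
      using t P by (intro extU) (auto simp: tight_def)
    also have "card (?\<Gamma> (U \<inter> U')) \<le> card (?\<Gamma> U \<inter> ?\<Gamma> U')" using fG P by (intro card_mono) auto
    finally have 4: "sum c (U \<inter> U') \<le> int (card (?\<Gamma> U \<inter> ?\<Gamma> U'))" by simp
    have 5: "int (card (?\<Gamma> (U \<union> U'))) \<le> sum c (U \<union> U')"
      using 1 3 4 t unfolding 2 tight_def by linarith
    \<comment> \<open>Two tight sets have fewer than \<open>2 * p\<close> elements together. In the
      range from \<open>p\<close> to \<open>2 * p\<close> the slack forbids tightness, so the tight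
      union falls below \<open>p\<close> again and the process can be iterated.\<close>
    have "card (U \<union> U') \<le> card U + card U'" by (rule card_Un_le)
    then have "card (U \<union> U') < p" using slack[OF P(3)] 5 t unfolding tight_def by fastforce
    then show ?thesis using 5 P t unfolding tight_def by blast
  qed
  have "\<exists>U. tight U \<and> Y \<subseteq> ?\<Gamma> U" if "finite Y" "Y \<subseteq> N s - S" for Y
    using that
  proof (induction Y)
    case empty
    then show ?case using p by (intro exI[of _ "{}"]) (auto simp: tight_def)
  next
    case (insert y Y)
    obtain U where "tight U" "Y \<subseteq> ?\<Gamma> U" using insert by blast
    moreover obtain U' where "tight U'" "y \<in> ?\<Gamma> U'" using bad insert.prems by blast
    ultimately show ?case using closed by (intro exI[of _ "U \<union> U'"]) auto
  qed
  then obtain U where U: "tight U" "N s - S \<subseteq> ?\<Gamma> U" using fN[OF s(1)] by blast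
  have UP: "insert s U \<subseteq> P" "U \<subseteq> P" using U s by (auto simp: tight_def)
  have "?\<Gamma> (insert s U) = ?\<Gamma> U" using U(2) by auto
  moreover have "sum c (insert s U) = c s + sum c U" using U fU[OF UP(2)] by (simp add: tight_def)
  moreover have "card (insert s U) \<le> 2 * p" using U fU[OF UP(2)] by (simp add: tight_def card_insert_if)
  ultimately show False using extU[OF UP(1)] U(1) s(2) unfolding tight_def by fastforce
qed

text \<open>\<open>par\<close> maps a vertex to the port from which it was attached, so this number
  is the part of the demand of \<open>u\<close> that has been spent. It is an integer because it is
  subtracted from demands.\<close>

definition children :: "'a set \<Rightarrow> ('a \<Rightarrow> 'p) \<Rightarrow> 'p \<Rightarrow> int" where
  "children T par u = int (card {y\<in>T. par y = u})"

lemma children_Un: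
  assumes "finite T" "finite T'" "T \<inter> T' = {}"
  shows "children (T \<union> T') par u = children T par u + children T' par u"
proof -
  have "{y \<in> T \<union> T'. par y = u} = {y\<in>T. par y = u} \<union> {y\<in>T'. par y = u}" by auto
  then show ?thesis using assms unfolding children_def
    by (subst card_Un_disjoint[symmetric, THEN arg_cong[of _ _ int], simplified]) auto
qed

lemma children_cong: "(\<And>y. y \<in> T \<Longrightarrow> par y = par' y) \<Longrightarrow> children T par u = children T par' u"
  unfolding children_def by (rule arg_cong[of _ _ "\<lambda>S. int (card S)"]) auto

lemma children_eq_0: "(\<And>y. y \<in> T \<Longrightarrow> par y \<noteq> u) \<Longrightarrow> children T par u = 0"
  unfolding children_def by (subst Collect_empty_eq[THEN iffD2]) auto

lemma children_empty [simp]: "children {} par u = 0"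
  by (simp add: children_def)

lemma sum_children:
  assumes "finite T" "finite U"
  shows "sum (children T par) U = int (card {y\<in>T. par y \<in> U})"
proof -
  have "card (\<Union>u\<in>U. {y\<in>T. par y = u}) = (\<Sum>u\<in>U. card {y\<in>T. par y = u})"
    using assms by (intro card_UN_disjoint) auto
  moreover have "(\<Union>u\<in>U. {y\<in>T. par y = u}) = {y\<in>T. par y \<in> U}" by auto
  ultimately show ?thesis by (simp add: children_def)
qed

text \<open>A tree of extensions may be pruned to any subset: each removed vertex returns to
  the neighbourhood of its parent, which pays for the demand that the parent regains.\<close>

lemma extendable_rollback:
  assumes fP: "finite P" and fN: "\<And>u. u \<in> P \<Longrightarrow> finite (N u)"
    and ext: "extendable N P p (S \<union> T) (\<lambda>u. c u - children T par u)"
    and T: "S \<inter> T = {}" "finite T" "\<And>y. y \<in> T \<Longrightarrow> y \<in> N (par y)" "T' \<subseteq> T"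
  shows "extendable N P p (S \<union> T') (\<lambda>u. c u - children T' par u)"
  unfolding extendable_def
proof (intro allI impI)
  fix U assume U: "U \<subseteq> P" "card U \<le> 2 * p"
  have fU: "finite U" using U fP finite_subset by blast
  have fT': "finite T'" using T finite_subset by blast
  define D where "D = {y\<in>T - T'. par y \<in> U}"
  have fD: "finite D" using T by (auto simp: D_def)
  have "children T par u = children T' par u + children (T - T') par u" for u
    using children_Un[of T' "T - T'" par u] T fT' by (simp add: Un_absorb1)
  then have "sum (\<lambda>u. c u - children T' par u) U = sum (\<lambda>u. c u - children T par u) U + sum (children (T - T') par) U"
    by (simp add: sum.distrib[symmetric])
  also have "sum (children (T - T') par) U = int (card D)"
    unfolding D_def using T fU by (intro sum_children) auto
  also have "sum (\<lambda>u. c u - children T par u) U \<le> int (card (\<Union>(N ` U) - (S \<union> T)))"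
    using ext U by (auto simp: extendable_def)
  finally have "sum (\<lambda>u. c u - children T' par u) U \<le> int (card (\<Union>(N ` U) - (S \<union> T)) + card D)" by simp
  also have "card (\<Union>(N ` U) - (S \<union> T)) + card D = card ((\<Union>(N ` U) - (S \<union> T)) \<union> D)"
    using fU U fN fD by (intro card_Un_disjoint[symmetric]) (auto simp: D_def)
  also have "\<dots> \<le> card (\<Union>(N ` U) - (S \<union> T'))"
    using fU U fN T by (intro card_mono) (auto simp: D_def)
  finally show "sum (\<lambda>u. c u - children T' par u) U \<le> int (card (\<Union>(N ` U) - (S \<union> T')))" by simp
qed

section \<open>Walks with a prescribed pattern of directions\<close>

definition step :: "('a \<times> 'a) set \<Rightarrow> bool \<Rightarrow> 'a \<Rightarrow> 'a \<Rightarrow> bool" where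
  "step E b x y = (if b then (x, y) \<in> E else (y, x) \<in> E)"

text \<open>The list leaves out the start \<open>a\<close>: the start is an old vertex, whereas
  \<open>ys\<close> collects the vertices that become used. A constant pattern gives directed paths,
  an alternating one gives the cycles of the switches.\<close>

fun pwalk :: "('a \<times> 'a) set \<Rightarrow> bool list \<Rightarrow> 'a \<Rightarrow> 'a list \<Rightarrow> bool" where
  "pwalk E [] a ys = (ys = [])"
| "pwalk E (b # bs) a [] = False"
| "pwalk E (b # bs) a (y # ys) = (step E b a y \<and> pwalk E bs y ys)"

lemma pwalk_append:
  "pwalk E bs a ys \<Longrightarrow> pwalk E bs' (last (a # ys)) zs \<Longrightarrow> pwalk E (bs @ bs') a (ys @ zs)"
  by (induction E bs a ys rule: pwalk.induct) auto

lemma pwalk_length: "pwalk E bs a ys \<Longrightarrow> length ys = length bs"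
  by (induction E bs a ys rule: pwalk.induct) auto

lemma pwalk_nth: "pwalk E bs a ys \<Longrightarrow> i < length bs \<Longrightarrow> step E (bs ! i) ((a # ys) ! i) ((a # ys) ! Suc i)"
proof (induction E bs a ys arbitrary: i rule: pwalk.induct)
  case (3 E b bs a y ys)
  then show ?case by (cases i) auto
qed auto

text \<open>The branch of a tree, read off from the parent ports. Keeping \<open>par\<close> instead
  of the arcs is what allows the demand along the branch to be counted by
  \<open>children\<close>.\<close>

fun parent_chain :: "('a \<Rightarrow> 'a \<times> bool) \<Rightarrow> bool list \<Rightarrow> 'a \<Rightarrow> 'a list \<Rightarrow> bool" where
  "parent_chain par [] a ys = (ys = [])"
| "parent_chain par (b # bs) a [] = False"
| "parent_chain par (b # bs) a (y # ys) = (par y = (a, b) \<and> parent_chain par bs y ys)"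

lemma parent_chain_cong:
  "parent_chain par bs a ys \<Longrightarrow> (\<And>y. y \<in> set ys \<Longrightarrow> par' y = par y) \<Longrightarrow> parent_chain par' bs a ys"
  by (induction par bs a ys rule: parent_chain.induct) auto

lemma parent_chain_parents:
  "parent_chain par bs a ys \<Longrightarrow> y \<in> set ys \<Longrightarrow> fst (par y) \<in> insert a (set ys)"
  by (induction par bs a ys rule: parent_chain.induct) auto

lemma parent_chain_inj:
  "parent_chain par bs a ys \<Longrightarrow> distinct (a # ys) \<Longrightarrow> inj_on par (set ys)"
proof (induction par bs a ys rule: parent_chain.induct)
  case (3 par b bs a y ys)
  have "par y \<notin> par ` set ys"
  proof
    assume "par y \<in> par ` set ys"
    then obtain z where "z \<in> set ys" "par y = par z" by auto
    then have "a \<in> insert y (set ys)" using parent_chain_parents[of par bs y ys z] 3 by auto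
    then show False using 3 by auto
  qed
  then show ?case using 3 by auto
qed auto

text \<open>Different vertices of a branch have different parents. So a tree pruned to a single
  branch costs each port at most one unit, and only at vertices of the branch.\<close>

lemma children_chain:
  assumes "parent_chain par bs a ys" "distinct (a # ys)"
  shows "children (set ys) par u \<le> (if fst u \<in> insert a (set ys) then 1 else 0)"
proof (cases "fst u \<in> insert a (set ys)")
  case True
  have "\<forall>x\<in>{y\<in>set ys. par y = u}. \<forall>z\<in>{y\<in>set ys. par y = u}. x = z"
    using parent_chain_inj[OF assms] by (auto dest: inj_onD)
  then have "card {y\<in>set ys. par y = u} \<le> 1"
    by (subst One_nat_def, subst card_le_Suc0_iff_eq) auto
  then show ?thesis using True by (simp add: children_def)
next
  case False
  then have "children (set ys) par u = 0"
    using parent_chain_parents[OF assms(1)] by (intro children_eq_0) auto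
  then show ?thesis by simp
qed

section \<open>Extendability in expanding digraphs\<close>

locale expander =
  fixes E :: "('a \<times> 'a) set" and V Z :: "'a set" and m :: nat
  assumes finV: "finite V" and ZV: "Z \<subseteq> V" and m: "1 \<le> m"
    and expands: "\<And>A. A \<subseteq> V \<Longrightarrow> card A \<le> m \<Longrightarrow> 16 * card A \<le> card (E `` A \<inter> Z) \<and> 16 * card A \<le> card (E\<inverse> `` A \<inter> Z)"
    and joined: "\<And>A B. A \<subseteq> V \<Longrightarrow> B \<subseteq> V \<Longrightarrow> A \<inter> B = {} \<Longrightarrow> m \<le> card A \<Longrightarrow> m \<le> card B \<Longrightarrow> \<exists>a\<in>A. \<exists>b\<in>B. (a, b) \<in> E"
begin

definition nb :: "'a \<times> bool \<Rightarrow> 'a set" where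
  "nb u = {y\<in>Z. step E (snd u) (fst u) y}"

text \<open>The demand 4 of a fresh vertex: one unit is lost when a path runs through it and one when that path is continued
  from its end, which leaves 2 for the binary trees and for the vertex of a switch that uses its outgoing port
  twice.\<close>

definition state :: "'a set \<Rightarrow> ('a \<times> bool \<Rightarrow> int) \<Rightarrow> bool" where
  "state S c \<longleftrightarrow> S \<subseteq> Z \<and> extendable nb (V \<times> UNIV) (2 * m) S c \<and> (\<forall>u. c u \<le> 4) \<and> (\<forall>v\<in>Z - S. \<forall>b. c (v, b) = 4)"

lemma finZ: "finite Z" using finV ZV finite_subset by blast

lemma finite_nb: "finite (nb u)" using finZ by (auto simp: nb_def)

lemma finite_state: "state S c \<Longrightarrow> finite S" using finZ finite_subset by (auto simp: state_def)

lemma state_mono: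
  assumes "state S c" "\<And>u. c' u \<le> c u" "\<And>v b. v \<in> Z - S \<Longrightarrow> c' (v, b) = 4"
  shows "state S c'"
  using assms extendable_mono[of nb "V \<times> UNIV" "2 * m" S c c'] order_trans[OF assms(2)]
  unfolding state_def by blast

lemma half_of_ports:
  assumes U: "U \<subseteq> V \<times> (UNIV :: bool set)"
  obtains A b where "A \<subseteq> V" "A \<times> {b} \<subseteq> U" "card U \<le> 2 * card A"
proof -
  define A where "A b = {v. (v, b) \<in> U}" for b
  have A: "A b \<subseteq> V" for b using U by (auto simp: A_def)
  have f: "finite (A b)" for b using A finV finite_subset by blast
  have "U = A True \<times> {True} \<union> A False \<times> {False}"
  proof (rule set_eqI)
    fix u :: "'a \<times> bool"
    show "u \<in> U \<longleftrightarrow> u \<in> A True \<times> {True} \<union> A False \<times> {False}"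
      by (cases u; cases "snd u") (auto simp: A_def)
  qed
  then have "card U = card (A True \<times> {True}) + card (A False \<times> {False})"
    using f card_Un_disjoint[of "A True \<times> {True}" "A False \<times> {False}"] by auto
  then have "card U = card (A True) + card (A False)" by (simp add: card_cartesian_product)
  then have "card U \<le> 2 * card (A True) \<or> card U \<le> 2 * card (A False)" by linarith
  then show ?thesis using that[of "A True" True] that[of "A False" False] A by (auto simp: A_def)
qed

lemma nb_image:
  assumes "A \<times> {b} \<subseteq> U"
  shows "(if b then E `` A else E\<inverse> `` A) \<inter> Z \<subseteq> \<Union>(nb ` U)"
proof
  fix y assume y: "y \<in> (if b then E `` A else E\<inverse> `` A) \<inter> Z"
  then obtain a where "a \<in> A" "step E b a y" by (cases b) (auto simp: step_def)
  then have "y \<in> nb (a, b)" "(a, b) \<in> U" using y assms by (auto simp: nb_def)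
  then show "y \<in> \<Union>(nb ` U)" by blast
qed

text \<open>The factor 16 of \<open>expands\<close> is 4 times 4. Half of at most
  \<open>4 * m\<close> ports have the same direction; cutting their vertices down to at most
  \<open>m\<close> keeps a quarter of the number of ports, and every port demands 4.\<close>

lemma initial_state: "state {} (\<lambda>_. 4)"
proof -
  have "4 * int (card U) \<le> int (card (\<Union>(nb ` U)))" if U: "U \<subseteq> V \<times> UNIV" "card U \<le> 2 * (2 * m)" for U
  proof -
    obtain A b where A: "A \<subseteq> V" "A \<times> {b} \<subseteq> U" "card U \<le> 2 * card A" using half_of_ports[OF U(1)] .
    obtain A' where A': "A' \<subseteq> A" "card A' \<le> m" "card U \<le> 4 * card A'"
    proof (cases "card A \<le> m")
      case True
      then show ?thesis using that[of A] A by auto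
    next
      case False
      then obtain A' where "A' \<subseteq> A" "card A' = m" by (meson nat_le_linear obtain_subset_with_card_n)
      then show ?thesis using that[of A'] U by auto
    qed
    have s: "A' \<subseteq> V" "A' \<times> {b} \<subseteq> U" using A A' by auto
    have "16 * card A' \<le> card ((if b then E `` A' else E\<inverse> `` A') \<inter> Z)"
      using expands[OF s(1) A'(2)] by auto
    also have "\<dots> \<le> card (\<Union>(nb ` U))"
    proof (rule card_mono)
      show "finite (\<Union>(nb ` U))" using finZ by (rule finite_subset[rotated]) (auto simp: nb_def)
    qed (rule nb_image[OF s(2)])
    finally show ?thesis using A'(3) by linarith
  qed
  then show ?thesis by (auto simp: state_def extendable_def mult.commute)
qed

text \<open>The 18 is 2 + 16. By \<open>joined\<close>, \<open>m\<close> vertices with ports of one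
  direction miss fewer than \<open>m\<close> vertices of \<open>Z\<close> outside themselves, so
  fewer than \<open>2 * m\<close> vertices of \<open>Z\<close> escape the neighbourhood; at most
  \<open>4 * m\<close> ports demand at most \<open>16 * m\<close> vertices.\<close>

lemma slack:
  assumes st: "state S c" and S: "card S + 18 * m < card Z"
    and U: "U \<subseteq> V \<times> UNIV" "2 * m \<le> card U" "card U \<le> 2 * (2 * m)"
  shows "sum c U < int (card (\<Union>(nb ` U) - S))"
proof -
  obtain A0 b where A0: "A0 \<subseteq> V" "A0 \<times> {b} \<subseteq> U" "card U \<le> 2 * card A0" using half_of_ports[OF U(1)] .
  then have "m \<le> card A0" using U(2) by linarith
  then obtain A where A1: "A \<subseteq> A0" "card A = m" by (meson obtain_subset_with_card_n)
  then have A: "A \<subseteq> V" "A \<times> {b} \<subseteq> U" using A0 by auto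
  let ?N = "\<Union>(nb ` U)"
  have fN: "finite ?N" using finZ by (rule finite_subset[rotated]) (auto simp: nb_def)
  have fA: "finite A" using A finV finite_subset by blast
  let ?B = "Z - ?N - A"
  have "card ?B < m"
  proof (rule ccontr)
    assume "\<not> ?thesis"
    then have B: "m \<le> card ?B" by simp
    have BV: "?B \<subseteq> V" using ZV by auto
    have "\<exists>a\<in>A. \<exists>y\<in>?B. step E b a y"
    proof (cases b)
      case True
      then show ?thesis using joined[OF A(1) BV _ _ B] A1(2) by (auto simp: step_def)
    next
      case False
      then show ?thesis using joined[OF BV A(1) _ B] A1(2) by (auto simp: step_def)
    qed
    then obtain a y where ay: "a \<in> A" "y \<in> ?B" "step E b a y" by blast
    then have "y \<in> nb (a, b)" by (auto simp: nb_def)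
    then show False using ay A by blast
  qed
  moreover have "card Z \<le> card (?N \<union> A \<union> ?B)" using fN fA finZ by (intro card_mono) auto
  moreover have "card (?N \<union> A \<union> ?B) \<le> card ?N + card A + card ?B"
    by (meson add_right_mono card_Un_le le_trans)
  ultimately have "card Z < card ?N + 2 * m" using A1(2) by linarith
  moreover have "card ?N \<le> card (?N - S) + card S"
    using finite_state[OF st] fN by (metis add.commute add_diff_inverse_nat card_mono diff_card_le_card_Diff le_diff_conv)
  moreover have "sum c U \<le> (\<Sum>u\<in>U. 4)" using st by (intro sum_mono) (auto simp: state_def)
  then have "sum c U \<le> 4 * int (card U)" by simp
  ultimately show ?thesis using U S by linarith
qed

text \<open>A port can be served only when its vertex is used or lies outside \<open>Z\<close>: the
  vertices of \<open>Z - S\<close> must keep demand 4 for the result to be a \<open>state\<close>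
  again.\<close>

lemma add_one:
  assumes st: "state S c" and S: "card S + 18 * m < card Z" and u: "fst u \<in> V" "fst u \<notin> Z - S" "1 \<le> c u"
  shows "\<exists>y\<in>nb u - S. state (insert y S) (c(u := c u - 1))"
proof -
  have "\<exists>y\<in>nb u - S. extendable nb (V \<times> UNIV) (2 * m) (insert y S) (c(u := c u - 1))"
    using st m u finV finite_nb slack[OF st S]
    by (intro extendable_add) (auto simp: state_def mem_Times_iff)
  then obtain y where y: "y \<in> nb u - S" "extendable nb (V \<times> UNIV) (2 * m) (insert y S) (c(u := c u - 1))" by blast
  have "c u \<le> 4" using st unfolding state_def by blast
  then have "state (insert y S) (c(u := c u - 1))"
    using st y u by (auto simp: state_def nb_def)
  then show ?thesis using y by blast
qed

text \<open>Each new vertex loses one unit at the port through which the path goes on; 3 at all its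
  ports is a uniform lower bound. The budget is checked before a vertex is added, so the last of the
  \<open>length bs + 1\<close> new vertices is not counted.\<close>

lemma extend_path:
  assumes "state S c" "a \<in> V" "a \<notin> Z - S" "1 \<le> c (a, b)" "card S + length bs + 18 * m < card Z"
  shows "\<exists>q. pwalk E (b # bs) a q \<and> distinct q \<and> set q \<subseteq> Z - S \<and>
    state (S \<union> set q) (\<lambda>u. if fst u \<in> set q then 3 else if u = (a, b) then c u - 1 else c u)"
  using assms
proof (induction bs arbitrary: S c a b)
  case Nil
  obtain y where y: "y \<in> nb (a, b) - S" "state (insert y S) (c((a, b) := c (a, b) - 1))"
    using add_one[of S c "(a, b)"] Nil by auto
  have yZ: "y \<in> Z - S" using y by (auto simp: nb_def)
  have "state (insert y S) (\<lambda>u. if fst u \<in> set [y] then 3 else if u = (a, b) then c u - 1 else c u)"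
    using y(2)
  proof (rule state_mono)
    fix u
    show "(if fst u \<in> set [y] then 3 else if u = (a, b) then c u - 1 else c u) \<le> (c((a, b) := c (a, b) - 1)) u"
      using Nil.prems(1,3) yZ by (cases u) (auto simp: state_def)
  next
    fix v b'
    assume "v \<in> Z - insert y S"
    then show "(if fst (v, b') \<in> set [y] then 3 else if (v, b') = (a, b) then c (v, b') - 1 else c (v, b')) = 4"
      using Nil.prems(1,3) by (auto simp: state_def)
  qed
  then show ?case using y yZ by (intro exI[of _ "[y]"]) (auto simp: nb_def)
next
  case (Cons b2 bs)
  let ?c1 = "c((a, b) := c (a, b) - 1)"
  obtain y where y: "y \<in> nb (a, b) - S" "state (insert y S) ?c1"
    using add_one[of S c "(a, b)"] Cons.prems by auto
  have yZ: "y \<in> Z - S" using y by (auto simp: nb_def)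
  have ya: "y \<noteq> a" using yZ Cons.prems(3) by auto
  have cy: "c (y, b') = 4" for b' using Cons.prems(1) yZ by (auto simp: state_def)
  have "card (insert y S) \<le> card S + 1" using card_insert_le_m1 finite_state[OF Cons.prems(1)]
    by (simp add: card_insert_if)
  then have "card (insert y S) + length bs + 18 * m < card Z" using Cons.prems(5) by simp
  moreover have "y \<in> V" "y \<notin> Z - insert y S" "1 \<le> ?c1 (y, b2)" using yZ ZV ya cy by auto
  ultimately obtain q where q: "pwalk E (b2 # bs) y q" "distinct q" "set q \<subseteq> Z - insert y S"
    "state (insert y S \<union> set q) (\<lambda>u. if fst u \<in> set q then 3 else if u = (y, b2) then ?c1 u - 1 else ?c1 u)"
    using Cons.IH[OF y(2)] by blast
  have "state (insert y S \<union> set q) (\<lambda>u. if fst u \<in> set (y # q) then 3 else if u = (a, b) then c u - 1 else c u)"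
    using q(4)
  proof (rule state_mono)
    fix u
    show "(if fst u \<in> set (y # q) then 3 else if u = (a, b) then c u - 1 else c u)
      \<le> (if fst u \<in> set q then 3 else if u = (y, b2) then ?c1 u - 1 else ?c1 u)"
      using cy ya by (cases u) auto
  next
    fix v b'
    assume "v \<in> Z - (insert y S \<union> set q)"
    then show "(if fst (v, b') \<in> set (y # q) then 3 else if (v, b') = (a, b) then c (v, b') - 1 else c (v, b')) = 4"
      using Cons.prems(1,3) by (auto simp: state_def)
  qed
  then show ?case using y(1) q yZ by (intro exI[of _ "y # q"]) (auto simp: nb_def)
qed

lemma grow_one:
  assumes st: "state (S \<union> T) (\<lambda>u. c u - children T par u)" and fT: "finite T"
    and b: "card (S \<union> T) + 18 * m < card Z" and s: "fst s \<in> V" "fst s \<notin> Z - (S \<union> T)" "1 \<le> c s - children T par s"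
  shows "\<exists>y\<in>nb s - (S \<union> T). state (S \<union> insert y T) (\<lambda>u. c u - children (insert y T) (par(y := s)) u)"
proof -
  obtain y where y: "y \<in> nb s - (S \<union> T)"
    "state (insert y (S \<union> T)) ((\<lambda>u. c u - children T par u)(s := c s - children T par s - 1))"
    using add_one[OF st b s] by blast
  have "(\<lambda>u. c u - children (insert y T) (par(y := s)) u) = (\<lambda>u. c u - children T par u)(s := c s - children T par s - 1)"
  proof
    fix u
    have "children ({y} \<union> T) (par(y := s)) u = children {y} (par(y := s)) u + children T (par(y := s)) u"
      using y fT by (intro children_Un) auto
    moreover have "children T (par(y := s)) u = children T par u" using y by (intro children_cong) auto
    moreover have "children {y} (par(y := s)) u = (if u = s then 1 else 0)"
      by (cases "u = s") (auto simp: children_def card_1_singleton_iff)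
    ultimately show "c u - children (insert y T) (par(y := s)) u = ((\<lambda>u. c u - children T par u)(s := c s - children T par s - 1)) u"
      by auto
  qed
  then show ?thesis using y by (intro bexI[of _ y]) auto
qed

lemma grow_level:
  assumes "finite A" "state S c" "A \<subseteq> V" "A \<inter> (Z - S) = {}" "\<And>v. v \<in> A \<Longrightarrow> 2 \<le> c (v, b)"
    "card S + 2 * card A + 18 * m < card Z"
  shows "\<exists>T par. T \<subseteq> Z - S \<and> (\<forall>y\<in>T. y \<in> nb (par y) \<and> par y \<in> A \<times> {b}) \<and> card T = 2 * card A
    \<and> state (S \<union> T) (\<lambda>u. c u - children T par u)"
  using assms
proof (induction A)
  case empty
  then show ?case by (intro exI[of _ "{}"]) (auto simp: children_eq_0)
next
  case (insert v A)
  have fS: "finite S" using insert.prems finite_state by blast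
  obtain T par where T: "T \<subseteq> Z - S" "\<forall>y\<in>T. y \<in> nb (par y) \<and> par y \<in> A \<times> {b}" "card T = 2 * card A"
    "state (S \<union> T) (\<lambda>u. c u - children T par u)"
    using insert.IH insert.prems insert.hyps by auto
  have fT: "finite T" using T(1) finZ finite_subset by blast
  let ?s = "(v, b)"
  have c0: "children T par ?s = 0" using T(2) insert.hyps(2) by (intro children_eq_0) auto
  have v: "fst ?s \<in> V" "fst ?s \<notin> Z - S" using insert.prems by auto
  have cU: "card (S \<union> T) = card S + card T" using fS fT T(1) by (intro card_Un_disjoint) auto
  have cA: "card (insert v A) = card A + 1" using insert.hyps by simp
  have c2: "2 \<le> c ?s" using insert.prems by auto
  obtain y where y: "y \<in> nb ?s - (S \<union> T)" "state (S \<union> insert y T) (\<lambda>u. c u - children (insert y T) (par(y := ?s)) u)"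
    using grow_one[OF T(4) fT, of ?s] v cU cA T(3) c0 c2 insert.prems(5) by force
  let ?T = "insert y T" and ?par = "par(y := ?s)"
  have "children ?T ?par ?s \<le> 1"
  proof -
    have "{x\<in>?T. ?par x = ?s} \<subseteq> {y}" using T(2) insert.hyps(2) by auto
    then have "card {x\<in>?T. ?par x = ?s} \<le> card {y}" by (intro card_mono) auto
    then show ?thesis by (simp add: children_def)
  qed
  moreover have "S \<union> ?T = insert y (S \<union> T)" by simp
  then have cU': "card (S \<union> ?T) = card S + card T + 1" using cU y(1) fS fT by simp
  ultimately obtain z where z: "z \<in> nb ?s - (S \<union> ?T)" "state (S \<union> insert z ?T) (\<lambda>u. c u - children (insert z ?T) (?par(z := ?s)) u)"
    using grow_one[OF y(2), of ?s] fT v cA T(3) c2 insert.prems(5) by force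
  have "y \<notin> T" "z \<notin> ?T" "y \<in> Z - S" "z \<in> Z - S" using y z by (auto simp: nb_def)
  then have "insert z ?T \<subseteq> Z - S \<and> (\<forall>x\<in>insert z ?T. x \<in> nb ((?par(z := ?s)) x) \<and> (?par(z := ?s)) x \<in> insert v A \<times> {b})
    \<and> card (insert z ?T) = 2 * card (insert v A)"
    using T(1,2,3) y z fT cA by auto
  then show ?case using z(2) by blast
qed

text \<open>The direction of an arc depends only on its level, so all branches to the leaves
  \<open>L\<close> follow the same pattern \<open>bs\<close> and any leaf may later serve as end of
  a path with that pattern. The bound |T| \<le> (2^(h+1) - 2)|A| for depth h is written without
  subtraction.\<close>

lemma grow_tree:
  assumes "state S c" "A \<subseteq> V" "A \<inter> (Z - S) = {}" "\<And>v b. v \<in> A \<Longrightarrow> 2 \<le> c (v, b)"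
    "card S + 2 * 2 ^ length bs * card A + 18 * m < card Z + 2 * card A"
  shows "\<exists>T par L. T \<subseteq> Z - S \<and> (\<forall>y\<in>T. y \<in> nb (par y) \<and> fst (par y) \<in> A \<union> T)
    \<and> card T + 2 * card A \<le> 2 * 2 ^ length bs * card A \<and> state (S \<union> T) (\<lambda>u. c u - children T par u)
    \<and> L \<subseteq> A \<union> T \<and> card L = 2 ^ length bs * card A
    \<and> (\<forall>y\<in>L. \<exists>a\<in>A. \<exists>q. parent_chain par bs a q \<and> distinct q \<and> set q \<subseteq> T \<and> last (a # q) = y)"
  using assms
proof (induction bs arbitrary: S c A)
  case Nil
  then show ?case
    by (intro exI[of _ "{}"] exI[of _ A]) (auto simp: children_eq_0 intro!: exI[of _ "[]"])
next
  case (Cons b bs)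
  have fA: "finite A" using Cons.prems(2) finV finite_subset by blast
  have fS: "finite S" using Cons.prems finite_state by blast
  have "1 * card A \<le> 2 ^ length bs * card A" by (intro mult_le_mono1) simp
  moreover have e: "2 * 2 ^ length (b # bs) * card A = 4 * (2 ^ length bs * card A)" by simp
  ultimately have cA: "card S + 2 * card A + 18 * m < card Z" using Cons.prems(5) unfolding e by linarith
  have "\<exists>T par. T \<subseteq> Z - S \<and> (\<forall>y\<in>T. y \<in> nb (par y) \<and> par y \<in> A \<times> {b}) \<and> card T = 2 * card A
    \<and> state (S \<union> T) (\<lambda>u. c u - children T par u)"
    by (rule grow_level[OF fA Cons.prems(1-3) _ cA]) (rule Cons.prems(4))
  then obtain T1 par1 where T1: "T1 \<subseteq> Z - S" "\<forall>y\<in>T1. y \<in> nb (par1 y) \<and> par1 y \<in> A \<times> {b}" "card T1 = 2 * card A"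
    "state (S \<union> T1) (\<lambda>u. c u - children T1 par1 u)"
    by (elim exE conjE)
  have fT1: "finite T1" using T1(1) finZ finite_subset by blast
  let ?c1 = "\<lambda>u. c u - children T1 par1 u"
  have c1: "2 \<le> ?c1 (v, b')" if v: "v \<in> T1" for v b'
  proof -
    have "children T1 par1 (v, b') = 0" using T1(1,2) v Cons.prems(3) by (intro children_eq_0) fastforce
    moreover have "c (v, b') = 4" using Cons.prems(1) T1(1) v by (auto simp: state_def)
    ultimately show ?thesis by simp
  qed
  have cU: "card (S \<union> T1) = card S + 2 * card A" using fS fT1 T1(1,3) by (subst card_Un_disjoint) auto
  have "\<exists>T par L. T \<subseteq> Z - (S \<union> T1) \<and> (\<forall>y\<in>T. y \<in> nb (par y) \<and> fst (par y) \<in> T1 \<union> T)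
    \<and> card T + 2 * card T1 \<le> 2 * 2 ^ length bs * card T1 \<and> state ((S \<union> T1) \<union> T) (\<lambda>u. ?c1 u - children T par u)
    \<and> L \<subseteq> T1 \<union> T \<and> card L = 2 ^ length bs * card T1
    \<and> (\<forall>y\<in>L. \<exists>a\<in>T1. \<exists>q. parent_chain par bs a q \<and> distinct q \<and> set q \<subseteq> T \<and> last (a # q) = y)"
  proof (rule Cons.IH[OF T1(4) _ _ c1])
    show "T1 \<subseteq> V" using T1(1) ZV by auto
    show "T1 \<inter> (Z - (S \<union> T1)) = {}" by auto
    show "card (S \<union> T1) + 2 * 2 ^ length bs * card T1 + 18 * m < card Z + 2 * card T1"
      using Cons.prems(5) cU T1(3) by simp
  qed
  then obtain T2 par2 L where T2: "T2 \<subseteq> Z - (S \<union> T1)" "\<forall>y\<in>T2. y \<in> nb (par2 y) \<and> fst (par2 y) \<in> T1 \<union> T2"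
    "card T2 + 2 * card T1 \<le> 2 * 2 ^ length bs * card T1" "state ((S \<union> T1) \<union> T2) (\<lambda>u. ?c1 u - children T2 par2 u)"
    "L \<subseteq> T1 \<union> T2" "card L = 2 ^ length bs * card T1"
    and chain: "\<forall>y\<in>L. \<exists>a\<in>T1. \<exists>q. parent_chain par2 bs a q \<and> distinct q \<and> set q \<subseteq> T2 \<and> last (a # q) = y" by blast
  have fT2: "finite T2" using T2(1) finZ finite_subset by blast
  let ?par = "\<lambda>y. if y \<in> T1 then par1 y else par2 y"
  have disj: "T1 \<inter> T2 = {}" using T2(1) by auto
  have ch: "children (T1 \<union> T2) ?par u = children T1 par1 u + children T2 par2 u" for u
  proof -
    have "children T1 ?par u = children T1 par1 u" by (intro children_cong) auto
    moreover have "children T2 ?par u = children T2 par2 u" using disj by (intro children_cong) auto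
    ultimately show ?thesis using children_Un[OF fT1 fT2 disj] by metis
  qed
  have g1: "\<forall>y\<in>L. \<exists>a\<in>A. \<exists>q. parent_chain ?par (b # bs) a q \<and> distinct q \<and> set q \<subseteq> T1 \<union> T2 \<and> last (a # q) = y"
  proof
    fix y assume y: "y \<in> L"
    obtain a q where q: "a \<in> T1" "parent_chain par2 bs a q" "distinct q" "set q \<subseteq> T2" "last (a # q) = y"
      using chain y by blast
    have a: "par1 a = (fst (par1 a), b)" "fst (par1 a) \<in> A" using T1(2) q(1) by (auto simp: prod_eq_iff mem_Times_iff)
    have "parent_chain ?par bs a q" using q(2) by (rule parent_chain_cong) (use q(4) disj in auto)
    then have "parent_chain ?par (b # bs) (fst (par1 a)) (a # q)" using a q(1) by simp
    moreover have "distinct (a # q)" "set (a # q) \<subseteq> T1 \<union> T2" using q disj by auto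
    ultimately show "\<exists>a\<in>A. \<exists>q. parent_chain ?par (b # bs) a q \<and> distinct q \<and> set q \<subseteq> T1 \<union> T2 \<and> last (a # q) = y"
      using a(2) q(5) by (intro bexI[of _ "fst (par1 a)"] exI[of _ "a # q"]) auto
  qed
  have g2: "state (S \<union> (T1 \<union> T2)) (\<lambda>u. c u - children (T1 \<union> T2) ?par u)"
    using T2(4) unfolding ch by (simp add: Un_assoc diff_diff_eq)
  have g3: "card (T1 \<union> T2) + 2 * card A \<le> 2 * 2 ^ length (b # bs) * card A"
    using T2(3) T1(3) card_Un_disjoint[OF fT1 fT2 disj] by simp
  have g4: "T1 \<union> T2 \<subseteq> Z - S" using T1(1) T2(1) by auto
  have g5: "\<forall>y\<in>T1 \<union> T2. y \<in> nb (?par y) \<and> fst (?par y) \<in> A \<union> (T1 \<union> T2)"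
  proof
    fix y assume "y \<in> T1 \<union> T2"
    then show "y \<in> nb (?par y) \<and> fst (?par y) \<in> A \<union> (T1 \<union> T2)"
      using T1(2) T2(2) disj by (cases "y \<in> T1") (auto simp: mem_Times_iff)
  qed
  have g6: "L \<subseteq> A \<union> (T1 \<union> T2)" and g7: "card L = 2 ^ length (b # bs) * card A" using T2(5,6) T1(3) by auto
  show ?case
    by (intro exI[of _ "T1 \<union> T2"] exI[of _ ?par] exI[of _ L] conjI) (fact g1 g2 g3 g4 g5 g6 g7)+
qed

lemma parent_chain_pwalk:
  "parent_chain par bs a q \<Longrightarrow> (\<And>y. y \<in> set q \<Longrightarrow> y \<in> nb (par y)) \<Longrightarrow> pwalk E bs a q"
proof (induction par bs a q rule: parent_chain.induct)
  case (3 par b bs a y ys)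
  have "y \<in> nb (a, b)" using 3(2) 3(3)[of y] by simp
  then show ?case using 3 by (simp add: nb_def)
qed auto

text \<open>Binary trees grown from both ends have at least \<open>m\<close> leaves each, so an edge joins them; then everything off the
  resulting path is pruned.\<close>

lemma connect:
  assumes st: "state S c" and V: "fst u \<in> V" "fst w \<in> V" "fst u \<notin> Z - S" "fst w \<notin> Z - S" "u \<noteq> w" "1 \<le> c u" "1 \<le> c w"
    and h: "m \<le> 2 ^ h" "2 ^ h \<le> 2 * m" and b: "hd bs1 = snd u" "hd bs2 = snd w" "h < length bs1" "h < length bs2"
    and budget: "card S + length bs1 + length bs2 + 26 * m < card Z"
  shows "\<exists>q1 q2. pwalk E bs1 (fst u) q1 \<and> pwalk E bs2 (fst w) q2 \<and> (last q1, last q2) \<in> E \<and> distinct (q1 @ q2)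
    \<and> set (q1 @ q2) \<subseteq> Z - S \<and> state (S \<union> set (q1 @ q2))
      (\<lambda>p. if fst p \<in> set (q1 @ q2) then 2 else c p - of_bool (p = u) - of_bool (p = w))"
proof -
  obtain a b1 t b2 where uw: "u = (a, b1)" "w = (t, b2)" by (cases u; cases w) auto
  have fS: "finite S" using st finite_state by blast
  \<comment> \<open>Only the last \<open>h\<close> steps of each pattern are made inside a binary
    tree. The steps before them form a single path, which adjusts the length.\<close>
  define e1 where "e1 = take (length bs1 - Suc h) (tl bs1)"
  define r1 where "r1 = drop (length bs1 - Suc h) (tl bs1)"
  define e2 where "e2 = take (length bs2 - Suc h) (tl bs2)"
  define r2 where "r2 = drop (length bs2 - Suc h) (tl bs2)"
  have bs: "bs1 = (b1 # e1) @ r1" "bs2 = (b2 # e2) @ r2"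
    using b uw by (auto simp: e1_def r1_def e2_def r2_def neq_Nil_conv intro!: hd_Cons_tl[symmetric])
  have len: "length r1 = h" "length r2 = h" "length bs1 = Suc (length e1 + h)" "length bs2 = Suc (length e2 + h)"
    using b by (auto simp: e1_def r1_def e2_def r2_def)
  obtain p1 where p1: "pwalk E (b1 # e1) a p1" "distinct p1" "set p1 \<subseteq> Z - S"
    "state (S \<union> set p1) (\<lambda>u. if fst u \<in> set p1 then 3 else if u = (a, b1) then c u - 1 else c u)"
    using extend_path[OF st, of a b1 e1] V uw budget len by auto
  define c1 where "c1 = (\<lambda>u. if fst u \<in> set p1 then 3 else if u = (a, b1) then c u - 1 else c u)"
  note st1 = p1(4)[folded c1_def]
  have lp1: "length p1 = Suc (length e1)" using pwalk_length[OF p1(1)] by simp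
  have tS: "t \<notin> set p1" "t \<notin> Z - (S \<union> set p1)" using V uw p1(3) by auto
  have cS1: "card (S \<union> set p1) \<le> card S + Suc (length e1)"
    using card_Un_le[of S "set p1"] card_length[of p1] lp1 by linarith
  have tV: "t \<in> V" using V uw by simp
  have bud: "card (S \<union> set p1) + length e2 + 18 * m < card Z" using cS1 budget len by linarith
  have ne_ports: "((t, b2) = (a, b1)) = False" "((a, b1) = (t, b2)) = False" using V(5) unfolding uw by blast+
  have c1t: "1 \<le> c1 (t, b2)" using V(7) ne_ports tS(1) unfolding uw c1_def by (simp only: fst_conv if_False)
  obtain p2 where p2: "pwalk E (b2 # e2) t p2" "distinct p2" "set p2 \<subseteq> Z - (S \<union> set p1)"
    "state ((S \<union> set p1) \<union> set p2) (\<lambda>u. if fst u \<in> set p2 then 3 else if u = (t, b2) then c1 u - 1 else c1 u)"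
    using extend_path[OF st1 tV tS(2) c1t bud] by (elim exE conjE)
  define c2 where "c2 = (\<lambda>u. if fst u \<in> set p2 then 3 else if u = (t, b2) then c1 u - 1 else c1 u)"
  note st2 = p2(4)[folded c2_def]
  let ?S2 = "(S \<union> set p1) \<union> set p2"
  have lp2: "length p2 = Suc (length e2)" using pwalk_length[OF p2(1)] by simp
  have cS2: "card ?S2 \<le> card S + Suc (length e1) + Suc (length e2)"
    using card_Un_le[of "S \<union> set p1" "set p2"] card_length[of p2] lp2 cS1 by linarith
  have ne: "p1 \<noteq> []" "p2 \<noteq> []" using lp1 lp2 by auto
  define x1 where "x1 = last p1"
  define x2 where "x2 = last p2"
  have x: "x1 \<in> set p1" "x2 \<in> set p2" using ne by (auto simp: x1_def x2_def)
  have xne: "x1 \<noteq> x2" "x1 \<notin> set p2" "x2 \<notin> set p1" using x p2(3) by auto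
  have xV: "x1 \<in> V" "x2 \<in> V" "x1 \<in> Z" "x2 \<in> Z" using x p1(3) p2(3) ZV by auto
  have "\<exists>T par L. T \<subseteq> Z - ?S2 \<and> (\<forall>y\<in>T. y \<in> nb (par y) \<and> fst (par y) \<in> {x1} \<union> T)
    \<and> card T + 2 * card {x1} \<le> 2 * 2 ^ length r1 * card {x1} \<and> state (?S2 \<union> T) (\<lambda>u. c2 u - children T par u)
    \<and> L \<subseteq> {x1} \<union> T \<and> card L = 2 ^ length r1 * card {x1}
    \<and> (\<forall>y\<in>L. \<exists>a\<in>{x1}. \<exists>q. parent_chain par r1 a q \<and> distinct q \<and> set q \<subseteq> T \<and> last (a # q) = y)"
  proof (rule grow_tree[OF st2])
    show "\<And>v b. v \<in> {x1} \<Longrightarrow> 2 \<le> c2 (v, b)" using x tS by (auto simp: c1_def c2_def)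
    show "card ?S2 + 2 * 2 ^ length r1 * card {x1} + 18 * m < card Z + 2 * card {x1}"
      using cS2 len h budget by simp
  qed (use xV x in auto)
  then obtain T1 par1 L1 where T1: "T1 \<subseteq> Z - ?S2" "\<forall>y\<in>T1. y \<in> nb (par1 y) \<and> fst (par1 y) \<in> {x1} \<union> T1"
    "card T1 \<le> 2 * 2 ^ h" "state (?S2 \<union> T1) (\<lambda>u. c2 u - children T1 par1 u)"
    "L1 \<subseteq> {x1} \<union> T1" "card L1 = 2 ^ h"
    and ch1: "\<forall>y\<in>L1. \<exists>q. parent_chain par1 r1 x1 q \<and> distinct q \<and> set q \<subseteq> T1 \<and> last (x1 # q) = y"
    using len by auto
  define c3 where "c3 = (\<lambda>u. c2 u - children T1 par1 u)"
  note st3 = T1(4)[folded c3_def]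
  have fT1: "finite T1" using T1(1) finZ finite_subset by blast
  \<comment> \<open>Depth \<open>h\<close> gives each tree at least \<open>m\<close> leaves, as
    needed for \<open>joined\<close>, and at most \<open>2 * 2 ^ h\<close>, that is
    \<open>4 * m\<close>, vertices. Two trees and the \<open>18 * m\<close> required by
    \<open>slack\<close> make up the \<open>26 * m\<close> of the budget.\<close>
  have cS3: "card (?S2 \<union> T1) \<le> card S + Suc (length e1) + Suc (length e2) + 4 * m"
    using card_Un_le[of ?S2 T1] T1(3) cS2 h by linarith
  have x2c: "2 \<le> c3 (x2, b)" for b
  proof -
    have "x2 \<notin> T1" using T1(1) x by auto
    then have "children T1 par1 (x2, b) = 0" using T1(2) xne(1) by (intro children_eq_0) fastforce
    then show ?thesis using x by (simp add: c3_def c2_def)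
  qed
  have "\<exists>T par L. T \<subseteq> Z - (?S2 \<union> T1) \<and> (\<forall>y\<in>T. y \<in> nb (par y) \<and> fst (par y) \<in> {x2} \<union> T)
    \<and> card T + 2 * card {x2} \<le> 2 * 2 ^ length r2 * card {x2} \<and> state ((?S2 \<union> T1) \<union> T) (\<lambda>u. c3 u - children T par u)
    \<and> L \<subseteq> {x2} \<union> T \<and> card L = 2 ^ length r2 * card {x2}
    \<and> (\<forall>y\<in>L. \<exists>a\<in>{x2}. \<exists>q. parent_chain par r2 a q \<and> distinct q \<and> set q \<subseteq> T \<and> last (a # q) = y)"
  proof (rule grow_tree[OF st3])
    show "\<And>v b. v \<in> {x2} \<Longrightarrow> 2 \<le> c3 (v, b)" using x2c by blast
    show "card (?S2 \<union> T1) + 2 * 2 ^ length r2 * card {x2} + 18 * m < card Z + 2 * card {x2}"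
      using cS3 len h budget by simp
  qed (use xV x in auto)
  then obtain T2 par2 L2 where T2: "T2 \<subseteq> Z - (?S2 \<union> T1)" "\<forall>y\<in>T2. y \<in> nb (par2 y) \<and> fst (par2 y) \<in> {x2} \<union> T2"
    "state ((?S2 \<union> T1) \<union> T2) (\<lambda>u. c3 u - children T2 par2 u)"
    "L2 \<subseteq> {x2} \<union> T2" "card L2 = 2 ^ h"
    and ch2: "\<forall>y\<in>L2. \<exists>q. parent_chain par2 r2 x2 q \<and> distinct q \<and> set q \<subseteq> T2 \<and> last (x2 # q) = y"
    using len by auto
  have fT2: "finite T2" using T2(1) finZ finite_subset by blast
  have x12: "x1 \<notin> T1" "x1 \<notin> T2" "x2 \<notin> T1" "x2 \<notin> T2" using T1(1) T2(1) x by auto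
  have T12: "T1 \<inter> T2 = {}" using T2(1) by auto
  have "L1 \<subseteq> V" "L2 \<subseteq> V" "L1 \<inter> L2 = {}"
    using T1(1,5) T2(1,4) xV ZV x12 T12 xne(1) by blast+
  then obtain y1 y2 where y: "y1 \<in> L1" "y2 \<in> L2" "(y1, y2) \<in> E"
    using joined[of L1 L2] T1(6) T2(5) h(1) by auto
  obtain q1 where q1: "parent_chain par1 r1 x1 q1" "distinct q1" "set q1 \<subseteq> T1" "last (x1 # q1) = y1"
    using ch1 y by blast
  obtain q2 where q2: "parent_chain par2 r2 x2 q2" "distinct q2" "set q2 \<subseteq> T2" "last (x2 # q2) = y2"
    using ch2 y by blast
  have fP: "finite (V \<times> (UNIV :: bool set))" using finV by simp
  \<comment> \<open>The trees are pruned one after the other. Meanwhile the other tree counts as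
    used, with its children already deducted from the demand.\<close>
  have r1: "extendable nb (V \<times> UNIV) (2 * m) ((?S2 \<union> T2) \<union> set q1) (\<lambda>u. (c2 u - children T2 par2 u) - children (set q1) par1 u)"
  proof (rule extendable_rollback[OF fP finite_nb])
    have un: "?S2 \<union> T2 \<union> T1 = ?S2 \<union> T1 \<union> T2" by blast
    have e: "(\<lambda>u. (c2 u - children T2 par2 u) - children T1 par1 u) = (\<lambda>u. (c2 u - children T1 par1 u) - children T2 par2 u)"
      by (rule ext) simp
    show "extendable nb (V \<times> UNIV) (2 * m) ((?S2 \<union> T2) \<union> T1) (\<lambda>u. (c2 u - children T2 par2 u) - children T1 par1 u)"
      using T2(3) unfolding state_def c3_def un e by blast
  qed (use T1(1,2) T12 fT1 q1(3) in auto)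
  have r2: "extendable nb (V \<times> UNIV) (2 * m) ((?S2 \<union> set q1) \<union> set q2) (\<lambda>u. (c2 u - children (set q1) par1 u) - children (set q2) par2 u)"
  proof (rule extendable_rollback[OF fP finite_nb])
    have un: "?S2 \<union> set q1 \<union> T2 = ?S2 \<union> T2 \<union> set q1" by blast
    have e: "(\<lambda>u. (c2 u - children (set q1) par1 u) - children T2 par2 u) = (\<lambda>u. (c2 u - children T2 par2 u) - children (set q1) par1 u)"
      by (rule ext) simp
    show "extendable nb (V \<times> UNIV) (2 * m) ((?S2 \<union> set q1) \<union> T2) (\<lambda>u. (c2 u - children (set q1) par1 u) - children T2 par2 u)"
      using r1 unfolding un e .
  qed (use T2(1,2) T12 fT2 q1(3) q2(3) in auto)
  let ?q1 = "p1 @ q1" and ?q2 = "p2 @ q2"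
  let ?c = "\<lambda>p. if fst p \<in> set (?q1 @ ?q2) then 2 else c p - of_bool (p = u) - of_bool (p = w)"
  have sets: "(?S2 \<union> set q1) \<union> set q2 = S \<union> set (?q1 @ ?q2)" by auto
  have d1: "distinct (x1 # q1)" "distinct (x2 # q2)" using q1 q2 x12 by auto
  have le: "?c p \<le> (c2 p - children (set q1) par1 p) - children (set q2) par2 p" for p
  proof -
    have k1: "children (set q1) par1 p \<le> (if fst p \<in> insert x1 (set q1) then 1 else 0)"
      by (rule children_chain[OF q1(1) d1(1)])
    have k2: "children (set q2) par2 p \<le> (if fst p \<in> insert x2 (set q2) then 1 else 0)"
      by (rule children_chain[OF q2(1) d1(2)])
    have k: "\<not> (fst p \<in> insert x1 (set q1) \<and> fst p \<in> insert x2 (set q2))"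
      using q1(3) q2(3) x12 T12 xne(1) by auto
    show ?thesis
    proof (cases "fst p \<in> set (?q1 @ ?q2)")
      case True
      have Zp: "fst p \<in> Z - S" using True p1(3) p2(3) q1(3) q2(3) T1(1) T2(1) by auto
      \<comment> \<open>This holds on the single paths as well as on the branches. The branches are
        disjoint and cost a vertex at most one more unit, so 2 remains everywhere on the
        connection.\<close>
      have "3 \<le> c2 p"
      proof -
        have "p \<noteq> (a, b1)" "p \<noteq> (t, b2)" using Zp V(3,4) unfolding uw by (metis fst_conv)+
        moreover have "c p = 4" using Zp st unfolding state_def by (metis prod.collapse)
        ultimately show ?thesis by (simp add: c1_def c2_def)
      qed
      moreover have "children (set q1) par1 p + children (set q2) par2 p \<le> 1"
      proof (cases "fst p \<in> insert x1 (set q1)")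
        case True
        then have "fst p \<notin> insert x2 (set q2)" using k by blast
        then have "children (set q2) par2 p \<le> 0" using k2 by (simp only: if_False)
        then show ?thesis using k1 True by (simp only: if_True)
      next
        case False
        then have "children (set q1) par1 p \<le> 0" using k1 by (simp only: if_False)
        moreover have "children (set q2) par2 p \<le> 1" using k2 by (simp only: split: if_splits) 
        ultimately show ?thesis by linarith
      qed
      moreover have "?c p = 2" using True by simp
      ultimately show ?thesis by linarith
    next
      case False
      then have "fst p \<notin> insert x1 (set q1)" "fst p \<notin> insert x2 (set q2)" using x by auto
      then have "children (set q1) par1 p \<le> 0" "children (set q2) par2 p \<le> 0" using k1 k2 by simp_all
      moreover have "c2 p = ?c p" 
      proof (cases "p = (t, b2)")
        case True
        then show ?thesis using False ne_ports unfolding uw c1_def c2_def by (simp only: if_True if_False fst_conv set_append Un_iff de_Morgan_disj) simp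
      next
        case pt: False
        then show ?thesis using False unfolding uw c1_def c2_def by (cases "p = (a, b1)") (simp_all only: if_True if_False set_append Un_iff de_Morgan_disj, simp_all)
      qed
      ultimately show ?thesis by linarith
    qed
  qed
  have fin: "state (S \<union> set (?q1 @ ?q2)) ?c"
    unfolding state_def
  proof (intro conjI allI ballI)
    show "S \<union> set (?q1 @ ?q2) \<subseteq> Z" using st p1(3) p2(3) q1(3) q2(3) T1(1) T2(1) by (auto simp: state_def)
    show "extendable nb (V \<times> UNIV) (2 * m) (S \<union> set (?q1 @ ?q2)) ?c"
      using extendable_mono[OF r2 le] unfolding sets .
    fix p
    have "c p \<le> 4" using st unfolding state_def by blast
    moreover have "(0::int) \<le> of_bool (p = u)" "(0::int) \<le> of_bool (p = w)" by simp_all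
    ultimately show "?c p \<le> 4"
    proof (cases "fst p \<in> set (?q1 @ ?q2)")
      case False
      then have "?c p = c p - of_bool (p = u) - of_bool (p = w)" by (simp only: if_False)
      then show ?thesis using \<open>c p \<le> 4\<close> \<open>(0::int) \<le> of_bool (p = u)\<close> \<open>(0::int) \<le> of_bool (p = w)\<close> by linarith
    qed simp
  next
    fix v b assume v: "v \<in> Z - (S \<union> set (?q1 @ ?q2))"
    then have "c (v, b) = 4" using st by (auto simp: state_def)
    moreover have "(v, b) \<noteq> u" "(v, b) \<noteq> w" using v V uw by auto
    ultimately show "?c (v, b) = 4" using v by auto
  qed
  have "pwalk E r1 x1 q1" "pwalk E r2 x2 q2"
    using parent_chain_pwalk q1 q2 T1(2) T2(2) by blast+
  then have w: "pwalk E bs1 a ?q1" "pwalk E bs2 t ?q2"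
    unfolding bs x1_def x2_def using pwalk_append[OF p1(1), of r1 q1] pwalk_append[OF p2(1), of r2 q2] ne by simp_all
  have l: "last ?q1 = y1" "last ?q2 = y2" using q1(4) q2(4) ne unfolding x1_def x2_def by (auto split: if_splits)
  have dist: "distinct (?q1 @ ?q2)"
    using p1(2) p2(2,3) q1(2,3) q2(2,3) T1(1) T2(1) T12 by auto
  have sub: "set (?q1 @ ?q2) \<subseteq> Z - S" using p1(3) p2(3) q1(3) q2(3) T1(1) T2(1) by auto
  show ?thesis
    using w l y(3) dist sub fin uw by (intro exI[of _ ?q1] exI[of _ ?q2]) simp
qed

end

section \<open>Linkages and switches\<close>

abbreviation walk :: "('a \<times> 'a) set \<Rightarrow> 'a list \<Rightarrow> bool" where
  "walk E \<equiv> successively (\<lambda>x y. (x, y) \<in> E)"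

lemma walk_join:
  assumes "walk E (a # p)" "walk E (last (a # p) # q)"
  shows "walk E (a # p @ q)"
  using assms by (cases q) (auto simp: successively_append_iff successively_Cons[of _ a "p @ _"] split: if_splits
      simp flip: append_Cons)

lemma walk_Cons_iff: "walk E (a # p) \<longleftrightarrow> p = [] \<or> (a, hd p) \<in> E \<and> walk E p"
  by (auto simp: successively_Cons)

lemma pwalk_True: "pwalk E (replicate n True) a q \<Longrightarrow> walk E (a # q)"
proof (induction n arbitrary: a q)
  case (Suc n)
  then show ?case by (cases q) (auto simp: step_def)
qed auto

lemma pwalk_False: "pwalk E (replicate n False) a q \<Longrightarrow> walk E (rev q @ [a])"
proof (induction n arbitrary: a q)
  case (Suc n)
  then show ?case by (cases q) (auto simp: step_def successively_append_iff)
qed auto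

lemma walk_concat:
  assumes "\<And>j. j < n \<Longrightarrow> T j \<noteq> [] \<and> walk E (T j)" "\<And>j. Suc j < n \<Longrightarrow> (last (T j), hd (T (Suc j))) \<in> E" "0 < n"
  shows "walk E (concat (map T [0..<n])) \<and> concat (map T [0..<n]) \<noteq> []
    \<and> hd (concat (map T [0..<n])) = hd (T 0) \<and> last (concat (map T [0..<n])) = last (T (n - 1))"
  using assms
proof (induction n)
  case (Suc n)
  show ?case
  proof (cases "n = 0")
    case True
    then show ?thesis using Suc.prems by auto
  next
    case False
    let ?c = "concat (map T [0..<n])"
    have "walk E ?c \<and> ?c \<noteq> [] \<and> hd ?c = hd (T 0) \<and> last ?c = last (T (n - 1))"
      using Suc False by simp
    moreover have "T n \<noteq> []" "walk E (T n)" "(last (T (n - 1)), hd (T n)) \<in> E"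
      using Suc.prems(1)[of n] Suc.prems(2)[of "n - 1"] False by auto
    ultimately show ?thesis by (auto simp: successively_append_iff)
  qed
qed simp

lemma distinct_concat_family:
  assumes "\<And>j. j < n \<Longrightarrow> distinct (T j)" "disjoint_family_on (\<lambda>j. set (T j)) {..<n}"
  shows "distinct (concat (map T [0..<n]))"
  using assms
proof (induction n)
  case (Suc n)
  have "disjoint_family_on (\<lambda>j. set (T j)) {..<n}" using Suc.prems(2) by (auto simp: disjoint_family_on_def)
  moreover have "set (T j) \<inter> set (T n) = {}" if "j < n" for j
    using Suc.prems(2) that unfolding disjoint_family_on_def by (metis lessThan_iff less_Suc_eq nat_neq_iff)
  ultimately show ?case using Suc by (auto simp: disjoint_iff)
qed simp

lemma set_concat_family: "set (concat (map T [0..<n])) = (\<Union>j<n. set (T j))"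
  by auto

lemma length_concat_family: "length (concat (map T [0..<n])) = (\<Sum>j<n. length (T j))"
  by (induction n) auto

text \<open>The starts \<open>s w\<close> are not counted in \<open>Q\<close> and the ends are, so
  that consecutive linkages have disjoint vertex sets. The routing \<pi> acts on indices: a network
  keeps its exits \<open>e\<close> and its set \<open>Q\<close> while \<pi> varies.\<close>

definition linkage :: "('a \<times> 'a) set \<Rightarrow> 'i set \<Rightarrow> ('i \<Rightarrow> 'a) \<Rightarrow> ('i \<Rightarrow> 'a) \<Rightarrow> 'a set \<Rightarrow> nat \<Rightarrow> ('i \<Rightarrow> 'i) \<Rightarrow> bool" where
  "linkage E I s e Q L \<pi> \<longleftrightarrow> (\<exists>p. (\<forall>w\<in>I. length (p w) = L \<and> walk E (s w # p w) \<and> last (s w # p w) = e (\<pi> w) \<and> distinct (p w))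
    \<and> disjoint_family_on (\<lambda>w. set (p w)) I \<and> (\<Union>w\<in>I. set (p w)) = Q)"

text \<open>The path of \<open>w\<close> is continued by that of \<open>\<sigma> w\<close>, which
  starts where the first one ends. Bijectivity of \<sigma> makes every path of the second linkage
  occur exactly once.\<close>

lemma linkage_comp:
  assumes "linkage E I s e Q L \<sigma>" "linkage E I e e' Q' L' \<tau>" "bij_betw \<sigma> I I" "Q \<inter> Q' = {}"
  shows "linkage E I s e' (Q \<union> Q') (L + L') (\<tau> \<circ> \<sigma>)"
proof -
  obtain p where p: "\<And>w. w \<in> I \<Longrightarrow> length (p w) = L \<and> walk E (s w # p w) \<and> last (s w # p w) = e (\<sigma> w) \<and> distinct (p w)"
    "disjoint_family_on (\<lambda>w. set (p w)) I" "(\<Union>w\<in>I. set (p w)) = Q" using assms(1) unfolding linkage_def by blast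
  obtain q where q: "\<And>w. w \<in> I \<Longrightarrow> length (q w) = L' \<and> walk E (e w # q w) \<and> last (e w # q w) = e' (\<tau> w) \<and> distinct (q w)"
    "disjoint_family_on (\<lambda>w. set (q w)) I" "(\<Union>w\<in>I. set (q w)) = Q'" using assms(2) unfolding linkage_def by blast
  have sI: "\<sigma> w \<in> I" if "w \<in> I" for w using assms(3) that by (auto simp: bij_betw_def)
  have sinj: "\<sigma> w = \<sigma> w' \<Longrightarrow> w = w'" if "w \<in> I" "w' \<in> I" for w w' using assms(3) that by (auto simp: bij_betw_def inj_on_def)
  have sub: "set (p w) \<subseteq> Q" "set (q w) \<subseteq> Q'" if "w \<in> I" for w using p(3) q(3) that by auto
  let ?r = "\<lambda>w. p w @ q (\<sigma> w)"
  have A: "\<forall>w\<in>I. length (?r w) = L + L' \<and> walk E (s w # ?r w) \<and> last (s w # ?r w) = e' ((\<tau> \<circ> \<sigma>) w) \<and> distinct (?r w)"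
  proof (intro ballI conjI)
    fix w assume w: "w \<in> I"
    show "length (?r w) = L + L'" using p(1) q(1) sI w by simp
    show "walk E (s w # ?r w)" using p(1)[OF w] q(1)[OF sI[OF w]] by (metis walk_join)
    show "last (s w # ?r w) = e' ((\<tau> \<circ> \<sigma>) w)" using p(1)[OF w] q(1)[OF sI[OF w]] by (cases "q (\<sigma> w) = []") auto
    show "distinct (?r w)" using p(1)[OF w] q(1)[OF sI[OF w]] sub(1)[OF w] sub(2)[OF sI[OF w]] assms(4) by auto
  qed
  have B: "disjoint_family_on (\<lambda>w. set (?r w)) I"
    unfolding disjoint_family_on_def
  proof (intro ballI impI)
    fix w w' assume w: "w \<in> I" "w' \<in> I" "w \<noteq> w'"
    have "set (p w) \<inter> set (p w') = {}" using p(2) w by (auto simp: disjoint_family_on_def)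
    moreover have "set (q (\<sigma> w)) \<inter> set (q (\<sigma> w')) = {}"
      using q(2) w sI sinj unfolding disjoint_family_on_def by metis
    moreover have "set (p w) \<inter> set (q (\<sigma> w')) = {}" using sub(1)[OF w(1)] sub(2)[OF sI[OF w(2)]] assms(4) by blast
    moreover have "set (q (\<sigma> w)) \<inter> set (p w') = {}" using sub(1)[OF w(2)] sub(2)[OF sI[OF w(1)]] assms(4) by blast
    ultimately show "set (?r w) \<inter> set (?r w') = {}"
      unfolding set_append Int_Un_distrib Int_Un_distrib2 by simp
  qed
  have "(\<Union>w\<in>I. set (q (\<sigma> w))) = Q'"
    using q(3) assms(3) unfolding bij_betw_def by (metis image_image)
  then have C: "(\<Union>w\<in>I. set (?r w)) = Q \<union> Q'" using p(3) unfolding set_append UN_Un_distrib by simp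
  show ?thesis unfolding linkage_def by (rule exI[of _ ?r], intro conjI) (fact A B C)+
qed

lemma linkage_Un:
  assumes "linkage E I s e Q L \<sigma>" "linkage E J s e R L \<sigma>" "I \<inter> J = {}" "Q \<inter> R = {}"
  shows "linkage E (I \<union> J) s e (Q \<union> R) L \<sigma>"
proof -
  obtain p where p: "\<And>w. w \<in> I \<Longrightarrow> length (p w) = L \<and> walk E (s w # p w) \<and> last (s w # p w) = e (\<sigma> w) \<and> distinct (p w)"
    "disjoint_family_on (\<lambda>w. set (p w)) I" "(\<Union>w\<in>I. set (p w)) = Q" using assms(1) unfolding linkage_def by blast
  obtain q where q: "\<And>w. w \<in> J \<Longrightarrow> length (q w) = L \<and> walk E (s w # q w) \<and> last (s w # q w) = e (\<sigma> w) \<and> distinct (q w)"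
    "disjoint_family_on (\<lambda>w. set (q w)) J" "(\<Union>w\<in>J. set (q w)) = R" using assms(2) unfolding linkage_def by blast
  define r where "r w = (if w \<in> I then p w else q w)" for w
  have rI: "r w = p w" if "w \<in> I" for w using that by (simp add: r_def)
  have rJ: "r w = q w" if "w \<in> J" for w using that assms(3) by (auto simp: r_def)
  have 1: "length (r w) = L \<and> walk E (s w # r w) \<and> last (s w # r w) = e (\<sigma> w) \<and> distinct (r w)" if w: "w \<in> I \<union> J" for w
    using w p(1)[of w] q(1)[of w] rI[of w] rJ[of w] by (cases "w \<in> I") auto
  have sub: "set (p w) \<subseteq> Q" if "w \<in> I" for w using p(3) that by auto
  have sub': "set (q w) \<subseteq> R" if "w \<in> J" for w using q(3) that by auto
  have 2: "disjoint_family_on (\<lambda>w. set (r w)) (I \<union> J)"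
    unfolding disjoint_family_on_def
  proof (intro ballI impI)
    fix w w' assume w: "w \<in> I \<union> J" "w' \<in> I \<union> J" "w \<noteq> w'"
    then consider "w \<in> I" "w' \<in> I" | "w \<in> I" "w' \<in> J" | "w \<in> J" "w' \<in> I" | "w \<in> J" "w' \<in> J" by blast
    then show "set (r w) \<inter> set (r w') = {}"
    proof cases
      case 1
      then show ?thesis using p(2) w(3) rI by (auto simp: disjoint_family_on_def)
    next
      case 2
      then show ?thesis using rI rJ sub sub' assms(4) by fastforce
    next
      case 3
      then show ?thesis using rI rJ sub sub' assms(4) by fastforce
    next
      case 4
      then show ?thesis using q(2) w(3) rJ by (auto simp: disjoint_family_on_def)
    qed
  qed
  have "(\<Union>w\<in>I \<union> J. set (r w)) = Q \<union> R" using p(3) q(3) rI rJ by auto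
  then show ?thesis unfolding linkage_def using 1 2 by blast
qed

lemma linkage_cong:
  assumes "linkage E I s e Q L \<sigma>" "\<And>w. w \<in> I \<Longrightarrow> e (\<sigma> w) = e' (\<sigma>' w)"
  shows "linkage E I s e' Q L \<sigma>'"
  using assms(1) unfolding linkage_def by (simp add: assms(2) cong: ball_cong)

lemma linkage_pair:
  assumes "i \<noteq> j" "length p = L" "length q = L" "walk E (s i # p)" "walk E (s j # q)"
    "last (s i # p) = e (\<sigma> i)" "last (s j # q) = e (\<sigma> j)" "distinct (p @ q)" "set (p @ q) = Q"
  shows "linkage E {i, j} s e Q L \<sigma>"
  unfolding linkage_def using assms
  by (intro exI[of _ "\<lambda>w. if w = i then p else q"]) (auto simp: disjoint_family_on_def)

text \<open>The switch: straight connection through the even and the odd segments, crossed connection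
  through the first and last segment and through all others in order.\<close>

lemma switch_segments:
  fixes T :: "nat \<Rightarrow> 'a list"
  assumes T: "\<And>j. j \<le> 2 * \<rho> + 1 \<Longrightarrow> T j \<noteq> [] \<and> walk E (T j) \<and> distinct (T j)"
    and disj: "disjoint_family_on (\<lambda>j. set (T j)) {..2 * \<rho> + 1}" and \<rho>: "1 \<le> \<rho>"
    and e2: "\<And>j. j + 2 \<le> 2 * \<rho> + 1 \<Longrightarrow> (last (T j), hd (T (j + 2))) \<in> E"
    and e1: "\<And>j. 1 \<le> j \<Longrightarrow> Suc j \<le> 2 * \<rho> \<Longrightarrow> (last (T j), hd (T (Suc j))) \<in> E"
    and e0: "(last (T 0), hd (T (2 * \<rho> + 1))) \<in> E"
    and start: "(a, hd (T 0)) \<in> E" "(b, hd (T 1)) \<in> E"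
    and len: "length (T 0) = \<rho> * f" "length (T (2 * \<rho> + 1)) = \<rho> * f" "\<And>j. 1 \<le> j \<Longrightarrow> j \<le> 2 * \<rho> \<Longrightarrow> length (T j) = f"
    and Q: "Q = (\<Union>j\<le>2 * \<rho> + 1. set (T j))"
  shows "\<exists>p q. length p = 2 * \<rho> * f \<and> length q = 2 * \<rho> * f \<and> walk E (a # p) \<and> walk E (b # q)
      \<and> last (a # p) = last (T (2 * \<rho>)) \<and> last (b # q) = last (T (2 * \<rho> + 1)) \<and> distinct (p @ q) \<and> set (p @ q) = Q"
    and "\<exists>p q. length p = 2 * \<rho> * f \<and> length q = 2 * \<rho> * f \<and> walk E (a # p) \<and> walk E (b # q)
      \<and> last (a # p) = last (T (2 * \<rho> + 1)) \<and> last (b # q) = last (T (2 * \<rho>)) \<and> distinct (p @ q) \<and> set (p @ q) = Q"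
proof -
  have dj: "set (T i) \<inter> set (T j) = {}" if "i \<le> 2 * \<rho> + 1" "j \<le> 2 * \<rho> + 1" "i \<noteq> j" for i j
    using disj that by (auto simp: disjoint_family_on_def)
  let ?E = "\<lambda>j. T (2 * j)" and ?O = "\<lambda>j. T (2 * j + 1)"
  define p where "p = concat (map ?E [0..<Suc \<rho>])"
  define q where "q = concat (map ?O [0..<Suc \<rho>])"
  have wp: "walk E p \<and> p \<noteq> [] \<and> hd p = hd (?E 0) \<and> last p = last (?E (Suc \<rho> - 1))"
    unfolding p_def by (rule walk_concat) (use T e2 in \<open>auto\<close>)
  have wq: "walk E q \<and> q \<noteq> [] \<and> hd q = hd (?O 0) \<and> last q = last (?O (Suc \<rho> - 1))"
    unfolding q_def using T e2[of "Suc (2 * _)"] by (intro walk_concat) auto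
  have dp: "distinct p" unfolding p_def using T dj by (intro distinct_concat_family) (auto simp: disjoint_family_on_def)
  have dq: "distinct q" unfolding q_def using T dj by (intro distinct_concat_family) (auto simp: disjoint_family_on_def)
  have sp: "set p = (\<Union>j\<le>\<rho>. set (?E j))" "set q = (\<Union>j\<le>\<rho>. set (?O j))"
    unfolding p_def q_def set_concat_family lessThan_Suc_atMost by (rule refl)+
  have pq: "set p \<inter> set q = {}"
  proof -
    have "set (?E i) \<inter> set (?O j) = {}" if "i \<le> \<rho>" "j \<le> \<rho>" for i j
      using that by (intro dj) presburger+
    then show ?thesis unfolding sp by blast
  qed
  have "set p \<union> set q = Q"
  proof
    show "set p \<union> set q \<subseteq> Q"
    proof
      fix x assume "x \<in> set p \<union> set q"
      then obtain j where "j \<le> \<rho>" "x \<in> set (?E j) \<or> x \<in> set (?O j)" unfolding sp by blast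
      moreover from this have "2 * j \<in> {..2 * \<rho> + 1}" "2 * j + 1 \<in> {..2 * \<rho> + 1}" by auto
      ultimately show "x \<in> Q" unfolding Q by blast
    qed
    show "Q \<subseteq> set p \<union> set q"
    proof
      fix x assume "x \<in> Q"
      then obtain j where j: "j \<le> 2 * \<rho> + 1" "x \<in> set (T j)" unfolding Q by auto
      show "x \<in> set p \<union> set q"
      proof (cases "even j")
        case True
        then obtain i where "j = 2 * i" by (elim evenE)
        then show ?thesis using j unfolding sp by auto
      next
        case False
        then obtain i where "j = 2 * i + 1" by (elim oddE)
        then show ?thesis using j unfolding sp by auto
      qed
    qed
  qed
  \<comment> \<open>One long segment and \<rho> short ones have \<open>2 * \<rho> * f\<close>
    vertices. In the crossed state the two long segments form one path and the
    \<open>2 * \<rho>\<close> short ones the other; the long ones have \<open>\<rho> * f\<close>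
    vertices so that these two paths balance as well.\<close>
  moreover have "length p = 2 * \<rho> * f"
  proof -
    have "length p = (\<Sum>j<Suc \<rho>. length (?E j))" unfolding p_def by (rule length_concat_family)
    also have "\<dots> = length (?E 0) + (\<Sum>j<\<rho>. length (?E (Suc j)))" by (subst sum.lessThan_Suc_shift) simp
    also have "(\<Sum>j<\<rho>. length (?E (Suc j))) = (\<Sum>j<\<rho>. f)" using len(3) by (intro sum.cong) auto
    finally show ?thesis using len(1) by simp
  qed
  moreover have "length q = 2 * \<rho> * f"
  proof -
    have "length q = (\<Sum>j<Suc \<rho>. length (?O j))" unfolding q_def by (rule length_concat_family)
    also have "\<dots> = (\<Sum>j<\<rho>. length (?O j)) + length (?O \<rho>)" by simp
    also have "(\<Sum>j<\<rho>. length (?O j)) = (\<Sum>j<\<rho>. f)" using len(3) by (intro sum.cong) auto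
    finally show ?thesis using len(2) by simp
  qed
  ultimately show "\<exists>p q. length p = 2 * \<rho> * f \<and> length q = 2 * \<rho> * f \<and> walk E (a # p) \<and> walk E (b # q)
      \<and> last (a # p) = last (T (2 * \<rho>)) \<and> last (b # q) = last (T (2 * \<rho> + 1)) \<and> distinct (p @ q) \<and> set (p @ q) = Q"
    using wp wq dp dq pq start
    by - (rule exI[of _ p], rule exI[of _ q], simp add: walk_Cons_iff)
next
  have dj: "set (T i) \<inter> set (T j) = {}" if "i \<le> 2 * \<rho> + 1" "j \<le> 2 * \<rho> + 1" "i \<noteq> j" for i j
    using disj that by (auto simp: disjoint_family_on_def)
  define p where "p = T 0 @ T (2 * \<rho> + 1)"
  define q where "q = concat (map (\<lambda>j. T (Suc j)) [0..<2 * \<rho>])"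
  have wq: "walk E q \<and> q \<noteq> [] \<and> hd q = hd (T (Suc 0)) \<and> last q = last (T (Suc (2 * \<rho> - 1)))"
    unfolding q_def by (rule walk_concat) (use T e1 \<rho> in \<open>auto\<close>)
  have wp: "walk E p" "p \<noteq> []" "hd p = hd (T 0)" "last p = last (T (2 * \<rho> + 1))"
    using T[of 0] T[of "2 * \<rho> + 1"] e0 by (auto simp: successively_append_iff p_def)
  have dq: "distinct q" unfolding q_def using T dj by (intro distinct_concat_family) (auto simp: disjoint_family_on_def)
  have dp: "distinct p" using T[of 0] T[of "2 * \<rho> + 1"] dj[of 0 "2 * \<rho> + 1"] by (auto simp: p_def)
  have sq: "set q = (\<Union>j\<in>{1..2 * \<rho>}. set (T j))"
  proof (intro equalityI subsetI)
    fix x assume "x \<in> set q"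
    then obtain j where "j < 2 * \<rho>" "x \<in> set (T (Suc j))" unfolding q_def set_concat_family by blast
    then show "x \<in> (\<Union>j\<in>{1..2 * \<rho>}. set (T j))" by (intro UN_I[of "Suc j"]) auto
  next
    fix x assume "x \<in> (\<Union>j\<in>{1..2 * \<rho>}. set (T j))"
    then obtain j where "1 \<le> j" "j \<le> 2 * \<rho>" "x \<in> set (T j)" by auto
    then show "x \<in> set q" unfolding q_def set_concat_family by (intro UN_I[of "j - 1"]) auto
  qed
  have sp: "set p = set (T 0) \<union> set (T (2 * \<rho> + 1))" by (simp add: p_def)
  have "set p \<inter> set q = {}" 
  proof -
    have "set (T 0) \<inter> set (T j) = {}" "set (T (2 * \<rho> + 1)) \<inter> set (T j) = {}" if "j \<in> {1..2 * \<rho>}" for j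
      using that by (intro dj; simp)+
    then show ?thesis unfolding sp sq by blast
  qed
  moreover have "set p \<union> set q = Q"
  proof -
    have "{..2 * \<rho> + 1} = insert 0 (insert (2 * \<rho> + 1) {1..2 * \<rho>})" by auto
    then show ?thesis unfolding sp sq Q by auto
  qed
  moreover have "length p = 2 * \<rho> * f" using len by (simp add: p_def)
  moreover have "length q = 2 * \<rho> * f"
  proof -
    have "length q = (\<Sum>j<2 * \<rho>. length (T (Suc j)))" unfolding q_def by (rule length_concat_family)
    also have "\<dots> = (\<Sum>j<2 * \<rho>. f)" using len(3) by (intro sum.cong) auto
    finally show ?thesis by simp
  qed
  ultimately show "\<exists>p q. length p = 2 * \<rho> * f \<and> length q = 2 * \<rho> * f \<and> walk E (a # p) \<and> walk E (b # q)
      \<and> last (a # p) = last (T (2 * \<rho> + 1)) \<and> last (b # q) = last (T (2 * \<rho>)) \<and> distinct (p @ q) \<and> set (p @ q) = Q"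
    using wp wq dp dq start \<rho>
    by - (rule exI[of _ p], rule exI[of _ q], simp add: walk_Cons_iff)
qed

section \<open>Connections, switches and networks inside an expander\<close>

locale branching_expander = expander +
  fixes h :: nat
  assumes h: "m \<le> 2 ^ h" "2 ^ h \<le> 2 * m"
begin

text \<open>The half grown from \<open>t\<close> runs against the arcs and is reversed. Each half
  needs one step through its port and \<open>h\<close> steps in its tree, hence
  \<open>2 * h + 2 \<le> l\<close>.\<close>

lemma connect_directed:
  assumes st: "state S c" and V: "a \<in> V" "t \<in> V" "a \<notin> Z - S" "t \<notin> Z - S" "1 \<le> c (a, True)" "1 \<le> c (t, False)"
    and l: "2 * h + 2 \<le> l" and budget: "card S + l + 26 * m < card Z"
  shows "\<exists>q. length q = l \<and> walk E (a # q @ [t]) \<and> distinct q \<and> set q \<subseteq> Z - S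
    \<and> state (S \<union> set q) (\<lambda>p. if fst p \<in> set q then 2 else c p - of_bool (p = (a, True)) - of_bool (p = (t, False)))"
proof -
  let ?bs1 = "replicate (h + 1) True" and ?bs2 = "replicate (l - h - 1) False"
  have "\<exists>q1 q2. pwalk E ?bs1 (fst (a, True)) q1 \<and> pwalk E ?bs2 (fst (t, False)) q2 \<and> (last q1, last q2) \<in> E \<and> distinct (q1 @ q2)
    \<and> set (q1 @ q2) \<subseteq> Z - S \<and> state (S \<union> set (q1 @ q2))
      (\<lambda>p. if fst p \<in> set (q1 @ q2) then 2 else c p - of_bool (p = (a, True)) - of_bool (p = (t, False)))"
    by (rule connect[OF st _ _ _ _ _ _ _ h]) (use V l budget in auto)
  then obtain q1 q2 where q: "pwalk E ?bs1 a q1" "pwalk E ?bs2 t q2" "(last q1, last q2) \<in> E" "distinct (q1 @ q2)"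
    "set (q1 @ q2) \<subseteq> Z - S" "state (S \<union> set (q1 @ q2))
      (\<lambda>p. if fst p \<in> set (q1 @ q2) then 2 else c p - of_bool (p = (a, True)) - of_bool (p = (t, False)))"
    unfolding fst_conv by (elim exE conjE)
  have len: "length q1 = h + 1" "length q2 = l - h - 1" using pwalk_length[OF q(1)] pwalk_length[OF q(2)] by simp_all
  have ne: "q1 \<noteq> []" "q2 \<noteq> []" using len l by auto
  have "walk E (a # q1)" "walk E (rev q2 @ [t])" using pwalk_True[OF q(1)] pwalk_False[OF q(2)] .
  moreover have "hd (rev q2 @ [t]) = last q2" using ne by (simp add: hd_rev)
  ultimately have "walk E ((a # q1) @ (rev q2 @ [t]))"
    using q(3) ne unfolding successively_append_iff[of _ "a # q1"] by simp
  moreover have "set (q1 @ rev q2) = set (q1 @ q2)" by simp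
  ultimately show ?thesis using q(4,5,6) len l
    by (intro exI[of _ "q1 @ rev q2"]) (simp only: append_Cons append_assoc, simp)
qed

text \<open>The vertices \<open>v i\<close> are tails and the \<open>u i\<close> are heads, and the
  two families of arcs are the two matchings. An additional arc from \<open>a\<close> to
  \<open>t\<close> closes the path to an alternating cycle; \<open>switch_gadget\<close> provides
  this arc beforehand.\<close>

lemma connect_alternating:
  assumes st: "state S c" and V: "a \<in> V" "t \<in> V" "a \<notin> Z - S" "t \<notin> Z - S" "1 \<le> c (a, True)" "1 \<le> c (t, False)"
    and n: "h < 2 * n" and budget: "card S + 4 * n + 2 + 26 * m < card Z"
  shows "\<exists>q u v. length q = 4 * n + 2 \<and> distinct q \<and> set q \<subseteq> Z - S \<and> v 0 = a \<and> u (2 * n + 1) = t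
    \<and> (\<forall>i\<le>2 * n. u i = q ! (2 * i) \<and> v (Suc i) = q ! (2 * i + 1)) \<and> (\<forall>i\<le>2 * n + 1. (v i, u i) \<in> E) \<and> (\<forall>i\<le>2 * n. (v (Suc i), u i) \<in> E)
    \<and> state (S \<union> set q) (\<lambda>p. if fst p \<in> set q then 2 else c p - of_bool (p = (a, True)) - of_bool (p = (t, False)))"
proof -
  \<comment> \<open>The half from \<open>a\<close> has an even number of steps and so ends at a
    tail. The half from \<open>t\<close> begins against an arc and ends, after an even number of
    steps, at a head. The arc supplied by \<open>connect\<close> therefore continues the
    alternation.\<close>
  let ?bs1 = "map even [0..<2 * n + 2]" and ?bs2 = "map odd [0..<2 * n]"
  have hd: "hd ?bs1 = True" "hd ?bs2 = False" using n by (auto simp: hd_map upt_conv_Cons)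
  have "\<exists>q1 q2. pwalk E ?bs1 (fst (a, True)) q1 \<and> pwalk E ?bs2 (fst (t, False)) q2 \<and> (last q1, last q2) \<in> E \<and> distinct (q1 @ q2)
    \<and> set (q1 @ q2) \<subseteq> Z - S \<and> state (S \<union> set (q1 @ q2))
      (\<lambda>p. if fst p \<in> set (q1 @ q2) then 2 else c p - of_bool (p = (a, True)) - of_bool (p = (t, False)))"
    by (rule connect[OF st _ _ _ _ _ _ _ h]) (use V n budget hd in auto)
  then obtain q1 q2 where q: "pwalk E ?bs1 a q1" "pwalk E ?bs2 t q2" "(last q1, last q2) \<in> E" "distinct (q1 @ q2)"
    "set (q1 @ q2) \<subseteq> Z - S" "state (S \<union> set (q1 @ q2))
      (\<lambda>p. if fst p \<in> set (q1 @ q2) then 2 else c p - of_bool (p = (a, True)) - of_bool (p = (t, False)))"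
    unfolding fst_conv by (elim exE conjE)
  have len: "length q1 = 2 * n + 2" "length q2 = 2 * n" using pwalk_length[OF q(1)] pwalk_length[OF q(2)] by simp_all
  have ne: "q1 \<noteq> []" "q2 \<noteq> []" using len n by auto
  define q where "q = q1 @ rev q2"
  define w where "w i = (a # q @ [t]) ! i" for i
  have w1: "w i = (a # q1) ! i" if "i \<le> 2 * n + 2" for i
    using that len unfolding w_def q_def by (cases i) (auto simp: nth_append)
  have w2: "w (2 * n + 3 + k) = (t # q2) ! (2 * n - k)" if "k \<le> 2 * n" for k
  proof -
    have "w (2 * n + 3 + k) = (rev q2 @ [t]) ! k" using len unfolding w_def q_def by (simp add: nth_append)
    also have "\<dots> = rev (t # q2) ! k" by simp
    also have "\<dots> = (t # q2) ! (2 * n - k)" using that len by (subst rev_nth) auto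
    finally show ?thesis .
  qed
  have edge: "if even i then (w i, w (Suc i)) \<in> E else (w (Suc i), w i) \<in> E" if i: "i < 4 * n + 3" for i
  proof -
    consider "i < 2 * n + 2" | "i = 2 * n + 2" | k where "i = 2 * n + 3 + k" "k < 2 * n"
    proof -
      have "i < 2 * n + 2 \<or> i = 2 * n + 2 \<or> i = 2 * n + 3 + (i - (2 * n + 3)) \<and> i - (2 * n + 3) < 2 * n"
        using i n by linarith
      then show ?thesis using that by blast
    qed
    then show ?thesis
    proof cases
      case 1
      have "step E (?bs1 ! i) ((a # q1) ! i) ((a # q1) ! Suc i)" by (rule pwalk_nth[OF q(1)]) (use 1 in simp)
      moreover have "?bs1 ! i = even i" using 1 by (simp del: upt_Suc)
      moreover have "w i = (a # q1) ! i" "w (Suc i) = (a # q1) ! Suc i" using 1 by (simp_all add: w1)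
      ultimately show ?thesis by (simp add: step_def)
    next
      case 2
      have "w i = last q1" using 2 w1[of i] len ne by (simp add: last_conv_nth)
      moreover have "w (Suc i) = last q2" using 2 w2[of 0] len ne n by (simp add: last_conv_nth numeral_3_eq_3)
      ultimately show ?thesis using q(3) 2 by simp
    next
      case (3 k)
      define j where "j = 2 * n - k - 1"
      have j: "j < 2 * n" "2 * n - k = Suc j" "2 * n - Suc k = j" using 3 by (auto simp: j_def)
      have "step E (?bs2 ! j) ((t # q2) ! j) ((t # q2) ! Suc j)" by (rule pwalk_nth[OF q(2)]) (use j in simp)
      moreover have "?bs2 ! j = odd j" using j by simp
      moreover have "w i = (t # q2) ! Suc j" using 3 w2[of k] j by simp
      moreover have "w (Suc i) = (t # q2) ! j" using 3 w2[of "Suc k"] j by simp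
      moreover have "odd j = odd i" using 3 j by presburger
      ultimately show ?thesis by (auto simp: step_def split: if_splits)
    qed
  qed
  have lq: "length q = 4 * n + 2" using len by (simp add: q_def)
  have wq: "w (Suc i) = q ! i" if "i < 4 * n + 2" for i using that lq by (simp add: w_def nth_append)
  have sq: "set q = set (q1 @ q2)" by (simp add: q_def)
  show ?thesis
  proof (rule exI[of _ q], rule exI[of _ "\<lambda>i. w (2 * i + 1)"], rule exI[of _ "\<lambda>i. w (2 * i)"], intro conjI allI impI)
    show "length q = 4 * n + 2" by (rule lq)
    show "distinct q" using q(4) by (simp add: q_def)
    show "set q \<subseteq> Z - S" using q(5) sq by simp
    show "w (2 * 0) = a" by (simp add: w_def)
    show "w (2 * (2 * n + 1) + 1) = t" using lq by (simp add: w_def nth_append)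
    show "w (2 * i + 1) = q ! (2 * i)" if "i \<le> 2 * n" for i using wq[of "2 * i"] that by simp
    show "w (2 * Suc i) = q ! (2 * i + 1)" if "i \<le> 2 * n" for i using wq[of "2 * i + 1"] that by simp
    show "(w (2 * i), w (2 * i + 1)) \<in> E" if "i \<le> 2 * n + 1" for i using edge[of "2 * i"] that by simp
    show "(w (2 * Suc i), w (2 * i + 1)) \<in> E" if "i \<le> 2 * n" for i using edge[of "2 * i + 1"] that by simp
    show "state (S \<union> set q) (\<lambda>p. if fst p \<in> set q then 2 else c p - of_bool (p = (a, True)) - of_bool (p = (t, False)))"
      using q(6) sq by simp
  qed
qed

lemma extend_directed:
  assumes st: "state S c" and V: "a \<in> V" "a \<notin> Z - S" "1 \<le> c (a, True)" and l: "1 \<le> l" and budget: "card S + l + 18 * m < card Z"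
  shows "\<exists>q. length q = l \<and> walk E (a # q) \<and> distinct q \<and> set q \<subseteq> Z - S
    \<and> state (S \<union> set q) (\<lambda>p. if fst p \<in> set q then 3 else if p = (a, True) then c p - 1 else c p)"
proof -
  have l': "True # replicate (l - 1) True = replicate l True" using l by (cases l) auto
  have "card S + length (replicate (l - 1) True) + 18 * m < card Z" using budget l by simp
  from extend_path[OF st V this] obtain q where q: "pwalk E (True # replicate (l - 1) True) a q" "distinct q" "set q \<subseteq> Z - S"
    "state (S \<union> set q) (\<lambda>p. if fst p \<in> set q then 3 else if p = (a, True) then c p - 1 else c p)" by (elim exE conjE)
  from q(1) have "length q = l" "walk E (a # q)" unfolding l' by (auto dest: pwalk_length pwalk_True)
  then show ?thesis using q by blast
qed

text \<open>\<open>a\<close> spends outgoing and \<open>t\<close> incoming ports, so the two maps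
  may share vertices. The last clause records that all other demand outside the new paths is
  untouched, from which later constructions start.\<close>

lemma connect_family:
  assumes "finite K" "state S c" "inj_on a K" "inj_on t K"
    "\<And>i. i \<in> K \<Longrightarrow> a i \<in> V \<and> t i \<in> V \<and> a i \<notin> Z - S \<and> t i \<notin> Z - S \<and> 1 \<le> c (a i, True) \<and> 1 \<le> c (t i, False) \<and> 2 * h + 2 \<le> l i"
    "card S + sum l K + 26 * m < card Z"
  shows "\<exists>F c'. (\<forall>i\<in>K. length (F i) = l i \<and> walk E (a i # F i @ [t i]) \<and> distinct (F i))
    \<and> disjoint_family_on (\<lambda>i. set (F i)) K \<and> (\<Union>i\<in>K. set (F i)) \<subseteq> Z - S \<and> state (S \<union> (\<Union>i\<in>K. set (F i))) c'
    \<and> (\<forall>p. fst p \<notin> (\<Union>i\<in>K. set (F i)) \<longrightarrow> p \<notin> a ` K \<times> {True} \<union> t ` K \<times> {False} \<longrightarrow> c' p = c p)"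
  using assms
proof (induction K)
  case empty
  then show ?case by (intro exI[of _ "\<lambda>_. []"] exI[of _ c]) (auto simp: disjoint_family_on_def)
next
  case (insert k K)
  have fS: "finite S" using insert.prems finite_state by blast
  have "\<exists>F c'. (\<forall>i\<in>K. length (F i) = l i \<and> walk E (a i # F i @ [t i]) \<and> distinct (F i))
    \<and> disjoint_family_on (\<lambda>i. set (F i)) K \<and> (\<Union>i\<in>K. set (F i)) \<subseteq> Z - S \<and> state (S \<union> (\<Union>i\<in>K. set (F i))) c'
    \<and> (\<forall>p. fst p \<notin> (\<Union>i\<in>K. set (F i)) \<longrightarrow> p \<notin> a ` K \<times> {True} \<union> t ` K \<times> {False} \<longrightarrow> c' p = c p)"
    by (rule insert.IH) (use insert.prems insert.hyps in \<open>auto\<close>)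
  then obtain F c1 where F: "\<forall>i\<in>K. length (F i) = l i \<and> walk E (a i # F i @ [t i]) \<and> distinct (F i)"
    "disjoint_family_on (\<lambda>i. set (F i)) K" "(\<Union>i\<in>K. set (F i)) \<subseteq> Z - S" "state (S \<union> (\<Union>i\<in>K. set (F i))) c1"
    "\<forall>p. fst p \<notin> (\<Union>i\<in>K. set (F i)) \<longrightarrow> p \<notin> a ` K \<times> {True} \<union> t ` K \<times> {False} \<longrightarrow> c1 p = c p" by (elim exE conjE)
  define Q where "Q = (\<Union>i\<in>K. set (F i))"
  have QZ: "Q \<subseteq> Z - S" using F(3) by (simp add: Q_def)
  have k: "a k \<in> V" "t k \<in> V" "a k \<notin> Z - S" "t k \<notin> Z - S" "1 \<le> c (a k, True)" "1 \<le> c (t k, False)" "2 * h + 2 \<le> l k"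
    using insert.prems(4)[of k] by auto
  have ak: "a k \<notin> a ` K" "t k \<notin> t ` K" using insert.prems(2,3) insert.hyps by auto
  have frame: "c1 p = c p" if "fst p \<notin> Q" "p \<notin> a ` K \<times> {True}" "p \<notin> t ` K \<times> {False}" for p
    using F(5)[folded Q_def] that by blast
  have "a k \<notin> Q" "t k \<notin> Q" using k(3,4) QZ by auto
  then have c1a: "c1 (a k, True) = c (a k, True)" and c1t: "c1 (t k, False) = c (t k, False)" using ak by (auto intro!: frame)
  have "card Q \<le> (\<Sum>i\<in>K. card (set (F i)))" unfolding Q_def by (rule card_UN_le[OF insert.hyps(1)])
  also have "\<dots> \<le> sum l K" using F(1) by (intro sum_mono) (metis card_length)
  finally have "card (S \<union> Q) \<le> card S + sum l K" using card_Un_le[of S Q] by linarith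
  then have bud: "card (S \<union> Q) + l k + 26 * m < card Z" using insert.prems(5) insert.hyps by simp
  have kS: "a k \<notin> Z - (S \<union> Q)" "t k \<notin> Z - (S \<union> Q)" using k by auto
  have k1: "1 \<le> c1 (a k, True)" "1 \<le> c1 (t k, False)" using k c1a c1t by simp_all
  from connect_directed[OF F(4)[folded Q_def] k(1,2) kS k1 k(7) bud]
  obtain q where q: "length q = l k" "walk E (a k # q @ [t k])" "distinct q" "set q \<subseteq> Z - (S \<union> Q)"
    "state (S \<union> Q \<union> set q) (\<lambda>p. if fst p \<in> set q then 2 else c1 p - of_bool (p = (a k, True)) - of_bool (p = (t k, False)))"
    by (elim exE conjE)
  define c' where "c' = (\<lambda>p. if fst p \<in> set q then 2 else c1 p - of_bool (p = (a k, True)) - of_bool (p = (t k, False)))"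
  define F' where "F' = F(k := q)"
  have F'K: "F' i = F i" if "i \<in> K" for i using that insert.hyps by (auto simp: F'_def)
  have F'k: "F' k = q" by (simp add: F'_def)
  have U: "(\<Union>i\<in>insert k K. set (F' i)) = Q \<union> set q" using F'K F'k by (auto simp: Q_def)
  have "\<forall>i\<in>insert k K. length (F' i) = l i \<and> walk E (a i # F' i @ [t i]) \<and> distinct (F' i)"
    using F(1) q F'K F'k by auto
  moreover have "disjoint_family_on (\<lambda>i. set (F' i)) (insert k K)"
  proof -
    have "set (F i) \<inter> set q = {}" if "i \<in> K" for i using that q(4) unfolding Q_def by blast
    then show ?thesis using F(2) F'K F'k unfolding disjoint_family_on_def by (auto simp: Int_commute)
  qed
  moreover have "(\<Union>i\<in>insert k K. set (F' i)) \<subseteq> Z - S" unfolding U using QZ q(4) by auto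
  moreover have "state (S \<union> (\<Union>i\<in>insert k K. set (F' i))) c'" unfolding U using q(5) by (simp add: c'_def Un_assoc)
  moreover have "\<forall>p. fst p \<notin> (\<Union>i\<in>insert k K. set (F' i)) \<longrightarrow> p \<notin> a ` insert k K \<times> {True} \<union> t ` insert k K \<times> {False} \<longrightarrow> c' p = c p"
  proof (intro allI impI)
    fix p assume p: "fst p \<notin> (\<Union>i\<in>insert k K. set (F' i))" "p \<notin> a ` insert k K \<times> {True} \<union> t ` insert k K \<times> {False}"
    then have "fst p \<notin> Q" "fst p \<notin> set q" unfolding U by auto
    moreover have "p \<noteq> (a k, True)" "p \<noteq> (t k, False)" "p \<notin> a ` K \<times> {True} \<union> t ` K \<times> {False}" using p(2) by auto
    ultimately show "c' p = c p" using frame[of p] unfolding c'_def by simp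
  qed
  ultimately show ?case by blast
qed

end

context branching_expander
begin

text \<open>\<open>f\<close> is the length \<open>2 * h + 2\<close> of a shortest connection plus
  its two ends on the cycle. The cycle has \<open>2 * \<rho>\<close> tails and as many heads;
  \<open>\<rho> = h + 2\<close> makes both halves of the alternating path longer than
  \<open>h\<close>, as their trees require. The long segments lead from \<open>a\<close> to the
  cycle and from the cycle to the exit \<open>e\<close>.\<close>

lemma switch_gadget:
  defines "f \<equiv> 2 * h + 4" and "\<rho> \<equiv> h + 2"
  assumes st: "state S c" and V: "a \<in> V" "b \<in> V" "a \<noteq> b" "a \<notin> Z - S" "b \<notin> Z - S" "1 \<le> c (a, True)" "1 \<le> c (b, True)"
    and budget: "card S + 2 * (2 * \<rho> * f) + 26 * m < card Z"
  shows "\<exists>d e Q c'. Q \<subseteq> Z - S \<and> d \<in> Q \<and> e \<in> Q \<and> d \<noteq> e \<and> state (S \<union> Q) c' \<and> 1 \<le> c' (d, True) \<and> 1 \<le> c' (e, True)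
    \<and> (\<forall>p. fst p \<notin> Q \<longrightarrow> p \<notin> {a, b} \<times> {True} \<longrightarrow> c' p = c p)
    \<and> (\<exists>p q. length p = 2 * \<rho> * f \<and> length q = 2 * \<rho> * f \<and> walk E (a # p) \<and> walk E (b # q)
      \<and> last (a # p) = d \<and> last (b # q) = e \<and> distinct (p @ q) \<and> set (p @ q) = Q)
    \<and> (\<exists>p q. length p = 2 * \<rho> * f \<and> length q = 2 * \<rho> * f \<and> walk E (a # p) \<and> walk E (b # q)
      \<and> last (a # p) = e \<and> last (b # q) = d \<and> distinct (p @ q) \<and> set (p @ q) = Q)"
proof -
  define n where "n = h + 1"
  have n: "2 * \<rho> = 2 * n + 2" "h < 2 * n" "f = 2 * n + 2" by (auto simp: n_def \<rho>_def f_def)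
  define g where "g = \<rho> * f"
  have g: "1 \<le> g" "f \<le> g" by (auto simp: g_def \<rho>_def f_def)
  \<comment> \<open>The vertices in order of construction: the two long segments, the alternating
    path, \<open>D\<close>, and the family of connections.\<close>
  have tot: "2 * (2 * \<rho> * f) = 2 * g + (4 * n + 2) + (f - 1) + ((f - 1) + 2 * n * (f - 2))"
  proof -
    have "2 * \<rho> * f = (2 * n + 2) * f" using n(1) by simp
    also have "\<dots> = (4 * n + 2) + (f - 1) + ((f - 1) + 2 * n * (f - 2))" using n(3) by (simp add: algebra_simps)
    finally have "2 * \<rho> * f = (4 * n + 2) + (f - 1) + ((f - 1) + 2 * n * (f - 2))" .
    moreover have "2 * g = 2 * \<rho> * f" by (simp add: g_def)
    ultimately show ?thesis by linarith
  qed
  have bud: "card S + (2 * g + (4 * n + 2) + (f - 1) + ((f - 1) + 2 * n * (f - 2))) + 26 * m < card Z"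
    using budget unfolding tot .
  have b1: "card S + g + 18 * m < card Z" using bud by linarith
  from extend_directed[OF st V(1,4,6) g(1) b1] obtain A where A: "length A = g" "walk E (a # A)" "distinct A" "set A \<subseteq> Z - S"
    "state (S \<union> set A) (\<lambda>p. if fst p \<in> set A then 3 else if p = (a, True) then c p - 1 else c p)" by (elim exE conjE)
  define S1 where "S1 = S \<union> set A"
  define c1 where "c1 = (\<lambda>p. if fst p \<in> set A then 3 else if p = (a, True) then c p - 1 else c p)"
  have st1: "state S1 c1" using A(5) by (simp add: S1_def c1_def)
  have cS1: "card S1 \<le> card S + g" unfolding S1_def using card_Un_le[of S "set A"] card_length[of A] A(1) by linarith
  \<comment> \<open>This is the vertex with two outgoing arcs in the switch: one to
    \<open>hd B\<close>, chosen now, and one to the start of the alternating path. Both are needed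
    to close the cycle.\<close>
  define v0 where "v0 = last A"
  have Ane: "A \<noteq> []" using A(1) g by auto
  then have v0A: "v0 \<in> set A" by (simp add: v0_def)
  have v0: "v0 \<in> V" "v0 \<notin> Z - S1" "1 \<le> c1 (v0, True)" using v0A A(4) ZV by (auto simp: S1_def c1_def)
  have b2: "card S1 + g + 18 * m < card Z" using bud cS1 by linarith
  from extend_directed[OF st1 v0 g(1) b2] obtain B where B: "length B = g" "walk E (v0 # B)" "distinct B" "set B \<subseteq> Z - S1"
    "state (S1 \<union> set B) (\<lambda>p. if fst p \<in> set B then 3 else if p = (v0, True) then c1 p - 1 else c1 p)" by (elim exE conjE)
  define S2 where "S2 = S1 \<union> set B"
  define c2 where "c2 = (\<lambda>p. if fst p \<in> set B then 3 else if p = (v0, True) then c1 p - 1 else c1 p)"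
  have st2: "state S2 c2" using B(5) by (simp add: S2_def c2_def)
  have cS2: "card S2 \<le> card S + 2 * g" unfolding S2_def using card_Un_le[of S1 "set B"] card_length[of B] B(1) cS1 by linarith
  have Bne: "B \<noteq> []" using B(1) g by auto
  define t where "t = hd B"
  have tB: "t \<in> set B" using Bne by (simp add: t_def)
  have AB: "set A \<inter> set B = {}" using B(4) by (auto simp: S1_def)
  have v0B: "v0 \<notin> set B" using AB v0A by auto
  have v2: "v0 \<notin> Z - S2" "1 \<le> c2 (v0, True)" using v0A v0B by (auto simp: S2_def S1_def c2_def c1_def)
  have t2: "t \<in> V" "t \<notin> Z - S2" "1 \<le> c2 (t, False)" using tB B(4) ZV by (auto simp: S2_def c2_def)
  have b3: "card S2 + 4 * n + 2 + 26 * m < card Z" using bud cS2 by linarith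
  from connect_alternating[OF st2 v0(1) t2(1) v2(1) t2(2) v2(2) t2(3) n(2) b3] obtain q u v where q: "length q = 4 * n + 2" "distinct q" "set q \<subseteq> Z - S2"
    and uv: "v 0 = v0" "u (2 * n + 1) = t" "\<forall>i\<le>2 * n. u i = q ! (2 * i) \<and> v (Suc i) = q ! (2 * i + 1)"
    "\<forall>i\<le>2 * n + 1. (v i, u i) \<in> E" "\<forall>i\<le>2 * n. (v (Suc i), u i) \<in> E"
    and q5: "state (S2 \<union> set q) (\<lambda>p. if fst p \<in> set q then 2 else c2 p - of_bool (p = (v0, True)) - of_bool (p = (t, False)))"
    by (elim exE conjE)
  define S3 where "S3 = S2 \<union> set q"
  define c3 where "c3 = (\<lambda>p. if fst p \<in> set q then 2 else c2 p - of_bool (p = (v0, True)) - of_bool (p = (t, False)))"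
  have st3: "state S3 c3" using q5 by (simp add: S3_def c3_def)
  have cS3: "card S3 \<le> card S + 2 * g + (4 * n + 2)" unfolding S3_def using card_Un_le[of S2 "set q"] card_length[of q] q(1) cS2 by linarith
  have uq: "u i = q ! (2 * i)" "v (Suc i) = q ! (2 * i + 1)" if "i \<le> 2 * n" for i using uv(3) that by auto
  have uq_in: "u i \<in> set q" "v (Suc i) \<in> set q" if "i \<le> 2 * n" for i using uq[OF that] that q(1) by auto
  have u_inj: "i = j" if "u i = u j" "i \<le> 2 * n" "j \<le> 2 * n" for i j
    using that uq(1)[OF that(2)] uq(1)[OF that(3)] q(1,2) by (auto simp: nth_eq_iff_index_eq)
  have v_inj: "i = j" if "v (Suc i) = v (Suc j)" "i \<le> 2 * n" "j \<le> 2 * n" for i j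
    using that uq(2)[OF that(2)] uq(2)[OF that(3)] q(1,2) by (auto simp: nth_eq_iff_index_eq)
  have u_inj': "i = j" if "u (i - 2) = u (j - 2)" "2 \<le> i" "i \<le> 2 * n + 2" "2 \<le> j" "j \<le> 2 * n + 2" for i j
  proof -
    have "i - 2 = j - 2" using that by (intro u_inj) auto
    then show ?thesis using that by linarith
  qed
  have v_inj': "i = j" if "v i = v j" "1 \<le> i" "i \<le> 2 * n + 1" "1 \<le> j" "j \<le> 2 * n + 1" for i j
  proof -
    have "i - 1 = j - 1" using that by (intro v_inj) auto
    then show ?thesis using that by linarith
  qed
  have uv_ne: "u i \<noteq> v (Suc j)" if "i \<le> 2 * n" "j \<le> 2 * n" for i j
  proof
    assume "u i = v (Suc j)"
    then have "q ! (2 * i) = q ! (2 * j + 1)" using uq that by metis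
    then have "2 * i = 2 * j + 1" using that q(1,2) by (subst (asm) nth_eq_iff_index_eq) auto
    then show False by presburger
  qed
  have q_set: "set q = (\<Union>i\<le>2 * n. {u i, v (Suc i)})"
  proof
    show "(\<Union>i\<le>2 * n. {u i, v (Suc i)}) \<subseteq> set q" using uq_in by blast
    show "set q \<subseteq> (\<Union>i\<le>2 * n. {u i, v (Suc i)})"
    proof
      fix x assume "x \<in> set q"
      then obtain k where k: "k < 4 * n + 2" "x = q ! k" using q(1) by (metis in_set_conv_nth)
      have "k div 2 \<le> 2 * n" using k(1) by linarith
      moreover have "k = 2 * (k div 2) \<or> k = 2 * (k div 2) + 1" by presburger
      then have "x = u (k div 2) \<or> x = v (Suc (k div 2))" using k(2) uq[OF \<open>k div 2 \<le> 2 * n\<close>] by metis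
      ultimately show "x \<in> (\<Union>i\<le>2 * n. {u i, v (Suc i)})" by blast
    qed
  qed
  have u2n: "u (2 * n) \<in> V" "u (2 * n) \<notin> Z - S3" "1 \<le> c3 (u (2 * n), True)"
    using uq_in[of "2 * n"] q(3) ZV by (auto simp: S3_def c3_def)
  have f1: "1 \<le> f - 1" using n by simp
  have b4: "card S3 + (f - 1) + 18 * m < card Z" using bud cS3 by linarith
  from extend_directed[OF st3 u2n f1 b4] obtain D where D: "length D = f - 1" "walk E (u (2 * n) # D)" "distinct D" "set D \<subseteq> Z - S3"
    "state (S3 \<union> set D) (\<lambda>p. if fst p \<in> set D then 3 else if p = (u (2 * n), True) then c3 p - 1 else c3 p)" by (elim exE conjE)
  define S4 where "S4 = S3 \<union> set D"
  define c4 where "c4 = (\<lambda>p. if fst p \<in> set D then 3 else if p = (u (2 * n), True) then c3 p - 1 else c3 p)"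
  have st4: "state S4 c4" using D(5) by (simp add: S4_def c4_def)
  have cS4: "card S4 \<le> card S + 2 * g + (4 * n + 2) + (f - 1)" unfolding S4_def using card_Un_le[of S3 "set D"] card_length[of D] D(1) cS3 by linarith
  \<comment> \<open>The segments that end at a tail of the cycle. Segment \<open>j\<close> comes
    from \<open>u (j - 2)\<close>, except that segment 1 is entered from \<open>b\<close>. Segment
    \<open>2 * n + 2\<close> may end anywhere and has been built with \<open>D\<close>.\<close>
  define K where "K = {1..2 * n + 1}"
  define src where "src j = (if j = 1 then b else u (j - 2))" for j
  \<comment> \<open>Segment 1 contains one cycle vertex and the other connected segments contain
    two, so that all of them have \<open>f\<close> vertices.\<close>
  define l where "l j = (if j = 1 then f - 1 else f - 2)" for j :: nat
  have bS: "b \<notin> set A" "b \<notin> set B" "b \<notin> set q" "b \<notin> set D" using V(5) A(4) B(4) q(3) D(4) by (auto simp: S1_def S2_def S3_def)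
  have qA: "set q \<inter> set A = {}" "set q \<inter> set B = {}" "set q \<inter> set D = {}" "set A \<inter> set D = {}" "set B \<inter> set D = {}"
    using q(3) D(4) by (auto simp: S1_def S2_def S3_def)
  have aS: "a \<notin> set A" "a \<notin> set B" "a \<notin> set q" "a \<notin> set D" using V(4) A(4) B(4) q(3) D(4) by (auto simp: S1_def S2_def S3_def)
  have c4q: "2 \<le> c4 p" if "fst p \<in> set q" "p \<noteq> (u (2 * n), True)" for p
    using that qA by (auto simp: c4_def c3_def)
  have c4b: "c4 (b, True) = c (b, True)"
    using bS V(3) v0A tB uq_in[of "2 * n"] by (auto simp: c4_def c3_def c2_def c1_def)
  have KC: "src i \<in> V \<and> v i \<in> V \<and> src i \<notin> Z - S4 \<and> v i \<notin> Z - S4 \<and> 1 \<le> c4 (src i, True) \<and> 1 \<le> c4 (v i, False) \<and> 2 * h + 2 \<le> l i"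
    if i: "i \<in> K" for i
  proof -
    have "i - 1 \<le> 2 * n" "Suc (i - 1) = i" using i by (auto simp: K_def)
    then have vq: "v i \<in> set q" using uq_in(2)[of "i - 1"] by simp
    then have 1: "v i \<in> V" "v i \<notin> Z - S4" "1 \<le> c4 (v i, False)"
      using q(3) ZV c4q[of "(v i, False)"] by (auto simp: S4_def S3_def)
    have 2: "src i \<in> V \<and> src i \<notin> Z - S4 \<and> 1 \<le> c4 (src i, True)"
    proof (cases "i = 1")
      case True
      then show ?thesis using V c4b by (auto simp: src_def S4_def S3_def S2_def S1_def)
    next
      case False
      then have i2: "i - 2 \<le> 2 * n" "i - 2 \<noteq> 2 * n" using i by (auto simp: K_def)
      then have "src i \<in> set q" "src i \<noteq> u (2 * n)" using False uq_in u_inj[of "i - 2" "2 * n"] by (auto simp: src_def)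
      then show ?thesis using q(3) ZV c4q[of "(src i, True)"] by (auto simp: S4_def S3_def)
    qed
    have "2 * h + 2 \<le> l i" by (auto simp: l_def f_def)
    then show ?thesis using 1 2 by blast
  qed
  have "inj_on src K"
  proof (rule inj_onI)
    fix i j assume ij: "i \<in> K" "j \<in> K" "src i = src j"
    have K2: "k = 1 \<or> (2 \<le> k \<and> k \<le> 2 * n + 2)" "k - 2 \<le> 2 * n" if "k \<in> K" for k using that by (auto simp: K_def)
    have "src k \<noteq> src 1" if "k \<in> K" "k \<noteq> 1" for k
      using that bS(3) uq_in(1)[OF K2(2)[OF that(1)]] by (auto simp: src_def)
    then have "i = 1 \<longleftrightarrow> j = 1" using ij by metis
    then show "i = j" using K2(1)[OF ij(1)] K2(1)[OF ij(2)] ij(3) u_inj'[of i j] by (auto simp: src_def)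
  qed
  moreover have "inj_on v K"
  proof (rule inj_onI)
    fix i j assume ij: "i \<in> K" "j \<in> K" "v i = v j"
    then show "i = j" using v_inj'[of i j] by (auto simp: K_def)
  qed
  moreover have sl: "sum l K = (f - 1) + 2 * n * (f - 2)"
  proof -
    have "K = insert 1 {2..2 * n + 1}" by (auto simp: K_def)
    then have "sum l K = l 1 + sum l {2..2 * n + 1}" by simp
    also have "sum l {2..2 * n + 1} = (\<Sum>i\<in>{2..2 * n + 1}. f - 2)" by (intro sum.cong) (auto simp: l_def)
    finally show ?thesis by (simp add: l_def)
  qed
  then have b5: "card S4 + sum l K + 26 * m < card Z" using bud cS4 by linarith
  moreover have "finite K" by (simp add: K_def)
  ultimately have "\<exists>F c'. (\<forall>i\<in>K. length (F i) = l i \<and> walk E (src i # F i @ [v i]) \<and> distinct (F i))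
    \<and> disjoint_family_on (\<lambda>i. set (F i)) K \<and> (\<Union>i\<in>K. set (F i)) \<subseteq> Z - S4 \<and> state (S4 \<union> (\<Union>i\<in>K. set (F i))) c'
    \<and> (\<forall>p. fst p \<notin> (\<Union>i\<in>K. set (F i)) \<longrightarrow> p \<notin> src ` K \<times> {True} \<union> v ` K \<times> {False} \<longrightarrow> c' p = c4 p)"
    using KC by (intro connect_family[OF _ st4]) auto
  then obtain F c5 where F: "\<forall>i\<in>K. length (F i) = l i \<and> walk E (src i # F i @ [v i]) \<and> distinct (F i)"
    "disjoint_family_on (\<lambda>i. set (F i)) K" "(\<Union>i\<in>K. set (F i)) \<subseteq> Z - S4" "state (S4 \<union> (\<Union>i\<in>K. set (F i))) c5"
    and fr5: "\<forall>p. fst p \<notin> (\<Union>i\<in>K. set (F i)) \<longrightarrow> p \<notin> src ` K \<times> {True} \<union> v ` K \<times> {False} \<longrightarrow> c5 p = c4 p" by (elim exE conjE)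
  define FF where "FF = (\<Union>i\<in>K. set (F i))"
  have FFd: "FF \<inter> set A = {}" "FF \<inter> set B = {}" "FF \<inter> set q = {}" "FF \<inter> set D = {}" "FF \<inter> S = {}" "FF \<subseteq> Z"
    using F(3) unfolding FF_def[symmetric] by (auto simp: S4_def S3_def S2_def S1_def)
  define T where "T j = (if j = 0 then A else if j = 1 then F 1 @ [v 1] else if j \<le> 2 * n + 1 then u (j - 2) # F j @ [v j]
    else if j = 2 * n + 2 then u (2 * n) # D else B)" for j
  have Tj: "T 0 = A" "T 1 = F 1 @ [v 1]" "T (2 * n + 2) = u (2 * n) # D" "T (2 * n + 3) = B"
    "\<And>j. 2 \<le> j \<Longrightarrow> j \<le> 2 * n + 1 \<Longrightarrow> T j = u (j - 2) # F j @ [v j]" by (auto simp: T_def)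
  \<comment> \<open>For disjointness each segment is divided into its vertices on the alternating
    path \<open>q\<close>, collected in \<open>P\<close>, and the others, collected in
    \<open>R\<close>.\<close>
  define P where "P j = (if 2 \<le> j \<and> j \<le> 2 * n + 2 then {u (j - 2)} else {}) \<union> (if 1 \<le> j \<and> j \<le> 2 * n + 1 then {v j} else {})" for j
  define R where "R j = (if j = 0 then set A else if j \<le> 2 * n + 1 then set (F j) else if j = 2 * n + 2 then set D else set B)" for j
  have jcases: "j = 0 \<or> j = 1 \<or> (2 \<le> j \<and> j \<le> 2 * n + 1) \<or> j = 2 * n + 2 \<or> j = 2 * n + 3" if "j \<le> 2 * n + 3" for j
    using that by linarith
  have TPR: "set (T j) = P j \<union> R j" if "j \<le> 2 * n + 3" for j
    using that by (auto simp: T_def P_def R_def)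
  have Pq: "P j \<subseteq> set q" for j
  proof -
    have "u (j - 2) \<in> set q" if "2 \<le> j" "j \<le> 2 * n + 2" using that uq_in(1)[of "j - 2"] by auto
    moreover have "v j \<in> set q" if "1 \<le> j" "j \<le> 2 * n + 1" using that uq_in(2)[of "j - 1"] by auto
    ultimately show ?thesis by (auto simp: P_def)
  qed
  have PP: "P i \<inter> P j = {}" if ij: "i \<noteq> j" for i j
  proof -
    have 1: "u (i - 2) \<noteq> u (j - 2)" if "2 \<le> i" "i \<le> 2 * n + 2" "2 \<le> j" "j \<le> 2 * n + 2" using that ij u_inj'[of i j] by blast
    have 2: "v i \<noteq> v j" if "1 \<le> i" "i \<le> 2 * n + 1" "1 \<le> j" "j \<le> 2 * n + 1" using that ij v_inj'[of i j] by blast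
    have 3: "u (i - 2) \<noteq> v j" if "2 \<le> i" "i \<le> 2 * n + 2" "1 \<le> j" "j \<le> 2 * n + 1" for i j using that uv_ne[of "i - 2" "j - 1"] by auto
    show ?thesis using 1 2 3[of i j] 3[of j i] by (auto simp: P_def)
  qed
  have FK: "set (F j) \<subseteq> FF" if "1 \<le> j" "j \<le> 2 * n + 1" for j using that by (auto simp: FF_def K_def)
  have Rq: "R j \<inter> set q = {}" if "j \<le> 2 * n + 3" for j
  proof (cases "1 \<le> j \<and> j \<le> 2 * n + 1")
    case True
    then have "R j = set (F j)" by (auto simp: R_def)
    then show ?thesis using FK[of j] FFd(3) True by blast
  next
    case False
    then have "j = 0 \<or> j = 2 * n + 2 \<or> j = 2 * n + 3" using that by linarith
    then have "R j = set A \<or> R j = set D \<or> R j = set B" by (auto simp: R_def)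
    then show ?thesis using qA by blast
  qed
  have RR: "R i \<inter> R j = {}" if ij: "i \<noteq> j" "i \<le> 2 * n + 3" "j \<le> 2 * n + 3" for i j
  proof -
    have FFi: "set (F i) \<inter> set (F j) = {}" if "i \<in> K" "j \<in> K" using F(2) ij that by (auto simp: disjoint_family_on_def)
    have R0: "R j = (if j \<in> K then set (F j) else if j = 0 then set A else if j = 2 * n + 2 then set D else set B)" if "j \<le> 2 * n + 3" for j
      using that by (auto simp: R_def K_def)
    have FK': "set (F j) \<subseteq> FF" if "j \<in> K" for j using that by (auto simp: FF_def)
    have nK: "j \<notin> K \<Longrightarrow> j = 0 \<or> j = 2 * n + 2 \<or> j = 2 * n + 3" if "j \<le> 2 * n + 3" for j using that by (auto simp: K_def)
    show ?thesis
    proof (cases "i \<in> K")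
      case True
      show ?thesis
      proof (cases "j \<in> K")
        case False
        then show ?thesis using True FK'[of i] FFd R0[OF ij(2)] R0[OF ij(3)] by auto
      qed (use True FFi R0[OF ij(2)] R0[OF ij(3)] in simp)
    next
      case iF: False
      show ?thesis
      proof (cases "j \<in> K")
        case True
        then show ?thesis using iF FK'[of j] FFd R0[OF ij(2)] R0[OF ij(3)] by auto
      next
        case False
        then show ?thesis using iF nK[OF ij(2)] nK[OF ij(3)] ij(1) R0[OF ij(2)] R0[OF ij(3)] AB qA by auto
      qed
    qed
  qed
  define Q where "Q = (\<Union>j\<le>2 * \<rho> + 1. set (T j))"
  have rho: "2 * \<rho> + 1 = 2 * n + 3" using n(1) by simp
  have Pun: "(\<Union>j\<le>2 * n + 3. P j) = set q"
  proof
    show "(\<Union>j\<le>2 * n + 3. P j) \<subseteq> set q" using Pq by blast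
    show "set q \<subseteq> (\<Union>j\<le>2 * n + 3. P j)"
    proof
      fix x assume "x \<in> set q"
      then obtain i where i: "i \<le> 2 * n" "x = u i \<or> x = v (Suc i)" unfolding q_set by auto
      then have "x \<in> P (i + 2) \<or> x \<in> P (Suc i)" by (auto simp: P_def)
      moreover have "i + 2 \<in> {..2 * n + 3}" "Suc i \<in> {..2 * n + 3}" using i(1) by auto
      ultimately show "x \<in> (\<Union>j\<le>2 * n + 3. P j)" by blast
    qed
  qed
  have Run: "(\<Union>j\<le>2 * n + 3. R j) = set A \<union> FF \<union> set D \<union> set B"
  proof -
    have "{..2 * n + 3} = {0} \<union> K \<union> {2 * n + 2} \<union> {2 * n + 3}" by (auto simp: K_def)
    moreover have "(\<Union>j\<in>K. R j) = FF" unfolding FF_def by (intro SUP_cong) (auto simp: R_def K_def)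
    moreover have "R 0 = set A" "R (2 * n + 2) = set D" "R (2 * n + 3) = set B" by (auto simp: R_def)
    ultimately show ?thesis by (simp only: UN_Un UN_insert UN_empty Un_empty_right)
  qed
  have Qeq: "Q = set q \<union> (set A \<union> FF \<union> set D \<union> set B)"
    unfolding Q_def rho Pun[symmetric] Run[symmetric] using TPR by auto
  have lastT: "last (T j) = v j" if j: "j \<le> 2 * n + 1" for j
  proof -
    have "j = 0 \<or> j = 1 \<or> (2 \<le> j \<and> j \<le> 2 * n + 1)" using j by linarith
    then show ?thesis by (auto simp: T_def uv(1) v0_def)
  qed
  have hdT: "hd (T (j + 2)) = u j" if j: "j \<le> 2 * n + 1" for j
  proof -
    have "j + 2 \<le> 2 * n + 1 \<or> j = 2 * n \<or> j = 2 * n + 1" using j by linarith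
    then consider "j + 2 \<le> 2 * n + 1" | "j = 2 * n" | "j = 2 * n + 1" by blast
    then show ?thesis
    proof cases
      case 1
      then show ?thesis by (simp add: Tj(5))
    next
      case 2
      then show ?thesis using Tj(3) by simp
    next
      case 3
      then have "j + 2 = 2 * n + 3" by simp
      then show ?thesis using Tj(4) 3 uv(2) unfolding t_def by metis
    qed
  qed
  have lF: "length (F 1) = f - 1" "\<And>j. 2 \<le> j \<Longrightarrow> j \<le> 2 * n + 1 \<Longrightarrow> length (F j) = f - 2" using F(1) by (auto simp: K_def l_def)
  have distT: "distinct (T j)" "walk E (T j)" "T j \<noteq> []" if "j \<le> 2 * n + 3" for j
  proof -
    consider "j = 0" | "j = 1" | "2 \<le> j" "j \<le> 2 * n + 1" | "j = 2 * n + 2" | "j = 2 * n + 3" using jcases[OF \<open>j \<le> 2 * n + 3\<close>] by blast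
    then have "distinct (T j) \<and> walk E (T j) \<and> T j \<noteq> []"
    proof cases
      case 1
      then show ?thesis using A Ane Tj(1) by (auto simp: walk_Cons_iff)
    next
      case 2
      have "1 \<in> K" by (simp add: K_def)
      moreover have "v 1 \<notin> set (F 1)" using FK[of 1] FFd(3) uq_in(2)[of 0] by auto
      ultimately show ?thesis using 2 Tj(2) F(1) by (auto simp: walk_Cons_iff)
    next
      case 3
      then have jK: "j \<in> K" "src j = u (j - 2)" by (auto simp: K_def src_def)
      have "u (j - 2) \<in> set q" "v j \<in> set q" using 3 uq_in(1)[of "j - 2"] uq_in(2)[of "j - 1"] by auto
      then have "v j \<notin> set (F j)" "u (j - 2) \<notin> set (F j)" using FK[of j] FFd(3) 3 by auto
      moreover have "u (j - 2) \<noteq> v j" using uv_ne[of "j - 2" "j - 1"] 3 by auto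
      ultimately show ?thesis using Tj(5)[OF 3] F(1) jK by auto
    next
      case 4
      moreover have "u (2 * n) \<notin> set D" using uq_in(1)[of "2 * n"] qA by auto
      ultimately show ?thesis using Tj(3) D by auto
    next
      case 5
      then show ?thesis using B Bne Tj(4) by (auto simp: walk_Cons_iff)
    qed
    then show "distinct (T j)" "walk E (T j)" "T j \<noteq> []" by auto
  qed
  have lenT: "length (T j) = f" if j: "1 \<le> j" "j \<le> 2 * \<rho>" for j
  proof -
    have "j = 1 \<or> (2 \<le> j \<and> j \<le> 2 * n + 1) \<or> j = 2 * n + 2" using j n(1) by linarith
    then show ?thesis using lF D(1) n(3) by (auto simp: T_def)
  qed
  have disjT: "disjoint_family_on (\<lambda>j. set (T j)) {..2 * \<rho> + 1}"
    unfolding disjoint_family_on_def rho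
  proof (intro ballI impI)
    fix i j assume ij: "i \<in> {..2 * n + 3}" "j \<in> {..2 * n + 3}" "i \<noteq> j"
    then have ij': "i \<le> 2 * n + 3" "j \<le> 2 * n + 3" by auto
    show "set (T i) \<inter> set (T j) = {}"
      unfolding TPR[OF ij'(1)] TPR[OF ij'(2)] using PP[OF ij(3)] RR[OF ij(3) ij'] Pq[of i] Pq[of j] Rq[OF ij'(1)] Rq[OF ij'(2)] by blast
  qed
  define d where "d = last (T (2 * \<rho>))"
  define e where "e = last (T (2 * \<rho> + 1))"
  have Dne: "D \<noteq> []" using D(1) f1 by auto
  have dD: "d = last D" "d \<in> set D" using n(1) Tj(3) Dne by (auto simp: d_def)
  have eB: "e = last B" "e \<in> set B" using Tj(4) Bne unfolding e_def rho by auto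
  have a1: "\<And>j. j \<le> 2 * \<rho> + 1 \<Longrightarrow> T j \<noteq> [] \<and> walk E (T j) \<and> distinct (T j)" using distT unfolding rho by blast
  have a2: "1 \<le> \<rho>" by (simp add: \<rho>_def)
  have a3: "\<And>j. j + 2 \<le> 2 * \<rho> + 1 \<Longrightarrow> (last (T j), hd (T (j + 2))) \<in> E"
    using lastT hdT uv(4) unfolding rho by simp
  have a4: "(last (T j), hd (T (Suc j))) \<in> E" if j: "1 \<le> j" "Suc j \<le> 2 * \<rho>" for j
  proof -
    have "j - 1 \<le> 2 * n" "Suc (j - 1) = j" "j - 1 + 2 = Suc j" using j n(1) by auto
    then show ?thesis using lastT[of j] hdT[of "j - 1"] uv(5) by (metis le_SucI Suc_eq_plus1 Suc_le_mono)
  qed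
  have a5: "(last (T 0), hd (T (2 * \<rho> + 1))) \<in> E"
    using B(2) Bne Tj(1,4) unfolding rho by (auto simp: walk_Cons_iff v0_def)
  have a6: "(a, hd (T 0)) \<in> E" using A(2) Ane Tj(1) by (auto simp: walk_Cons_iff)
  have a7: "(b, hd (T 1)) \<in> E"
  proof -
    have "1 \<in> K" by (simp add: K_def)
    then have "walk E (src 1 # F 1 @ [v 1])" using F(1) by blast
    then show ?thesis unfolding Tj(2) by (simp add: walk_Cons_iff src_def)
  qed
  have a8: "length (T 0) = \<rho> * f" "length (T (2 * \<rho> + 1)) = \<rho> * f" using A(1) B(1) Tj(1,4) unfolding rho g_def by auto
  have sw1: "\<exists>p q. length p = 2 * \<rho> * f \<and> length q = 2 * \<rho> * f \<and> walk E (a # p) \<and> walk E (b # q)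
      \<and> last (a # p) = d \<and> last (b # q) = e \<and> distinct (p @ q) \<and> set (p @ q) = Q"
    unfolding d_def e_def by (rule switch_segments(1)[of \<rho> T E a b f Q]) (fact a1 disjT a2 a3 a4 a5 a6 a7 a8 lenT Q_def)+
  have sw2: "\<exists>p q. length p = 2 * \<rho> * f \<and> length q = 2 * \<rho> * f \<and> walk E (a # p) \<and> walk E (b # q)
      \<and> last (a # p) = e \<and> last (b # q) = d \<and> distinct (p @ q) \<and> set (p @ q) = Q"
    unfolding d_def e_def by (rule switch_segments(2)[of \<rho> T E a b f Q]) (fact a1 disjT a2 a3 a4 a5 a6 a7 a8 lenT Q_def)+
  have QZ: "Q \<subseteq> Z - S" unfolding Qeq using A(4) B(4) q(3) D(4) FFd(5,6) by (auto simp: S1_def S2_def S3_def)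
  have SQ: "S4 \<union> FF = S \<union> Q" unfolding Qeq S4_def S3_def S2_def S1_def by blast
  have frame5: "c5 p = c4 p" if "fst p \<notin> FF" "fst p \<notin> set q" "p \<noteq> (b, True)" for p
  proof -
    have "src ` K \<subseteq> insert b (set q)"
    proof
      fix x assume "x \<in> src ` K"
      then obtain j where "j \<in> K" "x = src j" by auto
      moreover from this have "j - 2 \<le> 2 * n" by (auto simp: K_def)
      ultimately show "x \<in> insert b (set q)" using uq_in(1)[of "j - 2"] by (simp add: src_def)
    qed
    moreover have "v ` K \<subseteq> set q"
    proof
      fix x assume "x \<in> v ` K"
      then obtain j where "j \<in> K" "x = v j" by auto
      then show "x \<in> set q" using uq_in(2)[of "j - 1"] by (auto simp: K_def)
    qed
    ultimately have "p \<notin> src ` K \<times> {True} \<union> v ` K \<times> {False}" using that(2,3) by auto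
    then show ?thesis using fr5 that(1) unfolding FF_def by blast
  qed
  have u2q: "u (2 * n) \<in> set q" using uq_in(1)[of "2 * n"] by simp
  have c5d: "1 \<le> c5 (d, True)"
  proof -
    have "c5 (d, True) = c4 (d, True)" using dD FFd(4) qA(3) bS(4) by (intro frame5) auto
    then show ?thesis using dD by (simp add: c4_def)
  qed
  have c5e: "1 \<le> c5 (e, True)"
  proof -
    have "c5 (e, True) = c4 (e, True)" using eB FFd(2) qA(2) bS(2) by (intro frame5) auto
    also have "\<dots> = c3 (e, True)" using eB qA(2,5) u2q by (auto simp: c4_def)
    also have "\<dots> = c2 (e, True)" using eB qA(2) v0B by (auto simp: c3_def)
    finally show ?thesis using eB by (simp add: c2_def)
  qed
  have fr: "\<forall>p. fst p \<notin> Q \<longrightarrow> p \<notin> {a, b} \<times> {True} \<longrightarrow> c5 p = c p"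
  proof (intro allI impI)
    fix p assume p: "fst p \<notin> Q" "p \<notin> {a, b} \<times> {True}"
    then have np: "fst p \<notin> FF" "fst p \<notin> set q" "fst p \<notin> set A" "fst p \<notin> set B" "fst p \<notin> set D" unfolding Qeq by auto
    have "p \<noteq> (b, True)" "p \<noteq> (a, True)" using p(2) by auto
    moreover have "p \<noteq> (u (2 * n), True)" "p \<noteq> (v0, True)" "p \<noteq> (t, False)" using np u2q v0A tB by auto
    ultimately show "c5 p = c p" using np frame5[of p] by (simp add: c4_def c3_def c2_def c1_def)
  qed
  have stf: "state (S \<union> Q) c5" using F(4) unfolding FF_def[symmetric] SQ .
  have dQ: "d \<in> Q" "e \<in> Q" "d \<noteq> e" using dD eB qA(5) unfolding Qeq by auto
  show ?thesis
    by (rule exI[of _ d], rule exI[of _ e], rule exI[of _ Q], rule exI[of _ c5], intro conjI) (fact QZ dQ stf c5d c5e fr sw1 sw2)+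
qed

text \<open>The exits \<open>e\<close>, the set \<open>Q\<close> and the demand \<open>c'\<close>
  are chosen before \<sigma>: every setting of the switches uses the same vertices and the same
  exits. This independence is what lets the network be embedded without knowing the
  permutation.\<close>

definition has_layer :: "'a set \<Rightarrow> ('a \<times> bool \<Rightarrow> int) \<Rightarrow> 'i set \<Rightarrow> ('i \<Rightarrow> 'a) \<Rightarrow> nat \<Rightarrow> ('i \<Rightarrow> 'i) \<Rightarrow> bool" where
  "has_layer S c I s L \<mu> \<longleftrightarrow> (\<exists>e Q c'. Q \<subseteq> Z - S \<and> inj_on e I \<and> e ` I \<subseteq> Q \<and> card Q = L * card I \<and> state (S \<union> Q) c'
    \<and> (\<forall>w\<in>I. 1 \<le> c' (e w, True)) \<and> (\<forall>p. fst p \<notin> Q \<longrightarrow> p \<notin> s ` I \<times> {True} \<longrightarrow> c' p = c p)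
    \<and> (\<forall>\<sigma>. bij_betw \<sigma> I I \<longrightarrow> (\<forall>x\<in>I. \<sigma> x = x \<or> \<sigma> x = \<mu> x) \<longrightarrow> linkage E I s e Q L \<sigma>))"

lemma card_linkage:
  assumes "finite I" "linkage E I s e Q L \<sigma>"
  shows "card Q = L * card I"
proof -
  obtain p where p: "\<forall>w\<in>I. length (p w) = L \<and> distinct (p w)" "disjoint_family_on (\<lambda>w. set (p w)) I" "(\<Union>w\<in>I. set (p w)) = Q"
    using assms(2) unfolding linkage_def by blast
  have "card Q = (\<Sum>w\<in>I. card (set (p w)))"
    unfolding p(3)[symmetric] using assms(1) p(2) by (intro card_UN_disjoint) (auto simp: disjoint_family_on_def)
  also have "\<dots> = (\<Sum>w\<in>I. L)" using p(1) by (intro sum.cong) (auto simp: distinct_card)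
  finally show ?thesis by simp
qed

lemma bij_betw_closed_subset:
  assumes "bij_betw \<sigma> I I" "J \<subseteq> I" "finite J" "\<sigma> ` J \<subseteq> J"
  shows "bij_betw \<sigma> J J"
  using assms by (metis bij_betw_def endo_inj_surj inj_on_subset)

text \<open>The part for \<open>J\<close> is built on top of the part for \<open>I\<close>, in a
  state of which only the demand at the starts of \<open>J\<close> is known. Hence its hypothesis
  speaks about all such states.\<close>

lemma has_layer_Un:
  assumes fin: "finite I" "finite J" and IJ: "I \<inter> J = {}" and \<mu>: "\<mu> ` I \<subseteq> I" "\<mu> ` J \<subseteq> J"
    and s: "inj_on s (I \<union> J)" "\<And>w. w \<in> I \<union> J \<Longrightarrow> s w \<notin> Z - S"
    and I: "has_layer S c I s L \<mu>"
    and J: "\<And>Q c'. Q \<subseteq> Z - S \<Longrightarrow> card Q = L * card I \<Longrightarrow> state (S \<union> Q) c' \<Longrightarrow> (\<And>w. w \<in> J \<Longrightarrow> c' (s w, True) = c (s w, True))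
      \<Longrightarrow> has_layer (S \<union> Q) c' J s L \<mu>"
  shows "has_layer S c (I \<union> J) s L \<mu>"
proof -
  obtain e Q c1 where Q: "Q \<subseteq> Z - S" "inj_on e I" "e ` I \<subseteq> Q" "card Q = L * card I" "state (S \<union> Q) c1" "\<forall>w\<in>I. 1 \<le> c1 (e w, True)"
    "\<forall>p. fst p \<notin> Q \<longrightarrow> p \<notin> s ` I \<times> {True} \<longrightarrow> c1 p = c p"
    "\<forall>\<sigma>. bij_betw \<sigma> I I \<longrightarrow> (\<forall>x\<in>I. \<sigma> x = x \<or> \<sigma> x = \<mu> x) \<longrightarrow> linkage E I s e Q L \<sigma>"
    using I unfolding has_layer_def by (elim exE conjE)
  have sJ: "s w \<notin> Q" "s w \<notin> s ` I" if "w \<in> J" for w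
    using that s Q(1) IJ by (auto dest: inj_onD)
  have "has_layer (S \<union> Q) c1 J s L \<mu>" by (rule J) (use Q sJ in auto)
  then obtain e2 R c2 where R: "R \<subseteq> Z - (S \<union> Q)" "inj_on e2 J" "e2 ` J \<subseteq> R" "card R = L * card J" "state (S \<union> Q \<union> R) c2" "\<forall>w\<in>J. 1 \<le> c2 (e2 w, True)"
    "\<forall>p. fst p \<notin> R \<longrightarrow> p \<notin> s ` J \<times> {True} \<longrightarrow> c2 p = c1 p"
    "\<forall>\<sigma>. bij_betw \<sigma> J J \<longrightarrow> (\<forall>x\<in>J. \<sigma> x = x \<or> \<sigma> x = \<mu> x) \<longrightarrow> linkage E J s e2 R L \<sigma>"
    unfolding has_layer_def by (elim exE conjE)
  define e' where "e' w = (if w \<in> I then e w else e2 w)" for w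
  have e'I: "e' w = e w" if "w \<in> I" for w using that by (simp add: e'_def)
  have e'J: "e' w = e2 w" if "w \<in> J" for w using that IJ by (auto simp: e'_def)
  have QR: "Q \<inter> R = {}" using R(1) by auto
  have fQ: "finite Q" "finite R" using Q(1) R(1) finZ by (auto intro: finite_subset)
  have 1: "Q \<union> R \<subseteq> Z - S" using Q(1) R(1) by auto
  have 2: "inj_on e' (I \<union> J)"
  proof -
    have "inj_on e' I" "inj_on e' J" using Q(2) R(2) e'I e'J by (auto simp: inj_on_def)
    moreover have "e' ` I \<subseteq> Q" "e' ` J \<subseteq> R" using Q(3) R(3) e'I e'J by auto
    then have "e' ` (I - J) \<inter> e' ` (J - I) = {}" using QR by blast
    ultimately show ?thesis by (simp add: inj_on_Un)
  qed
  have 3: "e' ` (I \<union> J) \<subseteq> Q \<union> R" using Q(3) R(3) e'I e'J by auto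
  have 4: "card (Q \<union> R) = L * card (I \<union> J)"
    using card_Un_disjoint[OF fQ QR] card_Un_disjoint[OF fin IJ] Q(4) R(4) by (simp add: add_mult_distrib2)
  have 5: "state (S \<union> (Q \<union> R)) c2" using R(5) by (simp add: Un_assoc)
  have 6: "\<forall>w\<in>I \<union> J. 1 \<le> c2 (e' w, True)"
  proof
    fix w assume w: "w \<in> I \<union> J"
    show "1 \<le> c2 (e' w, True)"
    proof (cases "w \<in> I")
      case True
      then have "e w \<in> Q" using Q(3) by auto
      then have "e w \<notin> R" "e w \<notin> s ` J" using QR sJ by auto
      then have "c2 (e w, True) = c1 (e w, True)" using R(7) by auto
      then show ?thesis using True Q(6) e'I by auto
    next
      case False
      then show ?thesis using w R(6) e'J by auto
    qed
  qed
  have 7: "\<forall>p. fst p \<notin> Q \<union> R \<longrightarrow> p \<notin> s ` (I \<union> J) \<times> {True} \<longrightarrow> c2 p = c p"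
  proof (intro allI impI)
    fix p assume p: "fst p \<notin> Q \<union> R" "p \<notin> s ` (I \<union> J) \<times> {True}"
    then have "p \<notin> s ` I \<times> {True}" "p \<notin> s ` J \<times> {True}" by auto
    then have "c2 p = c1 p" "c1 p = c p" using p(1) Q(7) R(7) by blast+
    then show "c2 p = c p" by simp
  qed
  have 8: "\<forall>\<sigma>. bij_betw \<sigma> (I \<union> J) (I \<union> J) \<longrightarrow> (\<forall>x\<in>I \<union> J. \<sigma> x = x \<or> \<sigma> x = \<mu> x) \<longrightarrow> linkage E (I \<union> J) s e' (Q \<union> R) L \<sigma>"
  proof (intro allI impI)
    fix \<sigma> assume \<sigma>: "bij_betw \<sigma> (I \<union> J) (I \<union> J)" "\<forall>x\<in>I \<union> J. \<sigma> x = x \<or> \<sigma> x = \<mu> x"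
    have im: "\<sigma> ` I \<subseteq> I" "\<sigma> ` J \<subseteq> J" 
      using \<sigma>(2) \<mu> by (metis UnI1 UnI2 image_subset_iff)+
    have "bij_betw \<sigma> I I" "bij_betw \<sigma> J J"
      using bij_betw_closed_subset[OF \<sigma>(1)] fin im by auto
    then have l: "linkage E I s e Q L \<sigma>" "linkage E J s e2 R L \<sigma>" using Q(8) R(8) \<sigma>(2) by auto
    have "linkage E I s e' Q L \<sigma>" using l(1) by (rule linkage_cong) (use im e'I in auto)
    moreover have "linkage E J s e' R L \<sigma>" using l(2) by (rule linkage_cong) (use im e'J in auto)
    ultimately show "linkage E (I \<union> J) s e' (Q \<union> R) L \<sigma>" by (rule linkage_Un[OF _ _ IJ QR])
  qed
  show ?thesis unfolding has_layer_def
    by (rule exI[of _ e'], rule exI[of _ "Q \<union> R"], rule exI[of _ c2], intro conjI) (fact 1 2 3 4 5 6 7 8)+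
qed

text \<open>A fixed point of \<mu> gets a plain path with as many vertices as a switch spends on one
  path, so that all wires stay equally long.\<close>

lemma has_layer_single:
  assumes st: "state S c" and V: "s w \<in> V" "s w \<notin> Z - S" "1 \<le> c (s w, True)" and L: "1 \<le> L" and bud: "card S + L + 26 * m < card Z"
  shows "has_layer S c {w} s L \<mu>"
proof -
  have "card S + L + 18 * m < card Z" using bud by linarith
  from extend_directed[OF st V L this] obtain q where q: "length q = L" "walk E (s w # q)" "distinct q" "set q \<subseteq> Z - S"
    "state (S \<union> set q) (\<lambda>p. if fst p \<in> set q then 3 else if p = (s w, True) then c p - 1 else c p)" by (elim exE conjE)
  have ne: "q \<noteq> []" using q(1) L by auto
  have lin: "linkage E {w} s (\<lambda>_. last q) (set q) L \<sigma>" for \<sigma>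
    unfolding linkage_def using q ne by (intro exI[of _ "\<lambda>_. q"]) (auto simp: disjoint_family_on_def)
  show ?thesis unfolding has_layer_def
  proof (rule exI[of _ "\<lambda>_. last q"], rule exI[of _ "set q"],
      rule exI[of _ "\<lambda>p. if fst p \<in> set q then 3 else if p = (s w, True) then c p - 1 else c p"], intro conjI)
    show "card (set q) = L * card {w}" using q by (simp add: distinct_card)
  qed (use q ne lin in auto)
qed

lemma has_layer_pair:
  assumes st: "state S c" and V: "s w \<in> V" "s w' \<in> V" "s w \<noteq> s w'" "s w \<notin> Z - S" "s w' \<notin> Z - S" "1 \<le> c (s w, True)" "1 \<le> c (s w', True)"
    and L: "L = 2 * (h + 2) * (2 * h + 4)" and bud: "card S + 2 * L + 26 * m < card Z" and \<mu>: "\<mu> w = w'" "\<mu> w' = w"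
  shows "has_layer S c {w, w'} s L \<mu>"
proof -
  have ww: "w \<noteq> w'" using V(3) by auto
  from switch_gadget[OF st V bud[unfolded L]] obtain d e Q c' where
    X: "Q \<subseteq> Z - S \<and> d \<in> Q \<and> e \<in> Q \<and> d \<noteq> e \<and> state (S \<union> Q) c' \<and> 1 \<le> c' (d, True) \<and> 1 \<le> c' (e, True)
    \<and> (\<forall>p. fst p \<notin> Q \<longrightarrow> p \<notin> {s w, s w'} \<times> {True} \<longrightarrow> c' p = c p)
    \<and> (\<exists>p q. length p = L \<and> length q = L \<and> walk E (s w # p) \<and> walk E (s w' # q)
      \<and> last (s w # p) = d \<and> last (s w' # q) = e \<and> distinct (p @ q) \<and> set (p @ q) = Q)
    \<and> (\<exists>p q. length p = L \<and> length q = L \<and> walk E (s w # p) \<and> walk E (s w' # q)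
      \<and> last (s w # p) = e \<and> last (s w' # q) = d \<and> distinct (p @ q) \<and> set (p @ q) = Q)"
    unfolding L[symmetric] by (elim exE)
  note Q = X[THEN conjunct1] X[THEN conjunct2, THEN conjunct1] X[THEN conjunct2, THEN conjunct2, THEN conjunct1]
  note X = X[THEN conjunct2, THEN conjunct2, THEN conjunct2]
  note Q = Q X[THEN conjunct1] X[THEN conjunct2, THEN conjunct1] X[THEN conjunct2, THEN conjunct2, THEN conjunct1]
  note X = X[THEN conjunct2, THEN conjunct2, THEN conjunct2]
  note Q = Q X[THEN conjunct1] X[THEN conjunct2, THEN conjunct1]
  note s1 = X[THEN conjunct2, THEN conjunct2, THEN conjunct1] and s2 = X[THEN conjunct2, THEN conjunct2, THEN conjunct2]
  define o' where "o' x = (if x = w then d else e)" for x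
  have lin: "linkage E {w, w'} s o' Q L \<sigma>" if \<sigma>: "bij_betw \<sigma> {w, w'} {w, w'}" for \<sigma>
  proof -
    have "\<sigma> w \<in> {w, w'}" "\<sigma> w' \<in> {w, w'}" "\<sigma> w \<noteq> \<sigma> w'"
      using \<sigma> ww by (auto simp: bij_betw_def inj_on_def)
    then have "\<sigma> w = w \<and> \<sigma> w' = w' \<or> \<sigma> w = w' \<and> \<sigma> w' = w" by auto
    then consider "\<sigma> w = w" "\<sigma> w' = w'" | "\<sigma> w = w'" "\<sigma> w' = w" by blast
    then show ?thesis
    proof cases
      case 1
      obtain p q where pq: "length p = L" "length q = L" "walk E (s w # p)" "walk E (s w' # q)"
        "last (s w # p) = d" "last (s w' # q) = e" "distinct (p @ q)" "set (p @ q) = Q" using s1 by blast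
      show ?thesis by (rule linkage_pair[OF ww pq(1-4) _ _ pq(7,8)]) (use 1 pq ww in \<open>auto simp: o'_def\<close>)
    next
      case 2
      obtain p q where pq: "length p = L" "length q = L" "walk E (s w # p)" "walk E (s w' # q)"
        "last (s w # p) = e" "last (s w' # q) = d" "distinct (p @ q)" "set (p @ q) = Q" using s2 by blast
      show ?thesis by (rule linkage_pair[OF ww pq(1-4) _ _ pq(7,8)]) (use 2 pq ww in \<open>auto simp: o'_def\<close>)
    qed
  qed
  have "card Q = L * card {w, w'}"
    using lin[of id] by (intro card_linkage) auto
  moreover have "inj_on o' {w, w'}" using ww Q(4) by (auto simp: o'_def inj_on_def)
  moreover have "o' ` {w, w'} \<subseteq> Q" using Q by (auto simp: o'_def)
  moreover have "\<forall>x\<in>{w, w'}. 1 \<le> c' (o' x, True)" using Q by (auto simp: o'_def)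
  ultimately show ?thesis unfolding has_layer_def
    using Q(1,5,8) lin by - (rule exI[of _ o'], rule exI[of _ Q], rule exI[of _ c'], simp)
qed

text \<open>The orbits of the involution are treated one at a time, a switch for a 2-cycle and a
  plain path for a fixed point.\<close>

lemma switch_layer:
  assumes "finite I" "\<And>w. w \<in> I \<Longrightarrow> \<mu> w \<in> I \<and> \<mu> (\<mu> w) = w" "state S c" "inj_on s I"
    "\<And>w. w \<in> I \<Longrightarrow> s w \<in> V \<and> s w \<notin> Z - S \<and> 1 \<le> c (s w, True)"
    and L: "L = 2 * (h + 2) * (2 * h + 4)" and "card S + L * card I + 26 * m < card Z"
  shows "has_layer S c I s L \<mu>"
  using assms(1-5,7)
proof (induction "card I" arbitrary: I rule: less_induct)
  case less
  show ?case
  proof (cases "I = {}")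
    case True
    then show ?thesis unfolding has_layer_def
      by - (rule exI, rule exI[of _ "{}"], rule exI[of _ c], use less.prems in \<open>auto simp: linkage_def disjoint_family_on_def\<close>)
  next
    case False
    then obtain w where w: "w \<in> I" by auto
    define J where "J = {w, \<mu> w}"
    define I' where "I' = I - J"
    have mw: "\<mu> w \<in> I" "\<mu> (\<mu> w) = w" using less.prems(2) w by auto
    have J: "J \<subseteq> I" "finite J" "\<mu> ` J \<subseteq> J" using w mw by (auto simp: J_def)
    have I: "I = I' \<union> J" "I' \<inter> J = {}" "finite I'" "I' \<subseteq> I" using J less.prems(1) by (auto simp: I'_def)
    have muI: "\<mu> x \<in> I'" if "x \<in> I'" for x
    proof -
      have "\<mu> x \<notin> J" using that less.prems(2)[of x] mw unfolding I'_def J_def by auto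
      then show ?thesis using that less.prems(2)[of x] by (auto simp: I'_def)
    qed
    have cI: "card I = card I' + card J" using card_Un_disjoint[OF I(3) J(2) I(2)] I(1) by simp
    have cJ: "1 \<le> card J" using J(2) by (simp add: J_def card_insert_if)
    have "card S + L * card I' + 26 * m < card Z" using less.prems(6) cI by (simp add: add_mult_distrib2)
    then have hI: "has_layer S c I' s L \<mu>"
      using cI cJ less.prems muI I by (intro less.hyps) (auto intro: inj_on_subset)
    have "has_layer S c (I' \<union> J) s L \<mu>"
    proof (rule has_layer_Un[OF I(3) J(2) I(2) _ J(3) _ _ hI])
      show "\<mu> ` I' \<subseteq> I'" using muI by auto
      show "inj_on s (I' \<union> J)" using less.prems(4) I(1) by simp
      show "\<And>w. w \<in> I' \<union> J \<Longrightarrow> s w \<notin> Z - S" using less.prems(5) I(1) by auto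
      fix Q c' assume Q: "Q \<subseteq> Z - S" "card Q = L * card I'" "state (S \<union> Q) c'" "\<And>w. w \<in> J \<Longrightarrow> c' (s w, True) = c (s w, True)"
      have cSQ: "card (S \<union> Q) + L * card J + 26 * m < card Z"
        using card_Un_le[of S Q] Q(2) less.prems(6) cI by (simp add: add_mult_distrib2)
      have ws: "s w \<in> V" "s w \<notin> Z - (S \<union> Q)" "1 \<le> c' (s w, True)"
        using less.prems(5)[OF w] Q(4)[of w] by (auto simp: J_def)
      have mws: "s (\<mu> w) \<in> V" "s (\<mu> w) \<notin> Z - (S \<union> Q)" "1 \<le> c' (s (\<mu> w), True)"
        using less.prems(5)[OF mw(1)] Q(4)[of "\<mu> w"] by (auto simp: J_def)
      show "has_layer (S \<union> Q) c' J s L \<mu>"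
      proof (cases "\<mu> w = w")
        case True
        then have Jw: "J = {w}" by (simp add: J_def)
        show ?thesis unfolding Jw by (rule has_layer_single[of "S \<union> Q" c' s w L \<mu>, OF Q(3) ws]) (use L cSQ Jw in auto)
      next
        case False
        then have "s w \<noteq> s (\<mu> w)" using less.prems(4) w mw(1) by (auto dest: inj_onD)
        moreover have "card J = 2" using False by (simp add: J_def)
        then have "card (S \<union> Q) + 2 * L + 26 * m < card Z" using cSQ by simp
        ultimately show ?thesis unfolding J_def
          by (intro has_layer_pair[of "S \<union> Q" c' s w "\<mu> w" L \<mu>, OF Q(3) ws(1) mws(1) _ ws(2) mws(2) ws(3) mws(3) L]) (use mw in auto)
      qed
    qed
    then show ?thesis using I(1) by simp
  qed
qed

text \<open>The exits of one level are the starts of the next. The starts occur in the bound for the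
  exits because of the empty network, whose exits they are. A permutation in
  \<open>realizable\<close> factors into settings of the levels, and the corresponding linkages are
  composed.\<close>

lemma switching_network:
  assumes "finite I" "\<forall>\<mu>\<in>set Ms. \<mu> permutes I \<and> \<mu> \<circ> \<mu> = id" "state S c" "inj_on s I"
    "\<And>w. w \<in> I \<Longrightarrow> s w \<in> V \<and> s w \<notin> Z - S \<and> 1 \<le> c (s w, True)"
    and L: "L = 2 * (h + 2) * (2 * h + 4)" and "card S + length Ms * L * card I + 26 * m < card Z"
  shows "\<exists>e Q c'. Q \<subseteq> Z - S \<and> inj_on e I \<and> e ` I \<subseteq> s ` I \<union> Q \<and> card Q = length Ms * L * card I \<and> state (S \<union> Q) c'
    \<and> (\<forall>w\<in>I. 1 \<le> c' (e w, True)) \<and> (\<forall>p. fst p \<notin> Q \<longrightarrow> p \<notin> s ` I \<times> {True} \<longrightarrow> c' p = c p)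
    \<and> (\<forall>\<pi>\<in>realizable I Ms. linkage E I s e Q (length Ms * L) \<pi>)"
  using assms(2-5,7)
proof (induction Ms arbitrary: S c s)
  case Nil
  then show ?case
    by - (rule exI[of _ s], rule exI[of _ "{}"], rule exI[of _ c], auto simp: linkage_def disjoint_family_on_def intro!: exI[of _ "\<lambda>_. []"])
next
  case (Cons \<mu> Ms)
  have mm: "\<mu> permutes I" "\<mu> \<circ> \<mu> = id" using Cons.prems(1) by (metis list.set_intros(1))+
  have muI: "\<mu> w \<in> I \<and> \<mu> (\<mu> w) = w" if "w \<in> I" for w
    using that mm by (metis comp_apply id_apply permutes_in_image)
  have b1: "card S + L * card I + 26 * m < card Z" using Cons.prems(5) by (simp add: add_mult_distrib)
  have "has_layer S c I s L \<mu>" by (rule switch_layer[OF assms(1) muI Cons.prems(2,3,4) L b1])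
  then obtain e Q c1 where Q: "Q \<subseteq> Z - S" "inj_on e I" "e ` I \<subseteq> Q" "card Q = L * card I" "state (S \<union> Q) c1" "\<forall>w\<in>I. 1 \<le> c1 (e w, True)"
    "\<forall>p. fst p \<notin> Q \<longrightarrow> p \<notin> s ` I \<times> {True} \<longrightarrow> c1 p = c p"
    "\<forall>\<sigma>. bij_betw \<sigma> I I \<longrightarrow> (\<forall>x\<in>I. \<sigma> x = x \<or> \<sigma> x = \<mu> x) \<longrightarrow> linkage E I s e Q L \<sigma>"
    unfolding has_layer_def by (elim exE conjE)
  have eQ: "e w \<in> Q" if "w \<in> I" for w using Q(3) that by auto
  have "\<exists>e' R c'. R \<subseteq> Z - (S \<union> Q) \<and> inj_on e' I \<and> e' ` I \<subseteq> e ` I \<union> R \<and> card R = length Ms * L * card I \<and> state (S \<union> Q \<union> R) c'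
    \<and> (\<forall>w\<in>I. 1 \<le> c' (e' w, True)) \<and> (\<forall>p. fst p \<notin> R \<longrightarrow> p \<notin> e ` I \<times> {True} \<longrightarrow> c' p = c1 p)
    \<and> (\<forall>\<pi>\<in>realizable I Ms. linkage E I e e' R (length Ms * L) \<pi>)"
  proof (rule Cons.IH[OF _ Q(5) Q(2)])
    show "\<forall>\<mu>\<in>set Ms. \<mu> permutes I \<and> \<mu> \<circ> \<mu> = id" using Cons.prems(1) by (metis list.set_intros(2))
    show "\<And>w. w \<in> I \<Longrightarrow> e w \<in> V \<and> e w \<notin> Z - (S \<union> Q) \<and> 1 \<le> c1 (e w, True)" using eQ Q(1,6) ZV by auto
    show "card (S \<union> Q) + length Ms * L * card I + 26 * m < card Z"
      using Cons.prems(5) card_Un_le[of S Q] Q(4) by (simp add: add_mult_distrib)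
  qed
  then obtain e' R c' where R: "R \<subseteq> Z - (S \<union> Q)" "inj_on e' I" "e' ` I \<subseteq> e ` I \<union> R" "card R = length Ms * L * card I" "state (S \<union> Q \<union> R) c'"
    "\<forall>w\<in>I. 1 \<le> c' (e' w, True)" "\<forall>p. fst p \<notin> R \<longrightarrow> p \<notin> e ` I \<times> {True} \<longrightarrow> c' p = c1 p"
    "\<forall>\<pi>\<in>realizable I Ms. linkage E I e e' R (length Ms * L) \<pi>" by (elim exE conjE)
  have QR: "Q \<inter> R = {}" using R(1) by auto
  have fQ: "finite Q" "finite R" using Q(1) R(1) finZ by (auto intro: finite_subset)
  have 1: "Q \<union> R \<subseteq> Z - S" using Q(1) R(1) by auto
  have 2: "e' ` I \<subseteq> s ` I \<union> (Q \<union> R)" using R(3) Q(3) by blast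
  have 3: "card (Q \<union> R) = length (\<mu> # Ms) * L * card I" using card_Un_disjoint[OF fQ QR] Q(4) R(4) by (simp add: add_mult_distrib)
  have 4: "state (S \<union> (Q \<union> R)) c'" using R(5) by (simp add: Un_assoc)
  have 5: "\<forall>p. fst p \<notin> Q \<union> R \<longrightarrow> p \<notin> s ` I \<times> {True} \<longrightarrow> c' p = c p"
  proof (intro allI impI)
    fix p assume p: "fst p \<notin> Q \<union> R" "p \<notin> s ` I \<times> {True}"
    then have "p \<notin> e ` I \<times> {True}" using Q(3) by auto
    then have "c' p = c1 p" "c1 p = c p" using p Q(7) R(7) by blast+
    then show "c' p = c p" by simp
  qed
  have 6: "\<forall>\<pi>\<in>realizable I (\<mu> # Ms). linkage E I s e' (Q \<union> R) (length (\<mu> # Ms) * L) \<pi>"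
  proof
    fix \<pi> assume "\<pi> \<in> realizable I (\<mu> # Ms)"
    then obtain \<tau> \<sigma> where *: "\<pi> = \<tau> \<circ> \<sigma>" "\<sigma> \<in> switchings I \<mu>" "\<tau> \<in> realizable I Ms" by (rule realizable_ConsE)
    have \<sigma>: "bij_betw \<sigma> I I" using *(2) by (auto simp: switchings_def permutes_imp_bij)
    have "linkage E I s e Q L \<sigma>" using Q(8) \<sigma> *(2) by (auto simp: switchings_def)
    moreover have "linkage E I e e' R (length Ms * L) \<tau>" using R(8) *(3) by blast
    ultimately have "linkage E I s e' (Q \<union> R) (L + length Ms * L) (\<tau> \<circ> \<sigma>)" using \<sigma> QR by (rule linkage_comp)
    then show "linkage E I s e' (Q \<union> R) (length (\<mu> # Ms) * L) \<pi>" using *(1) by simp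
  qed
  show ?case by (rule exI[of _ e'], rule exI[of _ "Q \<union> R"], rule exI[of _ c'], intro conjI) (fact 1 R(2) 2 3 4 R(6) 5 6)+
qed

end

section \<open>Covering by matchings between layers\<close>

text \<open>The sets are completed one at a time. Since the other sets occupy at most
  \<open>M\<close> elements each, enough elements outside all \<open>R j\<close> remain; the total
  \<open>t * M\<close> makes the last completion use up everything.\<close>

lemma distribute_into_classes:
  fixes R :: "nat \<Rightarrow> 'a set"
  assumes "finite U" "\<And>j. j < t \<Longrightarrow> R j \<subseteq> U" "\<And>j. j < t \<Longrightarrow> card (R j) \<le> M" "disjoint_family_on R {..<t}" "card U = t * M"
  shows "\<exists>V. (\<forall>j<t. R j \<subseteq> V j \<and> card (V j) = M) \<and> disjoint_family_on V {..<t} \<and> (\<Union>j<t. V j) = U"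
  using assms
proof (induction t arbitrary: U)
  case 0
  then show ?case by (auto simp: disjoint_family_on_def)
next
  case (Suc t)
  let ?R = "\<Union>j<t. R j"
  have fR: "finite (R j)" if "j < Suc t" for j using Suc.prems(1,2) that finite_subset by blast
  have "R j \<inter> R t = {}" if "j < t" for j
    using disjoint_family_onD[OF Suc.prems(4), of j t] that by simp
  then have d: "?R \<inter> R t = {}" by blast
  have "card ?R \<le> (\<Sum>j<t. card (R j))" by (rule card_UN_le) simp
  also have "\<dots> \<le> (\<Sum>j<t. M)" using Suc.prems(3) by (intro sum_mono) auto
  finally have cR: "card ?R \<le> t * M" by simp
  have "card U \<le> card (U - ?R - R t \<union> ?R \<union> R t)"
    using Suc.prems(1) fR by (intro card_mono) auto
  also have "\<dots> \<le> card (U - ?R - R t) + card ?R + card (R t)"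
    by (meson add_mono card_Un_le le_trans order_refl)
  finally have "M - card (R t) \<le> card (U - ?R - R t)" using cR Suc.prems(5) by simp
  then obtain T where T: "T \<subseteq> U - ?R - R t" "card T = M - card (R t)" by (meson obtain_subset_with_card_n)
  have fT: "finite T" using T(1) Suc.prems(1) finite_subset by blast
  have cT: "card (R t \<union> T) = M" using T fT fR[of t] Suc.prems(3)[of t] by (subst card_Un_disjoint) auto
  have sub: "R t \<union> T \<subseteq> U" using T(1) Suc.prems(2)[of t] by auto
  have "\<exists>V. (\<forall>j<t. R j \<subseteq> V j \<and> card (V j) = M) \<and> disjoint_family_on V {..<t} \<and> (\<Union>j<t. V j) = U - (R t \<union> T)"
  proof (rule Suc.IH)
    show "R j \<subseteq> U - (R t \<union> T)" if "j < t" for j using Suc.prems(2)[of j] that T(1) d by auto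
    show "card (U - (R t \<union> T)) = t * M" using cT sub Suc.prems(1,5) finite_subset[OF sub] by (simp add: card_Diff_subset)
    show "disjoint_family_on R {..<t}" using Suc.prems(4) by (auto simp: disjoint_family_on_def)
  qed (use Suc.prems in auto)
  then obtain V where V: "\<forall>j<t. R j \<subseteq> V j \<and> card (V j) = M" "disjoint_family_on V {..<t}" "(\<Union>j<t. V j) = U - (R t \<union> T)" by blast
  let ?V = "V(t := R t \<union> T)"
  have "\<forall>j<Suc t. R j \<subseteq> ?V j \<and> card (?V j) = M" using V(1) cT by (auto simp: less_Suc_eq)
  moreover have "disjoint_family_on ?V {..<Suc t}"
  proof -
    have new: "V j \<inter> (R t \<union> T) = {}" if "j < t" for j using V(3) that by blast
    show ?thesis
      unfolding disjoint_family_on_def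
    proof (intro ballI impI)
      fix i j assume ij: "i \<in> {..<Suc t}" "j \<in> {..<Suc t}" "i \<noteq> j"
      then consider "i < t" "j < t" | "i < t" "j = t" | "i = t" "j < t" by fastforce
      then show "?V i \<inter> ?V j = {}"
        using new[of i] new[of j] disjoint_family_onD[OF V(2), of i j] ij(3) by cases auto
    qed
  qed
  moreover have "(\<Union>j<Suc t. ?V j) = U"
  proof -
    have "(\<Union>j<Suc t. ?V j) = (\<Union>j<t. V j) \<union> (R t \<union> T)" by (auto simp: lessThan_Suc)
    then show ?thesis using V(3) sub by auto
  qed
  ultimately show ?case by blast
qed

context branching_expander
begin

text \<open>Small sets satisfy Hall's condition by expansion into \<open>R'\<close>. For a large
  \<open>X\<close>, the set of vertices of \<open>B\<close> missed by \<open>X\<close> has fewer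
  than \<open>m\<close> elements by \<open>joined\<close>; hence it expands backwards, into
  \<open>A - X\<close>, and so has at most |A| - |X| elements.\<close>

lemma perfect_matching:
  assumes A: "finite A" "A \<subseteq> V" and B: "finite B" "B \<subseteq> V" and AB: "A \<inter> B = {}" "card A = card B" and R: "R \<subseteq> A" "R' \<subseteq> B"
    and ex: "\<And>X. X \<subseteq> V \<Longrightarrow> card X \<le> m \<Longrightarrow> card X \<le> card (E `` X \<inter> R') \<and> card X \<le> card (E\<inverse> `` X \<inter> R)"
  shows "\<exists>f. bij_betw f A B \<and> (\<forall>a\<in>A. (a, f a) \<in> E)"
proof -
  have "card X \<le> card (\<Union>((\<lambda>a. E `` {a} \<inter> B) ` X))" if X: "X \<subseteq> A" for X
  proof -
    have eq: "\<Union>((\<lambda>a. E `` {a} \<inter> B) ` X) = E `` X \<inter> B" by auto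
    have fX: "finite X" using X A(1) finite_subset by blast
    show ?thesis
    proof (cases "card X \<le> m")
      case True
      then have "card X \<le> card (E `` X \<inter> R')" using ex X A by blast
      also have "\<dots> \<le> card (E `` X \<inter> B)" using B(1) R by (intro card_mono) auto
      finally show ?thesis unfolding eq .
    next
      case False
      define Y where "Y = B - E `` X"
      have fY: "finite Y" using B by (simp add: Y_def)
      have "card Y < m"
      proof (rule ccontr)
        assume "\<not> card Y < m"
        then have "\<exists>a\<in>X. \<exists>b\<in>Y. (a, b) \<in> E"
          using False X A B AB by (intro joined) (auto simp: Y_def)
        then show False by (auto simp: Y_def)
      qed
      then have "card Y \<le> card (E\<inverse> `` Y \<inter> R)" using ex[of Y] B by (auto simp: Y_def)
      also have "\<dots> \<le> card (A - X)" using A(1) R by (intro card_mono) (auto simp: Y_def)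
      also have "\<dots> = card A - card X" using X fX by (rule card_Diff_subset[rotated])
      finally have Ycard: "card Y \<le> card A - card X" .
      have "card B = card (E `` X \<inter> B) + card Y"
        unfolding Y_def using B(1) by (subst card_Un_disjoint[symmetric]) (auto intro: arg_cong[of _ _ card])
      then show ?thesis using Ycard AB(2) card_mono[OF A(1) X] unfolding eq by linarith
    qed
  qed
  then obtain f where f: "inj_on f A" "\<forall>a\<in>A. f a \<in> E `` {a} \<inter> B"
    using hall[of A "\<lambda>a. E `` {a} \<inter> B"] A B by auto
  have "f ` A = B" using f B AB(2) by (intro card_subset_eq) (auto simp: card_image)
  then show ?thesis using f by (intro exI[of _ f]) (auto simp: bij_betw_def)
qed

text \<open>Expansion is required only into the subsets \<open>R j\<close>, so the layers may
  contain arbitrary further vertices. The bijection \<open>g\<close> onto the last layer is whatever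
  the matchings produce.\<close>

lemma layers_linkage:
  fixes U :: "nat \<Rightarrow> 'a set" and R :: "nat \<Rightarrow> 'a set"
  assumes U: "\<And>j. j \<le> t \<Longrightarrow> U j \<subseteq> V \<and> card (U j) = M \<and> R j \<subseteq> U j" "disjoint_family_on U {..t}"
    and ex: "\<And>j A. j \<le> t \<Longrightarrow> A \<subseteq> V \<Longrightarrow> card A \<le> m \<Longrightarrow> card A \<le> card (E `` A \<inter> R j) \<and> card A \<le> card (E\<inverse> `` A \<inter> R j)"
    and o: "bij_betw s I (U 0)" and I: "finite I"
  shows "\<exists>g. bij_betw g I (U t) \<and> linkage E I s g (\<Union>j\<in>{1..t}. U j) t id"
  using U ex
proof (induction t)
  case 0
  then show ?case using o
    by (intro exI[of _ s]) (auto simp: linkage_def disjoint_family_on_def intro!: exI[of _ "\<lambda>_. []"])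
next
  case (Suc t)
  have fU: "finite (U j)" if "j \<le> Suc t" for j using Suc.prems(1)[OF that] finV finite_subset by blast
  have "\<exists>g. bij_betw g I (U t) \<and> linkage E I s g (\<Union>j\<in>{1..t}. U j) t id"
    using Suc.prems by (intro Suc.IH) (auto simp: disjoint_family_on_def)
  then obtain g where g: "bij_betw g I (U t)" "linkage E I s g (\<Union>j\<in>{1..t}. U j) t id" by blast
  have dj: "U i \<inter> U j = {}" if "i \<le> Suc t" "j \<le> Suc t" "i \<noteq> j" for i j
    using Suc.prems(2) that by (auto simp: disjoint_family_on_def)
  have "\<exists>f. bij_betw f (U t) (U (Suc t)) \<and> (\<forall>a\<in>U t. (a, f a) \<in> E)"
    using Suc.prems(1)[of t] Suc.prems(1)[of "Suc t"] fU dj Suc.prems(3)[of "Suc t"] Suc.prems(3)[of t]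
    by (intro perfect_matching[where R = "R t" and R' = "R (Suc t)"]) auto
  then obtain f where f: "bij_betw f (U t) (U (Suc t))" "\<forall>a\<in>U t. (a, f a) \<in> E" by blast
  have gf: "bij_betw (f \<circ> g) I (U (Suc t))" using g(1) f(1) by (rule bij_betw_trans)
  have gU: "g w \<in> U t" if "w \<in> I" for w using g(1) that by (auto simp: bij_betw_def)
  have "linkage E I g (f \<circ> g) (U (Suc t)) 1 id"
    unfolding linkage_def
  proof (rule exI[of _ "\<lambda>w. [f (g w)]"], intro conjI)
    show "disjoint_family_on (\<lambda>w. set [f (g w)]) I" using gf by (auto simp: disjoint_family_on_def bij_betw_def inj_on_def)
    show "(\<Union>w\<in>I. set [f (g w)]) = U (Suc t)" using gf by (auto simp: bij_betw_def)
  qed (use gU f(2) in auto)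
  moreover have "U j \<inter> U (Suc t) = {}" if "j \<in> {1..t}" for j using dj[of j "Suc t"] that by simp
  then have "(\<Union>j\<in>{1..t}. U j) \<inter> U (Suc t) = {}" by blast
  ultimately have "linkage E I s (f \<circ> g) ((\<Union>j\<in>{1..t}. U j) \<union> U (Suc t)) (t + 1) (id \<circ> id)"
    using g(2) by (intro linkage_comp) auto
  moreover have "(\<Union>j\<in>{1..t}. U j) \<union> U (Suc t) = (\<Union>j\<in>{1..Suc t}. U j)" by (auto simp: atLeastAtMostSuc_conv)
  ultimately have "linkage E I s (f \<circ> g) (\<Union>j\<in>{1..Suc t}. U j) (Suc t) id" by (simp only: Suc_eq_plus1 comp_id)
  then show ?case using gf by blast
qed

text \<open>The path of \<open>w\<close> passes the network with \<open>2 * d * L\<close> vertices,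
  a connection of \<open>2 * h + 2\<close> vertices to the first layer, one vertex in each of the
  \<open>t + 1\<close> layers, and a connection to \<open>Y w\<close> that takes the remaining
  number of vertices. Only this last connection depends on \<open>l w\<close>, so paths of different
  lengths can share one network.\<close>

lemma cover_by_linkage:
  fixes R :: "nat \<Rightarrow> 'a set" and X Y :: "'i \<Rightarrow> 'a" and l :: "'i \<Rightarrow> nat"
  defines "L \<equiv> 2 * (h + 2) * (2 * h + 4)"
  assumes I: "finite I" and XY: "inj_on X I" "inj_on Y I" "X ` I \<subseteq> V" "Y ` I \<subseteq> V" and W: "W = V - (X ` I \<union> Y ` I)"
    and ZW: "Z \<subseteq> W" and t: "1 \<le> t" and R: "\<And>j. j \<le> t \<Longrightarrow> R j \<subseteq> W - Z \<and> card (R j) \<le> card I" "disjoint_family_on R {..t}"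
    and J: "J \<subseteq> W - Z" "\<And>j. j \<le> t \<Longrightarrow> J \<inter> R j = {}" "2 * card I \<le> card J"
    and ex: "\<And>j A. j \<le> t \<Longrightarrow> A \<subseteq> V \<Longrightarrow> card A \<le> m \<Longrightarrow> card A \<le> card (E `` A \<inter> R j) \<and> card A \<le> card (E\<inverse> `` A \<inter> R j)"
    and d: "card I \<le> 2 ^ d" and l: "\<And>w. w \<in> I \<Longrightarrow> Suc t + 2 * d * L + (2 * h + 2) + (2 * h + 2) \<le> l w" "sum l I = card W"
    and bud: "card W + 26 * m < card Z + Suc t * card I"
  shows "\<exists>p. (\<forall>w\<in>I. length (p w) = l w \<and> walk E (X w # p w @ [Y w]) \<and> distinct (p w))
    \<and> disjoint_family_on (\<lambda>w. set (p w)) I \<and> (\<Union>w\<in>I. set (p w)) = W"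
proof -
  define M where "M = card I"
  define r where "r w = l w - (Suc t + 2 * d * L + (2 * h + 2))" for w
  have lr: "l w = Suc t + 2 * d * L + (2 * h + 2) + r w" "2 * h + 2 \<le> r w" if "w \<in> I" for w
    using l(1)[OF that] by (auto simp: r_def)
  have "sum l I = (\<Sum>w\<in>I. (Suc t + 2 * d * L + (2 * h + 2)) + r w)" using lr(1) by (intro sum.cong) auto
  then have cW: "card W = (Suc t + 2 * d * L + (2 * h + 2)) * M + sum r I" unfolding l(2) sum.distrib sum_constant M_def
    by (simp add: algebra_simps)
  have cZ: "2 * d * L * M + (2 * h + 2) * M + sum r I + 26 * m < card Z"
    using bud cW unfolding M_def[symmetric] by (simp add: add_mult_distrib)
  have fV: "finite W" "W \<subseteq> V" using W finV by auto
  have fJ: "finite J" using J(1) fV finite_subset by blast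
  have fR: "finite (R j)" if "j \<le> t" for j using R(1)[OF that] fV finite_subset by blast
  \<comment> \<open>The connections need their ends in the first and last layer now, so these two
    layers are completed to \<open>M\<close> vertices from \<open>J\<close>. Each takes at most
    \<open>M\<close> vertices, hence the bound \<open>2 * card I\<close> for
    \<open>J\<close>.\<close>
  obtain J0 where J0: "J0 \<subseteq> J" "card J0 = M - card (R 0)"
    using obtain_subset_with_card_n[of "M - card (R 0)" J] J(3) unfolding M_def by (metis diff_le_self le_trans mult_2 le_add1)
  have "card (J - J0) = card J - (M - card (R 0))" using J0 fJ finite_subset by (metis card_Diff_subset)
  then obtain J1 where J1: "J1 \<subseteq> J - J0" "card J1 = M - card (R t)"
  proof -
    assume c: "card (J - J0) = card J - (M - card (R 0))"
      and g: "\<And>J1. J1 \<subseteq> J - J0 \<Longrightarrow> card J1 = M - card (R t) \<Longrightarrow> thesis"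
    have "M - card (R t) \<le> card (J - J0)" using c J(3) unfolding M_def by linarith
    then show thesis using g by (metis obtain_subset_with_card_n)
  qed
  have fJ01: "finite J0" "finite J1" using J0(1) J1(1) fJ finite_subset by blast+
  define R' where "R' j = (if j = 0 then R 0 \<union> J0 else if j = t then R t \<union> J1 else R j)" for j
  have R'W: "R' j \<subseteq> W - Z" "R j \<subseteq> R' j" if "j \<le> t" for j
    using R(1)[OF that] R(1)[of 0] R(1)[of t] J(1) J0(1) J1(1) by (auto simp: R'_def)
  have JR: "J0 \<inter> R j = {}" "J1 \<inter> R j = {}" if "j \<le> t" for j using J(2)[OF that] J0(1) J1(1) by auto
  have R'c: "card (R' j) \<le> M" if "j \<le> t" for j
  proof -
    have "card (R 0 \<union> J0) \<le> M" using card_Un_le[of "R 0" J0] J0(2) R(1)[of 0] unfolding M_def by simp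
    moreover have "card (R t \<union> J1) \<le> M" using card_Un_le[of "R t" J1] J1(2) R(1)[of t] unfolding M_def by simp
    ultimately show ?thesis using R(1)[OF that] unfolding R'_def M_def by simp
  qed
  have R'0: "card (R' 0) = M" using J0(2) R(1)[of 0] JR(1)[of 0] fR[of 0] fJ01 unfolding R'_def M_def by (simp add: card_Un_disjoint Int_commute)
  have R't: "card (R' t) = M" using t J1(2) R(1)[of t] JR(2)[of t] fR[of t] fJ01 unfolding R'_def M_def by (simp add: card_Un_disjoint Int_commute)
  have R'd: "disjoint_family_on R' {..t}"
    unfolding disjoint_family_on_def
  proof (intro ballI impI)
    fix i j assume ij: "i \<in> {..t}" "j \<in> {..t}" "i \<noteq> j"
    have "R i \<inter> R j = {}" using R(2) ij by (auto simp: disjoint_family_on_def)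
    then show "R' i \<inter> R' j = {}" using JR[of i] JR[of j] ij J1(1) t unfolding R'_def by (auto split: if_splits)
  qed
  have fR': "finite (R' j)" if "j \<le> t" for j using R'W[OF that] fV finite_subset by blast
  have "finite (R' 0)" "finite (R' t)" using fR' by auto
  then obtain o' z where oz: "bij_betw o' I (R' 0)" "bij_betw z I (R' t)"
    using I R'0 R't unfolding M_def by (metis finite_same_card_bij)
  have oW: "o' w \<in> W - Z" "z w \<in> W - Z" if "w \<in> I" for w
    using oz that R'W(1)[of 0] R'W(1)[of t] by (auto simp: bij_betw_def)
  obtain Ms where Ms: "length Ms = 2 * d" "\<forall>\<mu>\<in>set Ms. \<mu> permutes I \<and> \<mu> \<circ> \<mu> = id" "\<forall>\<pi>. \<pi> permutes I \<longrightarrow> \<pi> \<in> realizable I Ms"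
    using benes_network[OF I d] by blast
  have XZ: "X w \<in> V" "X w \<notin> Z" "Y w \<in> V" "Y w \<notin> Z" if "w \<in> I" for w using XY W ZW that by auto
  define c0 :: "'a \<times> bool \<Rightarrow> int" where "c0 = (\<lambda>_. 4)"
  have "\<exists>e Q c'. Q \<subseteq> Z - {} \<and> inj_on e I \<and> e ` I \<subseteq> X ` I \<union> Q \<and> card Q = length Ms * L * card I \<and> state ({} \<union> Q) c'
    \<and> (\<forall>w\<in>I. 1 \<le> c' (e w, True)) \<and> (\<forall>p. fst p \<notin> Q \<longrightarrow> p \<notin> X ` I \<times> {True} \<longrightarrow> c' p = c0 p)
    \<and> (\<forall>\<pi>\<in>realizable I Ms. linkage E I X e Q (length Ms * L) \<pi>)"
  proof (rule switching_network[OF I Ms(2) _ XY(1)])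
    show "state {} c0" unfolding c0_def by (rule initial_state)
    show "\<And>w. w \<in> I \<Longrightarrow> X w \<in> V \<and> X w \<notin> Z - {} \<and> 1 \<le> c0 (X w, True)" using XZ by (auto simp: c0_def)
    show "L = 2 * (h + 2) * (2 * h + 4)" by (simp add: L_def)
    show "card {} + length Ms * L * card I + 26 * m < card Z" using cZ Ms(1) unfolding M_def by simp
  qed
  then obtain e Q1 c1 where Q1: "Q1 \<subseteq> Z" "inj_on e I" "e ` I \<subseteq> X ` I \<union> Q1" "card Q1 = 2 * d * L * M" "state Q1 c1"
    "\<forall>w\<in>I. 1 \<le> c1 (e w, True)" "\<forall>p. fst p \<notin> Q1 \<longrightarrow> p \<notin> X ` I \<times> {True} \<longrightarrow> c1 p = 4"
    "\<forall>\<pi>\<in>realizable I Ms. linkage E I X e Q1 (2 * d * L) \<pi>"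
    unfolding M_def c0_def Ms(1) Un_empty_left Diff_empty by (elim exE conjE)
  have eV: "e w \<in> V" "e w \<notin> Z - Q1" if w: "w \<in> I" for w
  proof -
    have "e w \<in> Q1 \<or> (\<exists>w'\<in>I. e w = X w')" using Q1(3) w by blast
    then show "e w \<in> V" "e w \<notin> Z - Q1" using Q1(1) XZ ZV by auto
  qed
  define l2 where "l2 = (\<lambda>w::'i. 2 * h + 2)"
  have "\<exists>F c'. (\<forall>w\<in>I. length (F w) = l2 w \<and> walk E (e w # F w @ [o' w]) \<and> distinct (F w))
    \<and> disjoint_family_on (\<lambda>i. set (F i)) I \<and> (\<Union>i\<in>I. set (F i)) \<subseteq> Z - Q1 \<and> state (Q1 \<union> (\<Union>i\<in>I. set (F i))) c'
    \<and> (\<forall>p. fst p \<notin> (\<Union>i\<in>I. set (F i)) \<longrightarrow> p \<notin> e ` I \<times> {True} \<union> o' ` I \<times> {False} \<longrightarrow> c' p = c1 p)"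
  proof (rule connect_family[OF I Q1(5) Q1(2)])
    show "inj_on o' I" using oz by (simp add: bij_betw_def)
    show "card Q1 + sum l2 I + 26 * m < card Z" using cZ Q1(4) by (simp add: l2_def M_def algebra_simps)
    fix w assume w: "w \<in> I"
    have "c1 (o' w, False) = 4" using Q1(7) oW[OF w] Q1(1) by auto
    then show "e w \<in> V \<and> o' w \<in> V \<and> e w \<notin> Z - Q1 \<and> o' w \<notin> Z - Q1 \<and> 1 \<le> c1 (e w, True) \<and> 1 \<le> c1 (o' w, False) \<and> 2 * h + 2 \<le> l2 w"
      using eV[OF w] oW[OF w] fV(2) Q1(6) w by (auto simp: l2_def)
  qed
  then obtain F c2 where F: "\<forall>w\<in>I. length (F w) = 2 * h + 2 \<and> walk E (e w # F w @ [o' w]) \<and> distinct (F w)"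
    "disjoint_family_on (\<lambda>i. set (F i)) I" "(\<Union>i\<in>I. set (F i)) \<subseteq> Z - Q1" "state (Q1 \<union> (\<Union>i\<in>I. set (F i))) c2"
    "\<forall>p. fst p \<notin> (\<Union>i\<in>I. set (F i)) \<longrightarrow> p \<notin> e ` I \<times> {True} \<union> o' ` I \<times> {False} \<longrightarrow> c2 p = c1 p"
    unfolding l2_def by (elim exE conjE)
  define Q2 where "Q2 = (\<Union>i\<in>I. set (F i))"
  have card_fam: "card (\<Union>i\<in>I. set (G i)) = sum k I"
    if "\<forall>w\<in>I. length (G w) = k w \<and> distinct (G w)" "disjoint_family_on (\<lambda>i. set (G i)) I" for G :: "'i \<Rightarrow> 'a list" and k
  proof -
    have "card (\<Union>i\<in>I. set (G i)) = (\<Sum>i\<in>I. card (set (G i)))"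
      using that(2) I by (intro card_UN_disjoint) (auto simp: disjoint_family_on_def)
    also have "\<dots> = sum k I" using that(1) by (intro sum.cong) (auto simp: distinct_card)
    finally show ?thesis .
  qed
  have cQ2: "card Q2 = (2 * h + 2) * M" unfolding Q2_def using card_fam[of F "\<lambda>_. 2 * h + 2"] F(1,2) by (simp add: M_def)
  have Q2Z: "Q2 \<subseteq> Z - Q1" using F(3) by (simp add: Q2_def)
  have fQ: "finite Q1" "finite Q2" using Q1(1) Q2Z finZ finite_subset by blast+
  have cQ12: "card (Q1 \<union> Q2) = 2 * d * L * M + (2 * h + 2) * M"
    using card_Un_disjoint[OF fQ] Q2Z Q1(4) cQ2 by auto
  have "\<exists>G c'. (\<forall>w\<in>I. length (G w) = r w \<and> walk E (z w # G w @ [Y w]) \<and> distinct (G w))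
    \<and> disjoint_family_on (\<lambda>i. set (G i)) I \<and> (\<Union>i\<in>I. set (G i)) \<subseteq> Z - (Q1 \<union> Q2) \<and> state ((Q1 \<union> Q2) \<union> (\<Union>i\<in>I. set (G i))) c'
    \<and> (\<forall>p. fst p \<notin> (\<Union>i\<in>I. set (G i)) \<longrightarrow> p \<notin> z ` I \<times> {True} \<union> Y ` I \<times> {False} \<longrightarrow> c' p = c2 p)"
  proof (rule connect_family[OF I F(4)[folded Q2_def]])
    show "inj_on z I" using oz by (simp add: bij_betw_def)
    show "card (Q1 \<union> Q2) + sum r I + 26 * m < card Z" using cZ cQ12 by simp
    fix w assume w: "w \<in> I"
    have eI: "e ` I \<subseteq> X ` I \<union> Z" using Q1(1,3) by blast
    have "z w \<notin> X ` I \<union> Z" using oW(2)[OF w] W by auto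
    moreover from this have "z w \<notin> e ` I" using eI by blast
    ultimately have "c2 (z w, True) = c1 (z w, True)" using F(5)[folded Q2_def] Q2Z by auto
    moreover have "c1 (z w, True) = 4" using Q1(1,7) \<open>z w \<notin> X ` I \<union> Z\<close> by auto
    moreover have "Y w \<notin> W" using W w by auto
    then have "Y w \<notin> o' ` I" using oW(1) by auto
    then have "c2 (Y w, False) = c1 (Y w, False)" using F(5)[folded Q2_def] Q2Z XZ(4)[OF w] by auto
    moreover have "c1 (Y w, False) = 4" using Q1(1,7) XZ(4)[OF w] by auto
    ultimately show "z w \<in> V \<and> Y w \<in> V \<and> z w \<notin> Z - (Q1 \<union> Q2) \<and> Y w \<notin> Z - (Q1 \<union> Q2) \<and> 1 \<le> c2 (z w, True) \<and> 1 \<le> c2 (Y w, False) \<and> 2 * h + 2 \<le> r w"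
      using oW(2)[OF w] fV(2) XZ[OF w] lr(2)[OF w] by auto
  qed (rule XY(2))
  then obtain G c3 where G: "\<forall>w\<in>I. length (G w) = r w \<and> walk E (z w # G w @ [Y w]) \<and> distinct (G w)"
    "disjoint_family_on (\<lambda>i. set (G i)) I" "(\<Union>i\<in>I. set (G i)) \<subseteq> Z - (Q1 \<union> Q2)" by (elim exE conjE)
  define Q3 where "Q3 = (\<Union>i\<in>I. set (G i))"
  have Q3Z: "Q3 \<subseteq> Z - (Q1 \<union> Q2)" using G(3) by (simp add: Q3_def)
  have cQ3: "card Q3 = sum r I" unfolding Q3_def using card_fam[of G r] G(1,2) by simp
  define N where "N = Q1 \<union> Q2 \<union> Q3"
  have fQ3: "finite Q3" using Q3Z finZ finite_subset by blast
  have NZ: "N \<subseteq> Z" using Q1(1) Q2Z Q3Z by (auto simp: N_def)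
  have cN: "card N = 2 * d * L * M + (2 * h + 2) * M + sum r I"
    unfolding N_def using card_Un_disjoint[of "Q1 \<union> Q2" Q3] fQ fQ3 Q3Z cQ12 cQ3 by auto
  have "card (W - N) = card W - card N" using NZ ZW fV finite_subset by (metis card_Diff_subset order_trans)
  \<comment> \<open>The prescribed lengths add up to |W|, so the network and the connections leave
    exactly one vertex per index and layer. The layers can thus absorb everything.\<close>
  then have cU: "card (W - N) = Suc t * M" using cW cN by (simp add: add_mult_distrib)
  have "\<exists>U. (\<forall>j<Suc t. R' j \<subseteq> U j \<and> card (U j) = M) \<and> disjoint_family_on U {..<Suc t} \<and> (\<Union>j<Suc t. U j) = W - N"
  proof (rule distribute_into_classes)
    show "finite (W - N)" using fV by simp
    show "R' j \<subseteq> W - N" if "j < Suc t" for j using R'W(1)[of j] that NZ by auto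
    show "disjoint_family_on R' {..<Suc t}" using R'd by (simp add: lessThan_Suc_atMost)
  qed (use R'c cU in auto)
  then obtain U where U: "\<forall>j\<le>t. R' j \<subseteq> U j \<and> card (U j) = M" "disjoint_family_on U {..t}" "(\<Union>j\<le>t. U j) = W - N"
    unfolding less_Suc_eq_le lessThan_Suc_atMost by blast
  have UV: "U j \<subseteq> W - N" "finite (U j)" if "j \<le> t" for j
  proof -
    show "U j \<subseteq> W - N" using U(3) that by blast
    then show "finite (U j)" using fV finite_subset by blast
  qed
  have U0: "U 0 = R' 0" "U t = R' t"
    using U(1) UV(2) R'0 R't card_subset_eq[of "U 0" "R' 0"] card_subset_eq[of "U t" "R' t"] by auto
  have o0: "bij_betw o' I (U 0)" using oz(1) U0 by simp
  have "\<exists>g. bij_betw g I (U t) \<and> linkage E I o' g (\<Union>j\<in>{1..t}. U j) t id"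
  proof (rule layers_linkage[OF _ U(2) _ o0 I])
    show "\<And>j. j \<le> t \<Longrightarrow> U j \<subseteq> V \<and> card (U j) = M \<and> R j \<subseteq> U j" using U(1) UV(1) R'W(2) fV(2) by blast
    show "\<And>j A. j \<le> t \<Longrightarrow> A \<subseteq> V \<Longrightarrow> card A \<le> m \<Longrightarrow> card A \<le> card (E `` A \<inter> R j) \<and> card A \<le> card (E\<inverse> `` A \<inter> R j)" by (rule ex)
  qed
  then obtain g where g: "bij_betw g I (U t)" "linkage E I o' g (\<Union>j\<in>{1..t}. U j) t id" by blast
  \<comment> \<open>The permutation that the matchings happen to produce: they lead from
    \<open>o' w\<close> to \<open>g w\<close>, which is \<open>z (\<pi> w)\<close>.\<close>
  define \<pi> where "\<pi> = inv_into I z \<circ> g"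
  have z: "bij_betw z I (U t)" using oz(2) U0 by simp
  have \<pi>: "bij_betw \<pi> I I" unfolding \<pi>_def using g(1) bij_betw_inv_into[OF z] by (rule bij_betw_trans)
  have z\<pi>: "z (\<pi> w) = g w" if "w \<in> I" for w
    using bij_betw_inv_into_right[OF z, of "g w"] g(1) that by (auto simp: \<pi>_def bij_betw_def)
  \<comment> \<open>The inverse of \<pi>, extended by the identity to be a permutation in the sense
    of \<open>permutes\<close>. Routing it through the network cancels \<pi>, and \<open>w\<close>
    arrives at \<open>z w\<close>.\<close>
  define \<rho> where "\<rho> w = (if w \<in> I then inv_into I \<pi> w else w)" for w
  have \<rho>b: "bij_betw \<rho> I I"
    using bij_betw_inv_into[OF \<pi>] by (rule bij_betw_cong[THEN iffD1, rotated]) (simp add: \<rho>_def)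
  then have \<rho>p: "\<rho> permutes I" by (rule bij_imp_permutes) (simp add: \<rho>_def)
  have \<pi>\<rho>: "\<pi> (\<rho> w) = w" if "w \<in> I" for w using bij_betw_inv_into_right[OF \<pi> that] that by (simp add: \<rho>_def)
  have k1: "linkage E I X e Q1 (2 * d * L) \<rho>" using Q1(8) Ms(3) \<rho>p by blast
  have oN: "o' w \<in> W - N" if "w \<in> I" for w using oW(1)[OF that] NZ by auto
  have k2: "linkage E I e o' (Q2 \<union> U 0) (2 * h + 3) id"
    unfolding linkage_def
  proof (rule exI[of _ "\<lambda>w. F w @ [o' w]"], intro conjI ballI)
    have oQ: "o' w \<notin> set (F w')" if "w \<in> I" "w' \<in> I" for w w' using oN[OF that(1)] that(2) by (auto simp: N_def Q2_def)
    show "disjoint_family_on (\<lambda>w. set (F w @ [o' w])) I"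
      unfolding disjoint_family_on_def
    proof (intro ballI impI)
      fix w w' assume w: "w \<in> I" "w' \<in> I" "w \<noteq> w'"
      then have "o' w \<noteq> o' w'" using o0 by (auto simp: bij_betw_def inj_on_def)
      moreover have "set (F w) \<inter> set (F w') = {}" using F(2) w by (auto simp: disjoint_family_on_def)
      ultimately show "set (F w @ [o' w]) \<inter> set (F w' @ [o' w']) = {}" using oQ w by auto
    qed
    show "(\<Union>w\<in>I. set (F w @ [o' w])) = Q2 \<union> U 0" using o0 by (auto simp: Q2_def bij_betw_def)
    fix w assume w: "w \<in> I"
    show "length (F w @ [o' w]) = 2 * h + 3" "walk E (e w # F w @ [o' w])" "last (e w # F w @ [o' w]) = o' (id w)" "distinct (F w @ [o' w])"
      using F(1) w oQ[OF w w] by auto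
  qed
  have k3: "linkage E I o' z (\<Union>j\<in>{1..t}. U j) t \<pi>" using g(2) by (rule linkage_cong) (simp add: z\<pi>)
  have dis1: "Q1 \<inter> (Q2 \<union> U 0) = {}" using Q2Z UV(1)[of 0] by (auto simp: N_def)
  have dis2: "(Q1 \<union> (Q2 \<union> U 0)) \<inter> (\<Union>j\<in>{1..t}. U j) = {}"
  proof -
    have "U 0 \<inter> U j = {}" if "j \<in> {1..t}" for j using U(2) that by (auto simp: disjoint_family_on_def)
    moreover have "(Q1 \<union> Q2) \<inter> U j = {}" if "j \<in> {1..t}" for j using UV(1)[of j] that by (auto simp: N_def)
    ultimately show ?thesis by blast
  qed
  have "linkage E I X o' (Q1 \<union> (Q2 \<union> U 0)) (2 * d * L + (2 * h + 3)) (id \<circ> \<rho>)"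
    by (rule linkage_comp[OF k1 k2 \<rho>b dis1])
  then have k12: "linkage E I X o' (Q1 \<union> (Q2 \<union> U 0)) (2 * d * L + (2 * h + 3)) \<rho>" by simp
  have "linkage E I X z (Q1 \<union> (Q2 \<union> U 0) \<union> (\<Union>j\<in>{1..t}. U j)) (2 * d * L + (2 * h + 3) + t) (\<pi> \<circ> \<rho>)"
    by (rule linkage_comp[OF k12 k3 \<rho>b dis2])
  then have "linkage E I X z (Q1 \<union> (Q2 \<union> U 0) \<union> (\<Union>j\<in>{1..t}. U j)) (2 * d * L + (2 * h + 3) + t) id"
    by (rule linkage_cong) (simp add: \<pi>\<rho>)
  moreover have "Q1 \<union> (Q2 \<union> U 0) \<union> (\<Union>j\<in>{1..t}. U j) = W - Q3"
  proof -
    have "{..t} = insert 0 {1..t}" by auto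
    then have "U 0 \<union> (\<Union>j\<in>{1..t}. U j) = W - N" using U(3) by simp
    moreover have "W - Q3 = (W - N) \<union> (Q1 \<union> Q2)" using NZ ZW Q3Z by (auto simp: N_def)
    ultimately show ?thesis by blast
  qed
  ultimately obtain p where p: "\<forall>w\<in>I. length (p w) = 2 * d * L + (2 * h + 3) + t \<and> walk E (X w # p w) \<and> last (X w # p w) = z (id w) \<and> distinct (p w)"
    "disjoint_family_on (\<lambda>w. set (p w)) I" "(\<Union>w\<in>I. set (p w)) = W - Q3" unfolding linkage_def by metis
  have sub: "set (p w) \<subseteq> W - Q3" "set (G w) \<subseteq> Q3" if "w \<in> I" for w using p(3) that by (auto simp: Q3_def)
  show ?thesis
  proof (rule exI[of _ "\<lambda>w. p w @ G w"], intro conjI ballI)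
    fix w assume w: "w \<in> I"
    show "length (p w @ G w) = l w" using p(1) G(1) w lr(1)[OF w] by simp
    have "walk E (X w # p w @ (G w @ [Y w]))" by (rule walk_join) (use p(1) G(1) w in \<open>simp_all del: successively.simps last.simps\<close>)
    then show "walk E (X w # (p w @ G w) @ [Y w])" by simp
    show "distinct (p w @ G w)" using p(1) G(1) w sub[OF w] by auto
  next
    show "disjoint_family_on (\<lambda>w. set (p w @ G w)) I"
      unfolding disjoint_family_on_def
    proof (intro ballI impI)
      fix w w' assume w: "w \<in> I" "w' \<in> I" "w \<noteq> w'"
      have "set (p w) \<inter> set (p w') = {}" "set (G w) \<inter> set (G w') = {}" using p(2) G(2) w by (auto simp: disjoint_family_on_def)
      then show "set (p w @ G w) \<inter> set (p w' @ G w') = {}" using sub[OF w(1)] sub[OF w(2)] by auto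
    qed
    have "(\<Union>w\<in>I. set (p w @ G w)) = (\<Union>w\<in>I. set (p w)) \<union> Q3" by (auto simp: Q3_def)
    then show "(\<Union>w\<in>I. set (p w @ G w)) = W" using p(3) Q3Z ZW by auto
  qed
qed

end

section \<open>A random partition\<close>

text \<open>This is the moment generating function of a binomial count, without normalisation. The
  sum runs over all colourings, and independence of the colours of different vertices appears as a
  factorisation over \<open>W\<close>.\<close>

lemma sum_PiE_power_card_fibre:
  fixes z :: real
  assumes "finite W" "B \<subseteq> W" "j < Q"
  shows "(\<Sum>f\<in>W \<rightarrow>\<^sub>E {..<Q}. z ^ card {w\<in>B. f w = j}) = (z + real (Q - 1)) ^ card B * real Q ^ (card W - card B)"
proof -
  let ?g = "\<lambda>w y. if w \<in> B \<and> y = j then z else 1"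
  have 1: "z ^ card {w\<in>B. f w = j} = (\<Prod>w\<in>W. ?g w (f w))" for f
  proof -
    have "(\<Prod>w\<in>W. ?g w (f w)) = (\<Prod>w\<in>{w\<in>W. w \<in> B \<and> f w = j}. z)"
      using assms(1) by (subst prod.inter_filter) auto
    also have "{w\<in>W. w \<in> B \<and> f w = j} = {w\<in>B. f w = j}" using assms(2) by auto
    finally show ?thesis by simp
  qed
  have 2: "(\<Sum>y<Q. ?g w y) = (if w \<in> B then z + real (Q - 1) else real Q)" for w
  proof (cases "w \<in> B")
    case True
    have "(\<Sum>y<Q. ?g w y) = ?g w j + (\<Sum>y\<in>{..<Q} - {j}. ?g w y)" using assms(3) by (intro sum.remove) auto
    also have "(\<Sum>y\<in>{..<Q} - {j}. ?g w y) = (\<Sum>y\<in>{..<Q} - {j}. 1)" by (intro sum.cong) auto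
    finally show ?thesis using True assms(3) by simp
  qed simp
  have "(\<Sum>f\<in>W \<rightarrow>\<^sub>E {..<Q}. z ^ card {w\<in>B. f w = j}) = (\<Sum>f\<in>W \<rightarrow>\<^sub>E {..<Q}. \<Prod>w\<in>W. ?g w (f w))"
    unfolding 1 ..
  also have "\<dots> = (\<Prod>w\<in>W. \<Sum>y<Q. ?g w y)"
    using assms(1) by (subst prod_sum_PiE) auto
  also have "\<dots> = (\<Prod>w\<in>W. if w \<in> B then z + real (Q - 1) else real Q)" unfolding 2 ..
  also have "\<dots> = (\<Prod>w\<in>B. z + real (Q - 1)) * (\<Prod>w\<in>W - B. real Q)"
  proof -
    have "W = B \<union> (W - B)" using assms(2) by auto
    then have "(\<Prod>w\<in>W. if w \<in> B then z + real (Q - 1) else real Q)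
      = (\<Prod>w\<in>B \<union> (W - B). if w \<in> B then z + real (Q - 1) else real Q)" by simp
    also have "\<dots> = (\<Prod>w\<in>B. if w \<in> B then z + real (Q - 1) else real Q) * (\<Prod>w\<in>W - B. if w \<in> B then z + real (Q - 1) else real Q)"
      using assms by (intro prod.union_disjoint) (auto intro: finite_subset)
    finally show ?thesis by simp
  qed
  finally show ?thesis using assms by (simp add: card_Diff_subset finite_subset)
qed

lemma sum_PiE_power_card_fibre_le:
  fixes z :: real
  assumes "finite W" "B \<subseteq> W" "j < Q" "0 \<le> z"
  shows "(\<Sum>f\<in>W \<rightarrow>\<^sub>E {..<Q}. z ^ card {w\<in>B. f w = j}) \<le> real Q ^ card W * exp ((z - 1) * real (card B) / real Q)"
proof -
  have Q: "0 < real Q" using assms(3) by simp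
  have cB: "card B \<le> card W" using assms by (intro card_mono)
  have zQ: "z + real (Q - 1) = real Q * (1 + (z - 1) / real Q)" using assms(3) by (simp add: field_simps of_nat_diff)
  have "real Q * (1 + (z - 1) / real Q) \<le> real Q * exp ((z - 1) / real Q)"
    using Q by (intro mult_left_mono exp_ge_add_one_self) auto
  then have le: "z + real (Q - 1) \<le> real Q * exp ((z - 1) / real Q)" unfolding zQ .
  have "(\<Sum>f\<in>W \<rightarrow>\<^sub>E {..<Q}. z ^ card {w\<in>B. f w = j}) = (z + real (Q - 1)) ^ card B * real Q ^ (card W - card B)"
    by (rule sum_PiE_power_card_fibre[OF assms(1-3)])
  also have "\<dots> \<le> (real Q * exp ((z - 1) / real Q)) ^ card B * real Q ^ (card W - card B)"
    using assms(4) by (intro mult_right_mono power_mono le) auto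
  also have "\<dots> = (real Q ^ card B * real Q ^ (card W - card B)) * exp ((z - 1) / real Q) ^ card B"
    by (simp add: power_mult_distrib)
  also have "real Q ^ card B * real Q ^ (card W - card B) = real Q ^ card W" using cB by (simp flip: power_add)
  also have "exp ((z - 1) / real Q) ^ card B = exp ((z - 1) * real (card B) / real Q)"
    by (simp add: exp_of_nat_mult[symmetric] mult.commute)
  finally show ?thesis .
qed

text \<open>The first moment method with exponential moments, for a uniformly random colouring.\<close>

lemma random_colouring:
  fixes W :: "'a set" and K :: "'k set" and B :: "'k \<Rightarrow> 'a set" and a :: "'k \<Rightarrow> nat"
  assumes W: "finite W" and K: "finite K" "\<And>k. k \<in> K \<Longrightarrow> B k \<subseteq> W" and Q: "0 < Q"
    and small: "real Q * (\<Sum>k\<in>K. 2 ^ a k * exp (- real (card (B k)) / (2 * real Q))) + real Q * exp (real (card W) / real Q) / 2 ^ M < 1"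
  shows "\<exists>f\<in>W \<rightarrow>\<^sub>E {..<Q}. \<forall>j<Q. (\<forall>k\<in>K. a k < card {w\<in>B k. f w = j}) \<and> card {w\<in>W. f w = j} \<le> M"
proof (rule ccontr)
  assume no: "\<not> ?thesis"
  let ?F = "W \<rightarrow>\<^sub>E {..<Q}"
  \<comment> \<open>Two weights that are at least 1 when a class violates its lower or upper bound.
    If every colouring violated some bound, the total weight would be at least the number of
    colourings, as in Markov's inequality.\<close>
  let ?lo = "\<lambda>f j k. 2 ^ a k * (1 / 2 :: real) ^ card {w\<in>B k. f w = j}"
  let ?hi = "\<lambda>f j. (2 :: real) ^ card {w\<in>W. f w = j} / 2 ^ M"
  define g where "g f = (\<Sum>j<Q. (\<Sum>k\<in>K. ?lo f j k) + ?hi f j)" for f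
  have finF: "finite ?F" using W by (intro finite_PiE) auto
  have cF: "real (card ?F) = real Q ^ card W" using W by (simp add: card_PiE)
  have ge1: "1 \<le> g f" if f: "f \<in> ?F" for f
  proof -
    obtain j where j: "j < Q" "(\<exists>k\<in>K. card {w\<in>B k. f w = j} \<le> a k) \<or> M < card {w\<in>W. f w = j}"
      using no f by (meson not_le)
    have nn: "0 \<le> (\<Sum>k\<in>K. ?lo f j k)" "0 \<le> ?hi f j" for j by (auto intro!: sum_nonneg)
    have "1 \<le> (\<Sum>k\<in>K. ?lo f j k) + ?hi f j"
      using j(2)
    proof
      assume "\<exists>k\<in>K. card {w\<in>B k. f w = j} \<le> a k"
      then obtain k where k: "k \<in> K" "card {w\<in>B k. f w = j} \<le> a k" by blast
      have "(2::real) ^ card {w\<in>B k. f w = j} \<le> 2 ^ a k" using k(2) by (intro power_increasing) auto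
      then have "1 \<le> ?lo f j k" by (simp add: power_one_over field_simps)
      also have "\<dots> \<le> (\<Sum>k\<in>K. ?lo f j k)" using K(1) k(1) by (intro member_le_sum) auto
      finally show ?thesis using nn(2)[of j] by linarith
    next
      assume "M < card {w\<in>W. f w = j}"
      then have "(2::real) ^ M \<le> 2 ^ card {w\<in>W. f w = j}" by (intro power_increasing) auto
      then have "1 \<le> ?hi f j" by simp
      then show ?thesis using nn(1)[of j] by linarith
    qed
    also have "\<dots> \<le> g f" unfolding g_def using j(1) nn by (intro member_le_sum[where f = "\<lambda>j. (\<Sum>k\<in>K. ?lo f j k) + ?hi f j"]) auto
    finally show ?thesis .
  qed
  have "real Q ^ card W = (\<Sum>f\<in>?F. 1)" using cF by simp
  also have "\<dots> \<le> (\<Sum>f\<in>?F. g f)" using ge1 by (intro sum_mono) auto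
  also have "\<dots> = (\<Sum>j<Q. (\<Sum>k\<in>K. 2 ^ a k * (\<Sum>f\<in>?F. (1 / 2) ^ card {w\<in>B k. f w = j})) + (\<Sum>f\<in>?F. 2 ^ card {w\<in>W. f w = j}) / 2 ^ M)"
    unfolding g_def
    by (subst sum.swap) (simp add: sum.distrib sum_distrib_left sum_divide_distrib sum.swap[of _ K])
  also have "\<dots> \<le> (\<Sum>j<Q. (\<Sum>k\<in>K. 2 ^ a k * (real Q ^ card W * exp (- real (card (B k)) / (2 * real Q)))) + (real Q ^ card W * exp (real (card W) / real Q)) / 2 ^ M)"
  proof (intro sum_mono add_mono mult_left_mono divide_right_mono)
    fix j k assume "j \<in> {..<Q}" "k \<in> K"
    then show "(\<Sum>f\<in>?F. (1 / 2) ^ card {w\<in>B k. f w = j}) \<le> real Q ^ card W * exp (- real (card (B k)) / (2 * real Q))"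
      using sum_PiE_power_card_fibre_le[OF W K(2), of k j Q "1 / 2"] by (simp add: field_simps)
  next
    fix j assume "j \<in> {..<Q}"
    then show "(\<Sum>f\<in>?F. 2 ^ card {w\<in>W. f w = j}) \<le> real Q ^ card W * exp (real (card W) / real Q)"
      using sum_PiE_power_card_fibre_le[OF W order_refl, of j Q 2] by simp
  qed auto
  also have "\<dots> = real Q ^ card W * (real Q * (\<Sum>k\<in>K. 2 ^ a k * exp (- real (card (B k)) / (2 * real Q))) + real Q * exp (real (card W) / real Q) / 2 ^ M)"
    by (simp add: sum_distrib_left algebra_simps)
  also have "\<dots> < real Q ^ card W * 1" using small Q by (intro mult_strict_left_mono) auto
  finally show False by simp
qed

lemma sum_power_card_Pow:
  fixes b :: real
  assumes "finite V"
  shows "(\<Sum>A\<in>Pow V. b ^ card A) = (1 + b) ^ card V"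
proof -
  have "(\<Prod>v\<in>V. b + 1) = (\<Sum>A\<in>Pow V. (\<Prod>v\<in>A. b) * (\<Prod>v\<in>V - A. 1))"
    using assms by (rule prod_add)
  then show ?thesis by (simp add: add.commute)
qed

text \<open>For one colour and one direction a set \<open>A\<close> contributes at most
  \<open>\<beta> ^ card A\<close> with \<open>\<beta> = 4 * exp (- D / (2 * Q))\<close>; the 4 stems
  from asking for \<open>2 * card A\<close> neighbours. By the binomial theorem the nonempty sets
  add up to less than \<open>(1 + \<beta>) ^ card V\<close> in each direction. The index
  \<open>None\<close> stands for the lower bound on the size of a class.\<close>

lemma expanding_colouring:
  fixes E :: "('a \<times> 'a) set" and D :: real
  assumes V: "finite V" "W \<subseteq> V" and Q: "0 < Q"
    and ex: "\<And>A. A \<subseteq> V \<Longrightarrow> card A \<le> \<mu> \<Longrightarrow> D * real (card A) \<le> real (card (E `` A \<inter> W)) \<and> D * real (card A) \<le> real (card (E\<inverse> `` A \<inter> W))"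
    and small: "2 * real Q * ((1 + 4 * exp (- D / (2 * real Q))) ^ card V - 1) + real Q * (2 ^ a * exp (- real (card W) / (2 * real Q)))
      + real Q * exp (real (card W) / real Q) / 2 ^ M < 1"
  shows "\<exists>f. (\<forall>w\<in>W. f w < Q) \<and> (\<forall>j<Q. (\<forall>A\<subseteq>V. card A \<le> \<mu> \<longrightarrow>
      2 * card A \<le> card (E `` A \<inter> {w\<in>W. f w = j}) \<and> 2 * card A \<le> card (E\<inverse> `` A \<inter> {w\<in>W. f w = j}))
      \<and> a < card {w\<in>W. f w = j} \<and> card {w\<in>W. f w = j} \<le> M)"
proof -
  define \<A> where "\<A> = {A. A \<subseteq> V \<and> A \<noteq> {} \<and> card A \<le> \<mu>}"
  define K where "K = insert None (Some ` (\<A> \<times> (UNIV :: bool set)))"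
  define B where "B k = (case k of None \<Rightarrow> W | Some (A, b) \<Rightarrow> (if b then E `` A else E\<inverse> `` A) \<inter> W)" for k :: "('a set \<times> bool) option"
  define a' where "a' k = (case k of None \<Rightarrow> a | Some (A, b) \<Rightarrow> 2 * card A)" for k :: "('a set \<times> bool) option"
  define \<beta> where "\<beta> = 4 * exp (- D / (2 * real Q))"
  have fA: "finite \<A>" by (rule finite_subset[of _ "Pow V"]) (auto simp: \<A>_def V(1))
  have fW: "finite W" using V finite_subset by blast
  define t :: "('a set \<times> bool) option \<Rightarrow> real" where "t k = 2 ^ a' k * exp (- real (card (B k)) / (2 * real Q))" for k
  have "(\<Sum>k\<in>Some ` (\<A> \<times> UNIV). t k) = (\<Sum>u\<in>\<A> \<times> (UNIV :: bool set). t (Some u))"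
    using sum.reindex[of Some "\<A> \<times> UNIV" t] by (simp add: comp_def)
  also have "\<dots> \<le> (\<Sum>u\<in>\<A> \<times> (UNIV :: bool set). \<beta> ^ card (fst u))"
  proof (rule sum_mono)
    fix u assume u: "u \<in> \<A> \<times> (UNIV :: bool set)"
    obtain A b where Ab: "u = (A, b)" by (cases u)
    have A: "A \<subseteq> V" "card A \<le> \<mu>" using u Ab by (auto simp: \<A>_def)
    have "D * real (card A) \<le> real (card (B (Some u)))" using ex[OF A] by (cases b) (auto simp: B_def Ab)
    then have "- real (card (B (Some u))) / (2 * real Q) \<le> real (card A) * (- D / (2 * real Q))"
      using Q by (simp add: field_simps)
    then have "exp (- real (card (B (Some u))) / (2 * real Q)) \<le> exp (- D / (2 * real Q)) ^ card A"
      by (simp flip: exp_of_nat_mult)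
    then have "t (Some u) \<le> 2 ^ (2 * card A) * exp (- D / (2 * real Q)) ^ card A"
      unfolding t_def a'_def Ab option.case prod.case by (intro mult_mono) auto
    also have "\<dots> = \<beta> ^ card A" by (simp add: \<beta>_def power_mult power_mult_distrib)
    finally show "t (Some u) \<le> \<beta> ^ card (fst u)" by (simp add: Ab)
  qed
  also have "\<dots> = (\<Sum>A\<in>\<A>. \<Sum>b\<in>(UNIV :: bool set). \<beta> ^ card A)"
    by (subst sum.cartesian_product) (simp add: case_prod_unfold)
  also have "\<dots> = 2 * (\<Sum>A\<in>\<A>. \<beta> ^ card A)" by (simp add: sum_distrib_left UNIV_bool)
  also have "(\<Sum>A\<in>\<A>. \<beta> ^ card A) \<le> (\<Sum>A\<in>Pow V - {{}}. \<beta> ^ card A)"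
    using V(1) by (intro sum_mono2) (auto simp: \<A>_def \<beta>_def)
  also have "\<dots> = (1 + \<beta>) ^ card V - 1"
    using sum_power_card_Pow[OF V(1), of \<beta>] V(1) by (simp add: sum_diff1)
  finally have s1: "(\<Sum>k\<in>Some ` (\<A> \<times> UNIV). t k) \<le> 2 * ((1 + \<beta>) ^ card V - 1)" by simp
  have "(\<Sum>k\<in>K. t k) = t None + (\<Sum>k\<in>Some ` (\<A> \<times> UNIV). t k)"
    unfolding K_def using fA by (subst sum.insert) auto
  also have "\<dots> \<le> 2 ^ a * exp (- real (card W) / (2 * real Q)) + 2 * ((1 + \<beta>) ^ card V - 1)"
    using s1 by (simp add: t_def a'_def B_def)
  finally have "real Q * (\<Sum>k\<in>K. t k) \<le> real Q * (2 ^ a * exp (- real (card W) / (2 * real Q)) + 2 * ((1 + \<beta>) ^ card V - 1))"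
    by (intro mult_left_mono) auto
  then have "real Q * (\<Sum>k\<in>K. t k) + real Q * exp (real (card W) / real Q) / 2 ^ M < 1"
    using small unfolding \<beta>_def[symmetric] by (simp add: algebra_simps)
  then have "real Q * (\<Sum>k\<in>K. 2 ^ a' k * exp (- real (card (B k)) / (2 * real Q))) + real Q * exp (real (card W) / real Q) / 2 ^ M < 1"
    unfolding t_def .
  moreover have "finite K" using fA by (simp add: K_def)
  moreover have "B k \<subseteq> W" for k by (auto simp: B_def split: option.splits)
  ultimately obtain f where f: "f \<in> W \<rightarrow>\<^sub>E {..<Q}" "\<forall>j<Q. (\<forall>k\<in>K. a' k < card {w\<in>B k. f w = j}) \<and> card {w\<in>W. f w = j} \<le> M"
    using random_colouring[OF fW, of K B Q a' M] Q by blast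
  have "2 * card A \<le> card (E `` A \<inter> {w\<in>W. f w = j}) \<and> 2 * card A \<le> card (E\<inverse> `` A \<inter> {w\<in>W. f w = j})"
    if "j < Q" "A \<subseteq> V" "card A \<le> \<mu>" for j A
  proof (cases "A = {}")
    case False
    then have "Some (A, b) \<in> K" for b using that by (auto simp: K_def \<A>_def)
    then have "a' (Some (A, b)) < card {w\<in>B (Some (A, b)). f w = j}" for b using f(2) that(1) by blast
    moreover have "{w\<in>B (Some (A, b)). f w = j} = (if b then E `` A else E\<inverse> `` A) \<inter> {w\<in>W. f w = j}" for b
      by (auto simp: B_def)
    moreover have "a' (Some (A, b)) = 2 * card A" for b by (simp add: a'_def)
    ultimately have "2 * card A < card ((if b then E `` A else E\<inverse> `` A) \<inter> {w\<in>W. f w = j})" for b by metis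
    from this[of True] this[of False] show ?thesis by (simp only: if_True if_False less_imp_le)
  qed simp
  moreover have "a < card {w\<in>W. f w = j}" if "j < Q" for j
  proof -
    have "None \<in> K" by (simp add: K_def)
    then have "a' None < card {w\<in>B None. f w = j}" using f(2) that by blast
    then show ?thesis by (simp add: a'_def B_def)
  qed
  moreover have "\<forall>w\<in>W. f w < Q" using f(1) by (auto simp: PiE_def Pi_def)
  ultimately show ?thesis using f(2) by blast
qed

lemma concat_segments:
  assumes s: "1 \<le> s"
    and seg: "\<And>j. j < s \<Longrightarrow> walk E (X j # p j @ [Y j]) \<and> distinct (p j)" and link: "\<And>j. Suc j < s \<Longrightarrow> Y j = X (Suc j)"
    and disj: "disjoint_family_on (\<lambda>j. set (p j)) {..<s}" and X: "inj_on X {..<s}"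
    and Xp: "\<And>i j. i < s \<Longrightarrow> j < s \<Longrightarrow> X i \<notin> set (p j)" and Yp: "\<And>j. j < s \<Longrightarrow> Y (s - 1) \<notin> set (p j) \<and> Y (s - 1) \<noteq> X j"
  defines "P \<equiv> concat (map (\<lambda>j. X j # p j) [0..<s]) @ [Y (s - 1)]"
  shows "walk E P" "distinct P" "hd P = X 0" "last P = Y (s - 1)" "length P = (\<Sum>j<s. Suc (length (p j))) + 1"
    "set P = (\<Union>j<s. set (p j)) \<union> X ` {..<s} \<union> {Y (s - 1)}"
proof -
  let ?T = "\<lambda>j. X j # p j"
  define C where "C = concat (map ?T [0..<s])"
  have P: "P = C @ [Y (s - 1)]" by (simp add: P_def C_def)
  have w: "walk E (?T j)" "(last (?T j), Y j) \<in> E" if "j < s" for j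
    using seg[OF that] successively_append_iff[of "\<lambda>x y. (x, y) \<in> E" "?T j" "[Y j]"] by auto
  have C: "walk E C \<and> C \<noteq> [] \<and> hd C = hd (?T 0) \<and> last C = last (?T (s - 1))"
    unfolding C_def
  proof (rule walk_concat)
    fix j assume "Suc j < s"
    then show "(last (?T j), hd (?T (Suc j))) \<in> E" using w(2)[of j] link[of j] by simp
  qed (use s w in auto)
  show "walk E P" unfolding P using C w(2)[of "s - 1"] s by (simp add: successively_append_iff)
  show "hd P = X 0" "last P = Y (s - 1)" using C by (auto simp: P)
  show "length P = (\<Sum>j<s. Suc (length (p j))) + 1" unfolding P C_def length_append length_concat_family by simp
  have sC: "set C = (\<Union>j<s. set (p j)) \<union> X ` {..<s}" unfolding C_def set_concat_family by auto
  show "set P = (\<Union>j<s. set (p j)) \<union> X ` {..<s} \<union> {Y (s - 1)}" unfolding P set_append sC by auto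
  have "distinct C" unfolding C_def
  proof (rule distinct_concat_family)
    show "distinct (?T j)" if "j < s" for j using seg[OF that] Xp[OF that that] by auto
    show "disjoint_family_on (\<lambda>j. set (?T j)) {..<s}"
      unfolding disjoint_family_on_def
    proof (intro ballI impI)
      fix i j assume ij: "i \<in> {..<s}" "j \<in> {..<s}" "i \<noteq> j"
      then have "X i \<noteq> X j" using X by (auto dest: inj_onD)
      then show "set (?T i) \<inter> set (?T j) = {}"
        using disjoint_family_onD[OF disj ij] Xp[of i j] Xp[of j i] ij by auto
    qed
  qed
  moreover have "Y (s - 1) \<notin> set C" unfolding sC using Yp by auto
  ultimately show "distinct P" unfolding P by simp
qed

lemma walk_imp_vwalk_arcs: "walk E p \<Longrightarrow> set (vwalk_arcs p) \<subseteq> E"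
  by (induction p rule: vwalk_arcs.induct) auto

text \<open>\<open>1001 * ln n ^ 3\<close> bounds the number \<open>K\<close> of
  \<open>covering_paths\<close>. The second and third condition are the failure probabilities in
  \<open>colouring_condition\<close>; 16016 is 16 * 1001, from the exponent
  \<open>l ^ 5 / (16 * K)\<close>. The fourth bounds the vertices per path outside the layers, with
  \<open>3 / 2 * ln n\<close> in place of a binary logarithm; its leading coefficient is 27. The
  last two make the threshold of expansion at least 1 and small compared with
  \<open>n\<close>.\<close>

lemma eventually_numerics:
  "\<forall>\<^sub>F n :: nat in at_top. 10 \<le> ln (real n) \<and>
    32 * (1001 * ln (real n) ^ 3) * (4 * exp (ln (real n) - ln (real n) ^ 2 / 16016)) < 1 / 4 \<and>
    8 * (1001 * ln (real n) ^ 3) * exp (- real n / (64 * (1001 * ln (real n) ^ 3))) < 1 / 4 \<and>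
    2 * (3 / 2 * ln (real n)) * (4 * (3 / 2 * ln (real n) + 2) ^ 2) + 4 * (3 / 2 * ln (real n)) + 7 \<le> 31 * ln (real n) ^ 3 \<and>
    1 \<le> real n / (2 * ln (real n) ^ 5) \<and> 26 * (real n / (2 * ln (real n) ^ 5) + 1) \<le> real n / 100"
proof -
  have 1: "\<forall>\<^sub>F n :: nat in at_top. 10 \<le> ln (real n)" by real_asymp
  have 2: "\<forall>\<^sub>F n :: nat in at_top. 32 * (1001 * ln (real n) ^ 3) * (4 * exp (ln (real n) - ln (real n) ^ 2 / 16016)) < 1 / 4"
    by real_asymp
  have 3: "\<forall>\<^sub>F n :: nat in at_top. 8 * (1001 * ln (real n) ^ 3) * exp (- real n / (64 * (1001 * ln (real n) ^ 3))) < 1 / 4"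
    by real_asymp
  have "\<forall>\<^sub>F n :: nat in at_top. 20 \<le> ln (real n)" by real_asymp
  then have 4: "\<forall>\<^sub>F n :: nat in at_top. 2 * (3 / 2 * ln (real n)) * (4 * (3 / 2 * ln (real n) + 2) ^ 2) + 4 * (3 / 2 * ln (real n)) + 7 \<le> 31 * ln (real n) ^ 3"
  proof eventually_elim
    case (elim n)
    define l where "l = ln (real n)"
    have l: "20 \<le> l" using elim by (simp add: l_def)
    have "20 * l ^ 2 \<le> l * l ^ 2" using l by (intro mult_right_mono) auto
    moreover have "20 * l \<le> l ^ 2" using l unfolding power2_eq_square by (intro mult_right_mono) auto
    moreover have "l * l ^ 2 = l ^ 3" by (simp add: power3_eq_cube power2_eq_square)
    moreover have "2 * (3 / 2 * l) * (4 * (3 / 2 * l + 2) ^ 2) + 4 * (3 / 2 * l) + 7 = 27 * l ^ 3 + 72 * l ^ 2 + 54 * l + 7"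
      by (simp add: power3_eq_cube power2_eq_square algebra_simps)
    ultimately show ?case using l unfolding l_def[symmetric] by linarith
  qed
  have 5: "\<forall>\<^sub>F n :: nat in at_top. 1 \<le> real n / (2 * ln (real n) ^ 5)" by real_asymp
  have 6: "\<forall>\<^sub>F n :: nat in at_top. 26 * (real n / (2 * ln (real n) ^ 5) + 1) \<le> real n / 100" by real_asymp
  show ?thesis using 1 2 3 4 5 6 by eventually_elim blast
qed

lemma power_sub_one_le:
  fixes b :: real
  assumes "0 \<le> b" "real n * b \<le> 1"
  shows "(1 + b) ^ n - 1 \<le> 2 * (real n * b)"
proof -
  have "(1 + b) ^ n \<le> exp b ^ n" using assms(1) by (intro power_mono exp_ge_add_one_self) auto
  also have "\<dots> = exp (real n * b)" by (simp add: exp_of_nat_mult)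
  also have "\<dots> \<le> 1 + real n * b + (real n * b) ^ 2" using assms by (intro exp_bound) auto
  also have "(real n * b) ^ 2 \<le> real n * b" using assms by (simp add: power2_eq_square mult_left_le)
  finally show ?thesis by linarith
qed

text \<open>The quadratic bound for the exponential gives only 19/9 when applied at 2/3. Applied at
  1/12 and raised to the eighth power it suffices.\<close>

lemma exp_two_thirds_le: "exp (2 / 3 :: real) \<le> 2"
proof -
  have "exp (1 / 12 :: real) \<le> 1 + 1 / 12 + (1 / 12) ^ 2" by (rule exp_bound) auto
  also have "\<dots> = 157 / 144" by (simp add: power2_eq_square)
  finally have "exp (1 / 12 :: real) ^ 8 \<le> (157 / 144) ^ 8" by (intro power_mono) auto
  moreover have "exp (1 / 12 :: real) ^ 8 = exp (2 / 3)" by (simp flip: exp_of_nat_mult)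
  moreover have "(157 / 144 :: real) ^ 8 \<le> 2" by (simp add: power_def numeral_eq_Suc)
  ultimately show ?thesis by linarith
qed

text \<open>The mean size of a class is \<open>w / (8 * K)\<close>; \<open>a\<close> is at most a
  quarter of it and \<open>M\<close> at least four times as large, so both deviations are
  exponentially unlikely. In the term for expansion the exponent \<open>l ^ 5 / (16 * K)\<close> is
  of order l^2 and outweighs the \<open>l\<close> that comes from the factor \<open>n\<close>. Each
  of the three terms stays below 1/4.\<close>

lemma colouring_condition:
  fixes l :: real and n K M w a :: nat
  assumes l: "l = ln (real n)" "1 \<le> l" and n: "0 < n"
    and c1: "32 * (1001 * l ^ 3) * (4 * exp (l - l ^ 2 / 16016)) < 1 / 4"
    and c2: "8 * (1001 * l ^ 3) * exp (- real n / (64 * (1001 * l ^ 3))) < 1 / 4"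
    and K: "0 < K" "real K \<le> 1001 * l ^ 3" and M: "real n \<le> 2 * real K * real M"
    and w: "real n / 2 \<le> real w" "w \<le> n" and a: "a = w div (32 * K)"
  defines "Q \<equiv> 8 * K"
  shows "2 * real Q * ((1 + 4 * exp (- (l ^ 5) / (2 * real Q))) ^ n - 1) + real Q * (2 ^ a * exp (- real w / (2 * real Q)))
      + real Q * exp (real w / real Q) / 2 ^ M < 1"
proof -
  have Q: "real Q = 8 * real K" by (simp add: Q_def)
  have K0: "0 < real K" using K by simp
  have l3: "0 < l ^ 3" using l(2) by simp
  define b where "b = 4 * exp (- (l ^ 5) / (2 * real Q))"
  have ex: "(1 :: real) \<le> 32 * (1001 * l ^ 3)"
    using one_le_power[OF l(2), of 3] by linarith
  have "l ^ 2 / 16016 = l ^ 5 / (16 * (1001 * l ^ 3))" using l(2) by (simp add: field_simps power_def numeral_eq_Suc)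
  also have "\<dots> \<le> l ^ 5 / (2 * real Q)" using K K0 l(2) unfolding Q by (intro divide_left_mono) (auto intro!: mult_pos_pos)
  finally have "l ^ 2 / 16016 \<le> l ^ 5 / (2 * real Q)" .
  then have "exp (l - l ^ 5 / (2 * real Q)) \<le> exp (l - l ^ 2 / 16016)" by simp
  moreover have nb: "real n * b = 4 * exp (l - l ^ 5 / (2 * real Q))"
    using n by (simp add: b_def l(1) exp_diff exp_minus field_simps)
  ultimately have nb_le: "real n * b \<le> 4 * exp (l - l ^ 2 / 16016)" by simp
  define e where "e = 4 * exp (l - l ^ 2 / 16016)"
  have "e * 1 \<le> e * (32 * (1001 * l ^ 3))" using ex by (intro mult_left_mono) (auto simp: e_def)
  moreover have "e * (32 * (1001 * l ^ 3)) < 1 / 4" using c1 by (simp only: e_def mult.commute)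
  ultimately have nb1: "real n * b \<le> 1" using nb_le unfolding e_def[symmetric] by linarith
  have b0: "0 \<le> b" by (simp add: b_def)
  have "2 * real Q * ((1 + b) ^ n - 1) \<le> 2 * real Q * (2 * (real n * b))"
    using power_sub_one_le[OF b0 nb1] by (intro mult_left_mono) auto
  also have "\<dots> = 32 * real K * (real n * b)" by (simp add: Q)
  also have "\<dots> \<le> 32 * (1001 * l ^ 3) * (4 * exp (l - l ^ 2 / 16016))"
    by (rule mult_mono) (use K nb_le b0 l3 in auto)
  finally have t1: "2 * real Q * ((1 + b) ^ n - 1) < 1 / 4" using c1 by simp
  have mono: "8 * real K * exp (- real n / (64 * real K)) < 1 / 4"
  proof -
    have "real n / (64 * (1001 * l ^ 3)) \<le> real n / (64 * real K)"
      using K K0 l3 by (intro divide_left_mono) (auto intro!: mult_pos_pos)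
    then have "exp (- real n / (64 * real K)) \<le> exp (- real n / (64 * (1001 * l ^ 3)))" by simp
    then have "8 * real K * exp (- real n / (64 * real K)) \<le> 8 * (1001 * l ^ 3) * exp (- real n / (64 * (1001 * l ^ 3)))"
      using K l3 by (intro mult_mono) auto
    then show ?thesis using c2 by simp
  qed
  have "real (a * (32 * K)) \<le> real w" unfolding a by (intro of_nat_mono) (rule div_times_less_eq_dividend)
  then have aw: "real a \<le> real w / (32 * real K)" using K0 by (simp add: field_simps)
  have "(2::real) ^ a \<le> exp 1 ^ a" using exp_ge_add_one_self[of 1] by (intro power_mono) auto
  then have "(2::real) ^ a \<le> exp (real a)" by (simp flip: exp_of_nat_mult)
  then have "2 ^ a * exp (- real w / (2 * real Q)) \<le> exp (real a) * exp (- real w / (2 * real Q))"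
    by (intro mult_right_mono) auto
  also have "\<dots> = exp (real a - real w / (16 * real K))" by (simp add: Q exp_diff exp_minus field_simps)
  also have "\<dots> \<le> exp (- real n / (64 * real K))"
  proof -
    have "real w / (16 * real K) = 2 * (real w / (32 * real K))" by simp
    moreover have "real n / (64 * real K) \<le> real w / (32 * real K)" using w(1) K0 by (simp add: field_simps)
    ultimately show ?thesis using aw by simp
  qed
  finally have "real Q * (2 ^ a * exp (- real w / (2 * real Q))) \<le> 8 * real K * exp (- real n / (64 * real K))"
    unfolding Q by (intro mult_left_mono) auto
  then have t2: "real Q * (2 ^ a * exp (- real w / (2 * real Q))) < 1 / 4" using mono by simp
  \<comment> \<open>Passing to base e makes the exponents comparable: with
    \<open>x = n / (2 * K)\<close> the mean size is at most \<open>x / 4\<close> and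
    \<open>M\<close> is at least \<open>x\<close>, so the difference is at most x/4 - 2x/3, below
    the required -x/32.\<close>
  have "exp (2 / 3 :: real) ^ M \<le> 2 ^ M" using exp_two_thirds_le by (intro power_mono) auto
  then have M2: "exp (real M * (2 / 3)) \<le> 2 ^ M" by (subst exp_of_nat_mult)
  have "exp (real w / real Q) / 2 ^ M \<le> exp (real w / real Q) / exp (real M * (2 / 3))"
    using M2 by (intro divide_left_mono) auto
  also have "\<dots> = exp (real w / real Q - real M * (2 / 3))" by (simp add: exp_diff)
  also have "\<dots> \<le> exp (- real n / (64 * real K))"
  proof -
    define x where "x = real n / (2 * real K)"
    have "real w / real Q \<le> real n / (8 * real K)" unfolding Q using w(2) K0 by (intro divide_right_mono) auto
    then have "real w / real Q \<le> x / 4" by (simp add: x_def)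
    moreover have "x \<le> real M" using M K0 by (simp add: x_def field_simps)
    moreover have "- real n / (64 * real K) = - (x / 32)" "0 \<le> x" by (simp_all add: x_def)
    ultimately show ?thesis unfolding exp_le_cancel_iff by linarith
  qed
  finally have "real Q * (exp (real w / real Q) / 2 ^ M) \<le> 8 * real K * exp (- real n / (64 * real K))"
    unfolding Q by (intro mult_left_mono) auto
  then have t3: "real Q * exp (real w / real Q) / 2 ^ M < 1 / 4" using mono unfolding times_divide_eq_right by linarith
  show ?thesis using t1 t2 t3 unfolding b_def by linarith
qed

lemma power_two_between:
  assumes "1 \<le> (x :: nat)"
  obtains h where "x \<le> 2 ^ h" "2 ^ h < 2 * x"
proof -
  define h where "h = (LEAST h. x \<le> 2 ^ h)"
  have ex: "x \<le> 2 ^ x" by (simp add: less_imp_le)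
  then have h: "x \<le> 2 ^ h" unfolding h_def by (rule LeastI)
  have "2 ^ h < 2 * x"
  proof (cases h)
    case (Suc h')
    then have "\<not> x \<le> 2 ^ h'" using not_less_Least[of h' "\<lambda>h. x \<le> 2 ^ h"] by (simp add: h_def)
    then show ?thesis using Suc by simp
  qed (use assms in simp)
  then show ?thesis using that h by blast
qed

section \<open>The covering theorem\<close>

lemma card_fibres_ge:
  fixes f :: "'a \<Rightarrow> nat"
  assumes "finite S" "\<And>j. lo \<le> j \<Longrightarrow> j < hi \<Longrightarrow> c \<le> card {w\<in>S. f w = j}"
  shows "(hi - lo) * c \<le> card {w\<in>S. lo \<le> f w \<and> f w < hi}"
proof -
  have "(hi - lo) * c = (\<Sum>j\<in>{lo..<hi}. c)" by simp
  also have "\<dots> \<le> (\<Sum>j\<in>{lo..<hi}. card {w\<in>S. f w = j})" using assms(2) by (intro sum_mono) auto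
  also have "\<dots> = card (\<Union>j\<in>{lo..<hi}. {w\<in>S. f w = j})"
    using assms(1) by (intro card_UN_disjoint[symmetric]) auto
  also have "(\<Union>j\<in>{lo..<hi}. {w\<in>S. f w = j}) = {w\<in>S. lo \<le> f w \<and> f w < hi}" by auto
  finally show ?thesis .
qed

lemma exponent_le_ln:
  assumes "2 ^ d \<le> n" "0 < n"
  shows "real d \<le> 3 / 2 * ln (real n)"
proof -
  have "(2::real) ^ d \<le> real n" using assms(1) by (metis of_nat_le_iff of_nat_numeral of_nat_power)
  then have "ln ((2::real) ^ d) \<le> ln (real n)" using assms(2) by simp
  then have "real d * ln 2 \<le> ln (real n)" by (simp add: ln_realpow)
  moreover have "(2 / 3 :: real) \<le> ln 2"
    using exp_two_thirds_le by (subst ln_ge_iff) auto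
  then have "real d * (2 / 3) \<le> real d * ln 2" by (intro mult_left_mono) auto
  ultimately show ?thesis by linarith
qed

text \<open>A path on \<open>k\<close> vertices that is cut into \<open>s\<close> segments has
  \<open>s + 1\<close> vertices as ends of segments, so \<open>k - 1 - s\<close> vertices lie inside
  segments: \<open>l\<close> in each and a remainder \<open>r\<close>, which the covering gives to
  the last segment. Rounding changes the length of a segment by less than a factor of about 2, hence
  the bounds on \<open>l\<close>.\<close>

lemma segment_lengths:
  fixes k K :: nat
  assumes K: "4 \<le> K" "K \<le> k"
  defines "s \<equiv> k div K"
  defines "l \<equiv> (k - 1 - s) div s" and "r \<equiv> (k - 1 - s) mod s"
  shows "1 \<le> s" "s * K \<le> k" "k \<le> 2 * (s * K)" "K - 2 \<le> l" "l < 2 * K" "s * l + r = k - 1 - s" "r < s" "s + 1 \<le> k"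
proof -
  show s1: "1 \<le> s" unfolding s_def using K by (simp add: div_greater_zero_iff Suc_leI)
  show sK: "s * K \<le> k" unfolding s_def by (rule div_times_less_eq_dividend)
  have "k < K + s * K" unfolding s_def using K by (metis dividend_less_div_times gr0I not_numeral_le_zero)
  moreover have "1 * K \<le> s * K" using s1 by (rule mult_le_mono1)
  ultimately show k2: "k \<le> 2 * (s * K)" by linarith
  show "s * l + r = k - 1 - s" unfolding l_def r_def by simp
  show "r < s" unfolding r_def using s1 by simp
  have "s * 4 \<le> s * K" using K(1) by (rule mult_le_mono2)
  then show "s + 1 \<le> k" using sK s1 by linarith
  have "(K - 2) * s = s * K - 2 * s" by (simp add: algebra_simps diff_mult_distrib2)
  also have "\<dots> \<le> k - 1 - s" using sK s1 by linarith
  finally show "K - 2 \<le> l" unfolding l_def using s1 by (simp add: less_eq_div_iff_mult_less_eq)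
  have "k - 1 - s < 2 * K * s" using k2 s1 K by (simp add: mult.commute mult.left_commute)
  then show "l < 2 * K" unfolding l_def using s1 by (simp add: div_less_iff_less_mult)
qed

lemma covering_paths:
  fixes E :: "('a \<times> 'a) set" and x y :: "nat \<Rightarrow> 'a" and l :: real
  assumes l: "l = ln (real n)"
    and num: "10 \<le> l" "32 * (1001 * l ^ 3) * (4 * exp (l - l ^ 2 / 16016)) < 1 / 4"
      "8 * (1001 * l ^ 3) * exp (- real n / (64 * (1001 * l ^ 3))) < 1 / 4"
      "2 * (3 / 2 * l) * (4 * (3 / 2 * l + 2) ^ 2) + 4 * (3 / 2 * l) + 7 \<le> 31 * l ^ 3"
      "1 \<le> real n / (2 * l ^ 5)" "26 * (real n / (2 * l ^ 5) + 1) \<le> real n / 100"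
    and V: "finite V" "card V = n" and k: "10 ^ 3 * l ^ 3 \<le> real k" and n: "n = N * k"
    and xy: "inj_on x {1..N}" "inj_on y {1..N}" "x ` {1..N} \<subseteq> V" "y ` {1..N} \<subseteq> V" "x ` {1..N} \<inter> y ` {1..N} = {}"
    and W: "W = V - (x ` {1..N} \<union> y ` {1..N})"
    and ex: "\<And>A. A \<subseteq> V \<Longrightarrow> real (card A) \<le> real n / (2 * l ^ 5) \<Longrightarrow>
      l ^ 5 * real (card A) \<le> real (card (E `` A \<inter> W)) \<and> l ^ 5 * real (card A) \<le> real (card (E\<inverse> `` A \<inter> W))"
    and joined: "\<And>A B. A \<subseteq> V \<Longrightarrow> B \<subseteq> V \<Longrightarrow> A \<inter> B = {} \<Longrightarrow> real n / (2 * l ^ 5) \<le> real (card A) \<Longrightarrow>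
      real n / (2 * l ^ 5) \<le> real (card B) \<Longrightarrow> \<exists>a\<in>A. \<exists>b\<in>B. (a, b) \<in> E"
  shows "\<exists>P. (\<forall>i\<in>{1..N}. walk E (P i) \<and> distinct (P i) \<and> length (P i) = k \<and> hd (P i) = x i \<and> last (P i) = y i)
    \<and> disjoint_family_on (\<lambda>i. set (P i)) {1..N} \<and> (\<Union>i\<in>{1..N}. set (P i)) = V"
proof -
  have n0: "0 < n" using l num(1) by (cases n) auto
  then have N1: "1 \<le> N" "0 < k" using n by (auto intro: gr0I)
  have l3: "1000 \<le> l ^ 3" using power_mono[OF num(1), of 3] by simp
  have l5: "0 < l ^ 5" using num(1) by simp
  define K where "K = nat \<lceil>1000 * l ^ 3\<rceil>"
  have K: "1000 * l ^ 3 \<le> real K" "real K \<le> 1001 * l ^ 3" using l3 unfolding K_def by linarith+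
  \<comment> \<open>96 is 3 * 32: the reserve \<open>J0\<close> will contain at least
    \<open>n / 32\<close> vertices and must supply \<open>3 * M\<close>, while \<open>M * K\<close>
    is at most \<open>n\<close>.\<close>
  have K96: "96 \<le> K" using K(1) l3 by linarith
  have "\<lceil>1000 * l ^ 3\<rceil> \<le> int k" 
    unfolding ceiling_le_iff of_int_of_nat_eq using k by (simp only: power3_eq_cube)
  then have Kk: "K \<le> k" unfolding K_def by (simp only: nat_le_iff)
  define s where "s = k div K"
  define L0 where "L0 = (k - 1 - s) div s"
  define r where "r = (k - 1 - s) mod s"
  have seg: "1 \<le> s" "s * K \<le> k" "k \<le> 2 * (s * K)" "K - 2 \<le> L0" "L0 < 2 * K" "s * L0 + r = k - 1 - s" "r < s" "s + 1 \<le> k"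
    using segment_lengths[of K k] K96 Kk unfolding s_def L0_def r_def by auto
  define M where "M = N * s"
  have M1: "1 \<le> M" using N1 seg(1) by (simp add: M_def)
  have MK: "M * K \<le> n" unfolding M_def n mult.assoc using seg(2) by (rule mult_le_mono2)
  have "N * k \<le> N * (2 * (s * K))" using seg(3) by (rule mult_le_mono2)
  then have "n \<le> 2 * K * M" unfolding n M_def by (simp add: mult_ac)
  then have nKM: "real n \<le> 2 * real K * real M" by (metis of_nat_le_iff of_nat_mult of_nat_numeral)
  define \<mu> where "\<mu> = nat \<lfloor>real n / (2 * l ^ 5)\<rfloor>"
  have \<mu>: "real \<mu> \<le> real n / (2 * l ^ 5)" "real n / (2 * l ^ 5) < real (\<mu> + 1)" "1 \<le> \<mu>"
    using num(5) unfolding \<mu>_def by linarith+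
  \<comment> \<open>Expansion is given up to size \<mu>, and arcs between disjoint sets from the
    next integer on. The threshold \<open>m\<close> has to serve both purposes; expansion of sets of
    size \<open>m\<close> itself is recovered from subsets in \<open>exR\<close>.\<close>
  define m where "m = \<mu> + 1"
  have m26: "26 * real m \<le> real n / 100" using num(6) \<mu>(1) unfolding m_def by simp
  have m2: "2 * m \<le> n"
  proof -
    have "2 * real m \<le> 26 * real m" by simp
    also have "\<dots> \<le> real n" using m26 by simp
    finally show ?thesis by (metis of_nat_le_iff of_nat_mult of_nat_numeral)
  qed
  obtain h where h: "m \<le> 2 ^ h" "2 ^ h < 2 * m" using power_two_between[of m] by (auto simp: m_def)
  obtain d where d: "M \<le> 2 ^ d" "2 ^ d < 2 * M" using power_two_between[OF M1] .
  have "2 * M \<le> K * M" using K96 by (intro mult_le_mono1) simp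
  moreover have "K * M \<le> n" using MK by (simp add: mult.commute)
  ultimately have "2 ^ d \<le> n" using d(2) by linarith
  then have dl: "real d \<le> 3 / 2 * l" using exponent_le_ln n0 l by blast
  have hl: "real h \<le> 3 / 2 * l" using exponent_le_ln[of h n] h(2) m2 n0 l by simp
  define L where "L = 2 * (h + 2) * (2 * h + 4)"
  define g where "g = 2 * d * L + (2 * h + 2) + (2 * h + 2)"
  \<comment> \<open>\<open>g\<close> counts the vertices of a segment in the network and in two
    shortest connections. It takes at most one part in 32 of \<open>K\<close>; the coefficient 31 of
    the numerical condition fits because 32 * 31 = 992 is below 1000.\<close>
  have gK: "32 * (g + 3) \<le> K"
  proof -
    have "real L = 4 * (real h + 2) ^ 2" by (simp add: L_def power2_eq_square algebra_simps)
    also have "\<dots> \<le> 4 * (3 / 2 * l + 2) ^ 2" using hl by (intro mult_left_mono power_mono) auto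
    finally have "2 * real d * real L \<le> 2 * (3 / 2 * l) * (4 * (3 / 2 * l + 2) ^ 2)"
      using dl num(1) by (intro mult_mono) auto
    then have "real (g + 3) \<le> 2 * (3 / 2 * l) * (4 * (3 / 2 * l + 2) ^ 2) + 4 * (3 / 2 * l) + 7"
    proof -
      have "real (g + 3) = 2 * real d * real L + 4 * real h + 7" by (simp add: g_def)
      moreover have "4 * real h \<le> 4 * (3 / 2 * l)" using hl by simp
      ultimately show ?thesis using \<open>2 * real d * real L \<le> 2 * (3 / 2 * l) * (4 * (3 / 2 * l + 2) ^ 2)\<close> by linarith
    qed
    then have "real (g + 3) \<le> 31 * l ^ 3" using num(4) by (rule order_trans)
    moreover have "32 * u \<le> 1000 * v" if "u \<le> 31 * v" "1000 \<le> v" for u v :: real using that by linarith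
    ultimately have "32 * real (g + 3) \<le> 1000 * l ^ 3" using l3 by blast
    then show ?thesis using K(1) by linarith
  qed
  \<comment> \<open>What \<open>g\<close> leaves of a segment is one vertex for each of the layers 0
    to \<open>t\<close>. Since \<open>t\<close> is below \<open>2 * K\<close>, that many colours
    suffice for the layers.\<close>
  define t where "t = L0 - g - 1"
  have "K \<le> L0 + 2" using seg(4) by (simp add: le_diff_conv)
  moreover have "g + 4 \<le> 32 * (g + 3)" by simp
  ultimately have gL: "g + 2 \<le> L0" using gK by linarith
  have t: "1 \<le> t" "t < 2 * K" "L0 = Suc t + g" using gL seg(5) by (simp_all add: t_def)
  have fW: "finite W" "W \<subseteq> V" using V W by auto
  define w where "w = card W"
  have cU: "card (x ` {1..N} \<union> y ` {1..N}) = 2 * N"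
    using xy by (subst card_Un_disjoint) (auto simp: card_image)
  have w_eq: "w = n - 2 * N" unfolding w_def W using V xy cU by (subst card_Diff_subset) auto
  have "N * 4 \<le> N * k" using Kk K96 by (intro mult_le_mono2) linarith
  then have N4: "4 * N \<le> n" using n by simp
  then have w: "real n / 2 \<le> real w" "w \<le> n" "n \<le> 2 * w" unfolding w_eq by (auto simp: of_nat_diff)
  define a where "a = w div (32 * K)"
  have ha: "w \<le> (32 * K) * (a + 1)"
    unfolding a_def using K96 by (simp add: less_imp_le dividend_less_times_div add.commute)
  \<comment> \<open>Colours below \<open>2 * K\<close> give the layers, those in \<open>{2 * K..<4 * K}\<close> a reserve for the inner endpoints of
    segments and for padding, the others the set \<open>Z\<close> that hosts the network.\<close>
  have "\<exists>f. (\<forall>w\<in>W. f w < 8 * K) \<and> (\<forall>j<8 * K. (\<forall>A\<subseteq>V. card A \<le> \<mu> \<longrightarrow>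
      2 * card A \<le> card (E `` A \<inter> {w\<in>W. f w = j}) \<and> 2 * card A \<le> card (E\<inverse> `` A \<inter> {w\<in>W. f w = j}))
      \<and> a < card {w\<in>W. f w = j} \<and> card {w\<in>W. f w = j} \<le> M)"
  proof (rule expanding_colouring[OF V(1) fW(2)])
    show "0 < 8 * K" using K96 by simp
    show "2 * real (8 * K) * ((1 + 4 * exp (- (l ^ 5) / (2 * real (8 * K)))) ^ card V - 1)
      + real (8 * K) * (2 ^ a * exp (- real (card W) / (2 * real (8 * K)))) + real (8 * K) * exp (real (card W) / real (8 * K)) / 2 ^ M < 1"
      unfolding V(2) w_def[symmetric]
      by (rule colouring_condition[OF l _ n0 num(2,3) _ K(2) nKM w(1,2) a_def]) (use num(1) K96 in auto)
    fix A assume A: "A \<subseteq> V" "card A \<le> \<mu>"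
    then have "real (card A) \<le> real n / (2 * l ^ 5)" using \<mu>(1) by linarith
    then show "l ^ 5 * real (card A) \<le> real (card (E `` A \<inter> W)) \<and> l ^ 5 * real (card A) \<le> real (card (E\<inverse> `` A \<inter> W))"
      using ex A(1) by blast
  qed
  then obtain f where f0: "\<forall>w\<in>W. f w < 8 * K" "\<forall>j<8 * K. (\<forall>A\<subseteq>V. card A \<le> \<mu> \<longrightarrow>
      2 * card A \<le> card (E `` A \<inter> {w\<in>W. f w = j}) \<and> 2 * card A \<le> card (E\<inverse> `` A \<inter> {w\<in>W. f w = j}))
      \<and> a < card {w\<in>W. f w = j} \<and> card {w\<in>W. f w = j} \<le> M" by blast
  have f2: "2 * card A \<le> card (E `` A \<inter> {w\<in>W. f w = j}) \<and> 2 * card A \<le> card (E\<inverse> `` A \<inter> {w\<in>W. f w = j})"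
    if "j < 8 * K" "A \<subseteq> V" "card A \<le> \<mu>" for j A using f0(2) that by blast
  have f3: "a + 1 \<le> card {w\<in>W. f w = j}" "card {w\<in>W. f w = j} \<le> M" if "j < 8 * K" for j
    using f0(2) that by (simp_all add: Suc_le_eq)
  define R where "R j = {w\<in>W. f w = j}" for j
  \<comment> \<open>A set of size \<open>\<mu> + 1\<close> is reduced to a subset of size \<mu>.
    This is why twofold expansion was requested: \<open>2 * \<mu>\<close> is at least
    \<open>\<mu> + 1\<close>.\<close>
  have exR: "card A \<le> card (E `` A \<inter> R j) \<and> card A \<le> card (E\<inverse> `` A \<inter> R j)" if j: "j < 8 * K" and A: "A \<subseteq> V" "card A \<le> m" for j A
  proof (cases "card A \<le> \<mu>")
    case True
    then show ?thesis using f2[OF j A(1)] unfolding R_def by linarith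
  next
    case False
    then have cA: "card A = \<mu> + 1" using A(2) by (simp add: m_def)
    then obtain A' where A': "A' \<subseteq> A" "card A' = \<mu>" by (metis le_add1 obtain_subset_with_card_n)
    have fR: "finite (R j)" using fW(1) by (simp add: R_def)
    have "2 * \<mu> \<le> card (E `` A' \<inter> R j)" "2 * \<mu> \<le> card (E\<inverse> `` A' \<inter> R j)" using f2[OF j, of A'] A' A(1) unfolding R_def by auto
    moreover have "card (E `` A' \<inter> R j) \<le> card (E `` A \<inter> R j)" "card (E\<inverse> `` A' \<inter> R j) \<le> card (E\<inverse> `` A \<inter> R j)"
      using A'(1) fR by (intro card_mono; blast)+
    ultimately show ?thesis using cA \<mu>(3) by linarith
  qed
  define Z where "Z = {w\<in>W. 4 * K \<le> f w \<and> f w < 8 * K}"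
  define J0 where "J0 = {w\<in>W. 2 * K \<le> f w \<and> f w < 4 * K}"
  have cZ: "4 * K * (a + 1) \<le> card Z"
    unfolding Z_def using card_fibres_ge[OF fW(1), of "4 * K" "8 * K" "a + 1" f] f3(1) by simp
  have cJ0: "2 * K * (a + 1) \<le> card J0"
    unfolding J0_def using card_fibres_ge[OF fW(1), of "2 * K" "4 * K" "a + 1" f] f3(1) by simp
  \<comment> \<open>Every colour of \<open>Z\<close> contributes at least |A| neighbours, and
    \<open>Z\<close> has \<open>4 * K\<close> colours, more than the 16 required by
    \<open>expander\<close>.\<close>
  have exZ: "16 * card A \<le> card (D `` A \<inter> Z)" if D: "D = E \<or> D = E\<inverse>" and A: "A \<subseteq> V" "card A \<le> m" for D A
  proof -
    have "card A \<le> card {w\<in>D `` A \<inter> W. f w = j}" if "j < 8 * K" for j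
    proof -
      have "{w\<in>D `` A \<inter> W. f w = j} = D `` A \<inter> R j" by (auto simp: R_def)
      then show ?thesis using exR[OF that A] D by auto
    qed
    then have c: "(8 * K - 4 * K) * card A \<le> card {w\<in>D `` A \<inter> W. 4 * K \<le> f w \<and> f w < 8 * K}"
      using fW(1) by (intro card_fibres_ge) auto
    have eq: "{w\<in>D `` A \<inter> W. 4 * K \<le> f w \<and> f w < 8 * K} = D `` A \<inter> Z" by (auto simp: Z_def)
    have "16 \<le> 8 * K - 4 * K" using K96 by linarith
    then have "16 * card A \<le> (8 * K - 4 * K) * card A" by (rule mult_le_mono1)
    then show ?thesis using c unfolding eq by (rule le_trans)
  qed
  interpret branching_expander E V Z m h
  proof
    show "finite V" by (rule V(1))
    show "Z \<subseteq> V" using fW(2) by (auto simp: Z_def)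
    show "1 \<le> m" by (simp add: m_def)
    show "16 * card A \<le> card (E `` A \<inter> Z) \<and> 16 * card A \<le> card (E\<inverse> `` A \<inter> Z)" if "A \<subseteq> V" "card A \<le> m" for A
      using exZ that by blast
    show "\<exists>a\<in>A. \<exists>b\<in>B. (a, b) \<in> E" if "A \<subseteq> V" "B \<subseteq> V" "A \<inter> B = {}" "m \<le> card A" "m \<le> card B" for A B
      using that \<mu>(2) unfolding m_def by (intro joined) linarith+
    show "m \<le> 2 ^ h" "2 ^ h \<le> 2 * m" using h by auto
  qed
  define I where "I = {1..N} \<times> {..<s}"
  have I: "finite I" "card I = M" by (auto simp: I_def M_def)
  \<comment> \<open>One \<open>M\<close> covers the inner ends of segments, and the other two
    complete the first and the last layer.\<close>
  have J3: "3 * M \<le> card J0"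
  proof -
    have "96 * M \<le> n" using MK K96 by (metis le_trans mult.commute mult_le_mono1)
    moreover have "n \<le> 2 * (16 * (2 * K * (a + 1)))" using w(3) ha by simp
    ultimately show ?thesis using cJ0 by linarith
  qed
  have "card ({1..N} \<times> {1..<s}) \<le> card J0"
  proof -
    have "N * (s - 1) \<le> M" unfolding M_def by (intro mult_le_mono2) simp
    then show ?thesis using J3 by simp
  qed
  moreover have "finite J0" using fW(1) by (simp add: J0_def)
  ultimately obtain \<xi> where \<xi>: "inj_on \<xi> ({1..N} \<times> {1..<s})" "\<xi> ` ({1..N} \<times> {1..<s}) \<subseteq> J0"
    by (metis finite_SigmaI finite_atLeastAtMost finite_atLeastLessThan inj_on_iff_card_le)
  \<comment> \<open>Segment \<open>(i, j)\<close> leads from \<open>X (i, j)\<close> to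
    \<open>Y (i, j)\<close>. A vertex \<xi> where a path is cut is the end of one segment and the
    start of the next, so the images of \<open>X\<close> and \<open>Y\<close> share the set
    \<open>S\<close>.\<close>
  define X where "X u = (if snd u = 0 then x (fst u) else \<xi> u)" for u
  define Y where "Y u = (if snd u = s - 1 then y (fst u) else \<xi> (fst u, Suc (snd u)))" for u
  define S where "S = \<xi> ` ({1..N} \<times> {1..<s})"
  have S: "S \<subseteq> J0" "card S = N * (s - 1)" using \<xi> by (auto simp: S_def card_image)
  have J0W: "J0 \<subseteq> W" by (auto simp: J0_def)
  have xW: "x i \<notin> W" "y i \<notin> W" "x i \<in> V" "y i \<in> V" if "i \<in> {1..N}" for i using W xy that by auto
  have X1: "X (i, 0) = x i" "\<And>j. 1 \<le> j \<Longrightarrow> X (i, j) = \<xi> (i, j)" for i by (auto simp: X_def)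
  have Y1: "Y (i, s - 1) = y i" "\<And>j. Suc j < s \<Longrightarrow> Y (i, j) = \<xi> (i, Suc j)" for i by (auto simp: Y_def)
  have Y2: "Y (i, s - Suc 0) = y i" for i by (simp add: Y_def)
  have Xim: "X ` I = x ` {1..N} \<union> S"
  proof -
    have "I = (\<lambda>i. (i, 0)) ` {1..N} \<union> {1..N} \<times> {1..<s}"
      using seg(1) by (auto simp: I_def image_iff)
    moreover have "X ` ({1..N} \<times> {1..<s}) = S" unfolding S_def by (intro image_cong) (auto simp: X_def)
    ultimately show ?thesis by (simp add: image_Un image_image X1)
  qed
  have Yim: "Y ` I = y ` {1..N} \<union> S"
  proof -
    have "I = (\<lambda>i. (i, s - 1)) ` {1..N} \<union> {1..N} \<times> {..<s - 1}"
      using seg(1) by (auto simp: I_def image_iff)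
    moreover have "Y ` ({1..N} \<times> {..<s - 1}) = (\<lambda>u. \<xi> (fst u, Suc (snd u))) ` ({1..N} \<times> {..<s - 1})"
      by (intro image_cong) (auto simp: Y_def)
    moreover have "(\<lambda>u. (fst u, Suc (snd u))) ` ({1..N} \<times> {..<s - 1}) = {1..N} \<times> {1..<s}"
    proof
      show "{1..N} \<times> {1..<s} \<subseteq> (\<lambda>u. (fst u, Suc (snd u))) ` ({1..N} \<times> {..<s - 1})"
      proof
        fix u assume "u \<in> {1..N} \<times> {1..<s}"
        then show "u \<in> (\<lambda>u. (fst u, Suc (snd u))) ` ({1..N} \<times> {..<s - 1})"
          by (intro image_eqI[of _ _ "(fst u, snd u - 1)"]) auto
      qed
    qed auto
    then have "(\<lambda>u. \<xi> (fst u, Suc (snd u))) ` ({1..N} \<times> {..<s - 1}) = S" unfolding S_def by (metis image_image)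
    ultimately show ?thesis by (simp add: image_Un image_image Y2)
  qed
  have Xinj: "inj_on X I"
  proof (rule inj_onI)
    fix u v assume uv: "u \<in> I" "v \<in> I" "X u = X v"
    obtain i j i' j' where ij: "u = (i, j)" "v = (i', j')" by (cases u, cases v)
    have in0: "\<xi> p \<in> W" if "p \<in> {1..N} \<times> {1..<s}" for p using \<xi>(2) J0W that by auto
    have b: "i \<in> {1..N}" "i' \<in> {1..N}" "j < s" "j' < s" using uv ij by (auto simp: I_def)
    have in1: "X (e, j) \<in> W" if "e \<in> {1..N}" "j < s" "1 \<le> j" for e j
      using in0[of "(e, j)"] that by (simp add: X1)
    consider "j = 0" "j' = 0" | "j = 0" "1 \<le> j'" | "1 \<le> j" "j' = 0" | "1 \<le> j" "1 \<le> j'" by fastforce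
    then show "u = v"
    proof cases
      case 1
      then have "x i = x i'" using uv(3) by (simp add: ij X1)
      then have "i = i'" using xy(1) b by (auto dest: inj_onD)
      then show ?thesis using 1 by (simp add: ij)
    next
      case 2
      then show ?thesis using uv(3) xW(1)[OF b(1)] in1[OF b(2,4)] by (simp add: ij X1(1))
    next
      case 3
      then show ?thesis using uv(3) xW(1)[OF b(2)] in1[OF b(1,3)] by (simp add: ij X1(1))
    next
      case 4
      then have "\<xi> (i, j) = \<xi> (i', j')" using uv(3) by (simp add: ij X1(2))
      then show ?thesis using \<xi>(1) b 4 by (auto simp: ij dest: inj_onD)
    qed
  qed
  have Yinj: "inj_on Y I"
  proof (rule inj_onI)
    fix u v assume uv: "u \<in> I" "v \<in> I" "Y u = Y v"
    obtain i j i' j' where ij: "u = (i, j)" "v = (i', j')" by (cases u, cases v)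
    have in0: "\<xi> p \<in> W" if "p \<in> {1..N} \<times> {1..<s}" for p using \<xi>(2) J0W that by auto
    have b: "i \<in> {1..N}" "i' \<in> {1..N}" "j < s" "j' < s" using uv ij by (auto simp: I_def)
    consider "j = s - 1" "j' = s - 1" | "j = s - 1" "Suc j' < s" | "Suc j < s" "j' = s - 1" | "Suc j < s" "Suc j' < s" using b by linarith
    then show "u = v"
    proof cases
      case 1
      then have "y i = y i'" using uv(3) by (simp add: ij Y2)
      then have "i = i'" using xy(2) b by (auto dest: inj_onD)
      then show ?thesis using 1 by (simp add: ij)
    next
      case 2
      then have "y i = \<xi> (i', Suc j')" using uv(3) by (simp add: ij Y1(2) Y2)
      then show ?thesis using xW(2)[OF b(1)] in0[of "(i', Suc j')"] b 2 by auto
    next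
      case 3
      then have "y i' = \<xi> (i, Suc j)" using uv(3) by (simp add: ij Y1(2) Y2)
      then show ?thesis using xW(2)[OF b(2)] in0[of "(i, Suc j)"] b 3 by auto
    next
      case 4
      then have "\<xi> (i, Suc j) = \<xi> (i', Suc j')" using uv(3) by (simp add: ij Y1)
      then have "(i, Suc j) = (i', Suc j')" using \<xi>(1) b 4 by (auto dest: inj_onD)
      then show ?thesis by (simp add: ij)
    qed
  qed
  define W' where "W' = W - S"
  have W': "W' = V - (X ` I \<union> Y ` I)" unfolding W'_def W Xim Yim by auto
  define len where "len u = (if snd u = s - 1 then L0 + r else L0)" for u :: "nat \<times> nat"
  have s_len: "(\<Sum>j<s. len (i, j)) = k - 1 - s" for i
  proof -
    obtain s' where s': "s = Suc s'" using seg(1) by (cases s) auto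
    have "(\<Sum>j<s. len (i, j)) = (\<Sum>j<s'. len (i, j)) + len (i, s')" by (simp add: s')
    also have "(\<Sum>j<s'. len (i, j)) = (\<Sum>j<s'. L0)" by (intro sum.cong) (auto simp: len_def s')
    also have "(\<Sum>j<s'. L0) + len (i, s') = s * L0 + r" by (simp add: len_def s')
    finally show ?thesis using seg(6) by simp
  qed
  have suml: "sum len I = N * (k - 1 - s)"
  proof -
    have "sum len I = (\<Sum>i\<in>{1..N}. \<Sum>j<s. len (i, j))" unfolding I_def by (simp add: sum.cartesian_product)
    then show ?thesis using s_len by simp
  qed
  have cW': "card W' = N * (k - 1 - s)"
  proof -
    have "card W' = w - N * (s - 1)" unfolding W'_def w_def using S J0W fW(1) by (metis card_Diff_subset finite_subset order_trans)
    also have "\<dots> = N * k - 2 * N - N * (s - 1)" using w_eq n by simp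
    also have "\<dots> = N * (k - 2 - (s - 1))" by (simp add: diff_mult_distrib2 mult.commute)
    also have "k - 2 - (s - 1) = k - 1 - s" using seg(1) by simp
    finally show ?thesis .
  qed
  have J: "2 * card I \<le> card (J0 - S)"
  proof -
    have "card (J0 - S) = card J0 - N * (s - 1)" using S fW(1) J0W by (metis card_Diff_subset finite_subset)
    moreover have "N * (s - 1) \<le> M" unfolding M_def by (intro mult_le_mono2) simp
    ultimately show ?thesis using J3 I(2) by linarith
  qed
  \<comment> \<open>Outside the layers the segments need at most \<open>M * g + M\<close>, less than
    \<open>n / 32\<close>, vertices and the embedding needs a further \<open>26 * m\<close>, at most
    \<open>n / 100\<close>. \<open>Z\<close> holds half of the colours and at least
    \<open>n / 16\<close> vertices.\<close>
  have bud: "card W' + 26 * m < card Z + Suc t * card I"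
  proof -
    have "N * r \<le> M" unfolding M_def using seg(7) by (intro mult_le_mono2) simp
    have "card W' = N * (s * L0 + r)" using cW' seg(6) by simp
    also have "\<dots> = M * Suc t + M * g + N * r" unfolding M_def t(3) by (simp add: algebra_simps)
    finally have 1: "card W' \<le> Suc t * card I + M * g + M" using \<open>N * r \<le> M\<close> I(2) by (simp add: mult.commute)
    have "M * (32 * (g + 3)) \<le> M * K" using gK by (rule mult_le_mono2)
    then have "32 * (M * g + M) + 64 * M \<le> n" using MK by (simp add: algebra_simps)
    then have 2: "32 * (M * g + M) < n" using M1 by linarith
    have 3: "n \<le> 16 * card Z" using w(3) ha cZ by simp
    have "2600 * m \<le> n" using m26 by linarith
    have "c + 26 * m' < z + u" if "c \<le> u + q" "32 * q < n'" "n' \<le> 16 * z" "2600 * m' \<le> n'" for c m' z u q n' :: nat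
      using that by linarith
    from this[of "card W'" "Suc t * card I" "M * g + M" n "card Z" m] show ?thesis
      using 1 2 3 \<open>2600 * m \<le> n\<close> by simp
  qed
  have yX: "y e \<noteq> X u" "X u \<noteq> y e" if "e \<in> {1..N}" "u \<in> I" for e u
  proof -
    have "y ` {1..N} \<inter> X ` I = {}" unfolding Xim using xy(5) xW(2) S(1) J0W by blast
    then show "y e \<noteq> X u" "X u \<noteq> y e" using that by (metis disjoint_iff imageI)+
  qed
  have "\<exists>p. (\<forall>u\<in>I. length (p u) = len u \<and> walk E (X u # p u @ [Y u]) \<and> distinct (p u))
    \<and> disjoint_family_on (\<lambda>u. set (p u)) I \<and> (\<Union>u\<in>I. set (p u)) = W'"
  proof (rule cover_by_linkage[where R = R and J = "J0 - S" and t = t and d = d])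
    show "finite I" "inj_on X I" "inj_on Y I" by fact+
    show "X ` I \<subseteq> V" "Y ` I \<subseteq> V" unfolding Xim Yim using xy S J0W fW by auto
    show "W' = V - (X ` I \<union> Y ` I)" by (rule W')
    show "Z \<subseteq> W'" using S(1) by (auto simp: Z_def W'_def J0_def)
    show "1 \<le> t" by (rule t(1))
    show "R j \<subseteq> W' - Z \<and> card (R j) \<le> card I" if "j \<le> t" for j
    proof
      have "j < 2 * K" using that t(2) by simp
      then show "R j \<subseteq> W' - Z" using S(1) by (auto simp: R_def Z_def W'_def J0_def)
      show "card (R j) \<le> card I" using f3(2)[of j] \<open>j < 2 * K\<close> I(2) by (simp add: R_def)
    qed
    show "disjoint_family_on R {..t}" by (auto simp: disjoint_family_on_def R_def)
    show "J0 - S \<subseteq> W' - Z" by (auto simp: J0_def W'_def Z_def)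
    show "(J0 - S) \<inter> R j = {}" if "j \<le> t" for j using that t(2) by (auto simp: J0_def R_def)
    show "2 * card I \<le> card (J0 - S)" by (rule J)
    show "card A \<le> card (E `` A \<inter> R j) \<and> card A \<le> card (E\<inverse> `` A \<inter> R j)" if "j \<le> t" "A \<subseteq> V" "card A \<le> m" for j A
      using that t(2) by (intro exR) auto
    show "card I \<le> 2 ^ d" using d(1) I(2) by simp
    show "Suc t + 2 * d * (2 * (h + 2) * (2 * h + 4)) + (2 * h + 2) + (2 * h + 2) \<le> len u" for u
      using t(3) unfolding len_def g_def L_def by simp
    show "sum len I = card W'" using suml cW' by simp
    show "card W' + 26 * m < card Z + Suc t * card I" by (rule bud)
  qed
  then obtain p where p: "\<And>u. u \<in> I \<Longrightarrow> length (p u) = len u \<and> walk E (X u # p u @ [Y u]) \<and> distinct (p u)"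
    "disjoint_family_on (\<lambda>u. set (p u)) I" "(\<Union>u\<in>I. set (p u)) = W'" by blast
  have pW: "set (p u) \<subseteq> W'" if "u \<in> I" for u using p(3) that by auto
  have XW: "X u \<notin> W'" "Y u \<notin> W'" if "u \<in> I" for u using W' that by auto
  define P where "P i = concat (map (\<lambda>j. X (i, j) # p (i, j)) [0..<s]) @ [Y (i, s - 1)]" for i
  have II: "(i, j) \<in> I" if "i \<in> {1..N}" "j < s" for i j using that by (auto simp: I_def)
  have P: "walk E (P i) \<and> distinct (P i) \<and> hd (P i) = X (i, 0) \<and> last (P i) = Y (i, s - 1) \<and> length (P i) = (\<Sum>j<s. Suc (length (p (i, j)))) + 1
    \<and> set (P i) = (\<Union>j<s. set (p (i, j))) \<union> (\<lambda>j. X (i, j)) ` {..<s} \<union> {Y (i, s - 1)}" if i: "i \<in> {1..N}" for i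
  proof -
    note cs = concat_segments[of s E "\<lambda>j. X (i, j)" "\<lambda>j. p (i, j)" "\<lambda>j. Y (i, j)", folded P_def]
    have 1: "\<And>j. j < s \<Longrightarrow> walk E (X (i, j) # p (i, j) @ [Y (i, j)]) \<and> distinct (p (i, j))" using p(1) II[OF i] by blast
    have 2: "\<And>j. Suc j < s \<Longrightarrow> Y (i, j) = X (i, Suc j)" by (simp add: X1 Y1)
    have 3: "disjoint_family_on (\<lambda>j. set (p (i, j))) {..<s}"
      unfolding disjoint_family_on_def using II[OF i] disjoint_family_onD[OF p(2)] by auto
    have 4: "inj_on (\<lambda>j. X (i, j)) {..<s}" using Xinj II[OF i] by (auto simp: inj_on_def)
    have 5: "\<And>j j'. j < s \<Longrightarrow> j' < s \<Longrightarrow> X (i, j) \<notin> set (p (i, j'))" using XW(1) pW II[OF i] by blast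
    have 6: "\<And>j. j < s \<Longrightarrow> Y (i, s - 1) \<notin> set (p (i, j)) \<and> Y (i, s - 1) \<noteq> X (i, j)"
    proof
      fix j assume j: "j < s"
      show "Y (i, s - 1) \<notin> set (p (i, j))" using XW(2)[of "(i, s - 1)"] pW[OF II[OF i j]] II[OF i, of "s - 1"] seg(1) by auto
      show "Y (i, s - 1) \<noteq> X (i, j)" unfolding Y1(1) using yX(1)[OF i II[OF i j]] .
    qed
    show ?thesis using cs[OF seg(1) 1 2 3 4 5 6] by blast
  qed
  show ?thesis
  proof (intro exI[of _ P] conjI ballI)
    fix i assume i: "i \<in> {1..N}"
    show "walk E (P i)" "distinct (P i)" "hd (P i) = x i" "last (P i) = y i" using P[OF i] by (auto simp: X1 Y1(1) Y2)
    have "length (P i) = (\<Sum>j<s. Suc (len (i, j))) + 1" using P[OF i] p(1) II[OF i] by simp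
    also have "\<dots> = k" using s_len[of i] seg(8) by (simp add: sum.distrib Suc_eq_plus1 del: add_Suc_right One_nat_def)
    finally show "length (P i) = k" .
  next
    show "disjoint_family_on (\<lambda>i. set (P i)) {1..N}"
      unfolding disjoint_family_on_def
    proof (intro ballI impI)
      fix i i' assume i: "i \<in> {1..N}" "i' \<in> {1..N}" "i \<noteq> i'"
      have a1: "set (p (i, j)) \<inter> set (p (i', j')) = {}" if "j < s" "j' < s" for j j'
        using disjoint_family_onD[OF p(2) II[OF i(1) that(1)] II[OF i(2) that(2)]] i(3) by simp
      have a2: "X (i, j) \<noteq> X (i', j')" if "j < s" "j' < s" for j j'
        using Xinj II[OF i(1) that(1)] II[OF i(2) that(2)] i(3) by (auto dest: inj_onD)
      have a3: "X u \<notin> set (p v)" if "u \<in> I" "v \<in> I" for u v using XW(1)[OF that(1)] pW[OF that(2)] by auto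
      have a4: "y e \<notin> set (p v)" if "e \<in> {1..N}" "v \<in> I" for e v
        using xW(2)[OF that(1)] pW[OF that(2)] by (auto simp: W'_def)
      have a5: "y i \<noteq> y i'" using xy(2) i by (auto dest: inj_onD)
      have set1: "set (P e) = (\<Union>j<s. set (p (e, j))) \<union> (\<lambda>j. X (e, j)) ` {..<s} \<union> {y e}" if "e \<in> {1..N}" for e
        using P[OF that] by (simp add: Y2)
      let ?A = "\<lambda>e. \<Union>j<s. set (p (e, j))" and ?B = "\<lambda>e. (\<lambda>j. X (e, j)) ` {..<s}"
      have d: "?A i \<inter> ?A i' = {}" "?B i \<inter> ?B i' = {}" "?B i \<inter> ?A i' = {}" "?A i \<inter> ?B i' = {}"
        using a1 a2 a3[OF II[OF i(1)] II[OF i(2)]] a3[OF II[OF i(2)] II[OF i(1)]] by blast+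
      have e: "y i \<notin> ?A i'" "y i' \<notin> ?A i" "y i \<notin> ?B i'" "y i' \<notin> ?B i"
        using a4[OF i(1) II[OF i(2)]] a4[OF i(2) II[OF i(1)]] yX(1)[OF i(1) II[OF i(2)]] yX(1)[OF i(2) II[OF i(1)]] by blast+
      have "(A \<union> B \<union> {b}) \<inter> (A' \<union> B' \<union> {b'}) = {}"
        if "A \<inter> A' = {}" "B \<inter> B' = {}" "B \<inter> A' = {}" "A \<inter> B' = {}" "b \<notin> A'" "b' \<notin> A" "b \<notin> B'" "b' \<notin> B" "b \<noteq> b'"
        for A B A' B' :: "'a set" and b b' using that by blast
      from this[OF d e a5] show "set (P i) \<inter> set (P i') = {}" unfolding set1[OF i(1)] set1[OF i(2)] .
    qed
  next
    have "(\<Union>i\<in>{1..N}. set (P i)) = (\<Union>u\<in>I. set (p u)) \<union> X ` I \<union> y ` {1..N}"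
    proof -
      have "(\<Union>i\<in>{1..N}. set (P i)) = (\<Union>i\<in>{1..N}. (\<Union>j<s. set (p (i, j))) \<union> (\<lambda>j. X (i, j)) ` {..<s} \<union> {y i})"
        by (intro SUP_cong) (simp_all add: P Y2)
      also have "\<dots> = (\<Union>u\<in>I. set (p u)) \<union> X ` I \<union> y ` {1..N}" unfolding I_def by auto
      finally show ?thesis .
    qed
    also have "\<dots> = V" unfolding p(3) Xim W'_def using W xy S(1) J0W fW(2) by auto
    finally show "(\<Union>i\<in>{1..N}. set (P i)) = V" .
  qed
qed

theorem theorem5p1:
  shows "\<exists>n0::nat. \<forall>n\<ge>n0. \<forall>(k::nat) (G :: ('a, 'b) pre_digraph) (x :: nat \<Rightarrow> 'a) (y :: nat \<Rightarrow> 'a) (W :: 'a set).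
    real k \<ge> 10 ^ 3 * ln (real n) ^ 3 \<longrightarrow>
    k dvd n \<longrightarrow>
    digraph G \<longrightarrow>
    card (verts G) = n \<longrightarrow>
    disjoint_vertex_pairs G (n div k) x y \<longrightarrow>
    W = verts G - (\<Union>i\<in>{1..n div k}. {x i, y i}) \<longrightarrow>
    (\<forall>A\<subseteq>verts G. real (card A) \<le> real n / (2 * ln (real n) ^ 5) \<longrightarrow>
      real (card (out_nbhd G A \<inter> W)) \<ge> real (card A) * ln (real n) ^ 5 \<and>
      real (card (in_nbhd G A \<inter> W)) \<ge> real (card A) * ln (real n) ^ 5) \<longrightarrow>
    (\<forall>A\<subseteq>verts G. \<forall>B\<subseteq>verts G. A \<inter> B = {} \<longrightarrow>
      real (card A) \<ge> real n / (2 * ln (real n) ^ 5) \<longrightarrow>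
      real (card B) \<ge> real n / (2 * ln (real n) ^ 5) \<longrightarrow>
      (\<exists>a\<in>A. \<exists>b\<in>B. a \<rightarrow>\<^bsub>G\<^esub> b)) \<longrightarrow>
    (\<exists>P :: nat \<Rightarrow> 'a list.
      (\<forall>i\<in>{1..n div k}. vpath (P i) G \<and> vwalk_length (P i) = k - 1 \<and>
        hd (P i) = x i \<and> last (P i) = y i) \<and>
      (\<forall>i\<in>{1..n div k}. \<forall>j\<in>{1..n div k}. i \<noteq> j \<longrightarrow> set (P i) \<inter> set (P j) = {}) \<and>
      (\<Union>i\<in>{1..n div k}. set (P i)) = verts G)"
proof -
  obtain n0 :: nat where n0: "\<And>n. n0 \<le> n \<Longrightarrow> 10 \<le> ln (real n) \<and>
    32 * (1001 * ln (real n) ^ 3) * (4 * exp (ln (real n) - ln (real n) ^ 2 / 16016)) < 1 / 4 \<and>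
    8 * (1001 * ln (real n) ^ 3) * exp (- real n / (64 * (1001 * ln (real n) ^ 3))) < 1 / 4 \<and>
    2 * (3 / 2 * ln (real n)) * (4 * (3 / 2 * ln (real n) + 2) ^ 2) + 4 * (3 / 2 * ln (real n)) + 7 \<le> 31 * ln (real n) ^ 3 \<and>
    1 \<le> real n / (2 * ln (real n) ^ 5) \<and> 26 * (real n / (2 * ln (real n) ^ 5) + 1) \<le> real n / 100"
    using eventually_numerics unfolding eventually_at_top_linorder by blast
  show ?thesis
  proof (rule exI[of _ n0], intro allI impI)
    fix n k :: nat and G :: "('a, 'b) pre_digraph" and x y :: "nat \<Rightarrow> 'a" and W :: "'a set"
    assume n: "n0 \<le> n" and k: "10 ^ 3 * ln (real n) ^ 3 \<le> real k" "k dvd n" and G: "digraph G" and V: "card (verts G) = n"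
      and pairs: "disjoint_vertex_pairs G (n div k) x y" and W: "W = verts G - (\<Union>i\<in>{1..n div k}. {x i, y i})"
      and ex: "\<forall>A\<subseteq>verts G. real (card A) \<le> real n / (2 * ln (real n) ^ 5) \<longrightarrow>
        real (card (out_nbhd G A \<inter> W)) \<ge> real (card A) * ln (real n) ^ 5 \<and>
        real (card (in_nbhd G A \<inter> W)) \<ge> real (card A) * ln (real n) ^ 5"
      and joined: "\<forall>A\<subseteq>verts G. \<forall>B\<subseteq>verts G. A \<inter> B = {} \<longrightarrow>
        real (card A) \<ge> real n / (2 * ln (real n) ^ 5) \<longrightarrow>
        real (card B) \<ge> real n / (2 * ln (real n) ^ 5) \<longrightarrow>
        (\<exists>a\<in>A. \<exists>b\<in>B. a \<rightarrow>\<^bsub>G\<^esub> b)"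
    interpret digraph G by (rule G)
    let ?N = "n div k"
    let ?E = "arcs_ends G"
    have pr: "x i \<in> verts G" "y i \<in> verts G" "x i \<noteq> y i" if "i \<in> {1..?N}" for i
      using pairs that unfolding disjoint_vertex_pairs_def by blast+
    have pd: "{x i, y i} \<inter> {x j, y j} = {}" if "i \<in> {1..?N}" "j \<in> {1..?N}" "i \<noteq> j" for i j
      using pairs that unfolding disjoint_vertex_pairs_def by blast
    have fW: "finite W" using W by simp
    have "\<exists>P. (\<forall>i\<in>{1..?N}. walk ?E (P i) \<and> distinct (P i) \<and> length (P i) = k \<and> hd (P i) = x i \<and> last (P i) = y i)
      \<and> disjoint_family_on (\<lambda>i. set (P i)) {1..?N} \<and> (\<Union>i\<in>{1..?N}. set (P i)) = verts G"
    proof (rule covering_paths[OF refl])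
      show "10 \<le> ln (real n)" using n0[OF n] by blast
      show "32 * (1001 * ln (real n) ^ 3) * (4 * exp (ln (real n) - ln (real n) ^ 2 / 16016)) < 1 / 4" using n0[OF n] by blast
      show "8 * (1001 * ln (real n) ^ 3) * exp (- real n / (64 * (1001 * ln (real n) ^ 3))) < 1 / 4" using n0[OF n] by blast
      show "2 * (3 / 2 * ln (real n)) * (4 * (3 / 2 * ln (real n) + 2) ^ 2) + 4 * (3 / 2 * ln (real n)) + 7 \<le> 31 * ln (real n) ^ 3"
        using n0[OF n] by blast
      show "1 \<le> real n / (2 * ln (real n) ^ 5)" using n0[OF n] by blast
      show "26 * (real n / (2 * ln (real n) ^ 5) + 1) \<le> real n / 100" using n0[OF n] by blast
      show "finite (verts G)" by simp
      show "card (verts G) = n" by (rule V)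
      show "10 ^ 3 * ln (real n) ^ 3 \<le> real k" by (rule k(1))
      show "n = ?N * k" using k(2) by simp
      show "inj_on x {1..?N}" using pd by (intro inj_onI) blast
      show "inj_on y {1..?N}" using pd by (intro inj_onI) blast
      show "x ` {1..?N} \<subseteq> verts G" "y ` {1..?N} \<subseteq> verts G" using pr by auto
      show "x ` {1..?N} \<inter> y ` {1..?N} = {}"
      proof -
        have "x i \<noteq> y j" if "i \<in> {1..?N}" "j \<in> {1..?N}" for i j
          using pr(3)[OF that(1)] pd[OF that] by (cases "i = j") auto
        then show ?thesis by blast
      qed
      show "W = verts G - (x ` {1..?N} \<union> y ` {1..?N})" unfolding W by auto
      fix A assume A: "A \<subseteq> verts G" "real (card A) \<le> real n / (2 * ln (real n) ^ 5)"
      \<comment> \<open>A neighbourhood excludes \<open>A\<close>, while the image under the arcs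
        may meet it; expansion of neighbourhoods is therefore the stronger property.\<close>
      have "card (out_nbhd G A \<inter> W) \<le> card (?E `` A \<inter> W)" "card (in_nbhd G A \<inter> W) \<le> card (?E\<inverse> `` A \<inter> W)"
        using fW by (intro card_mono; force simp: out_nbhd_def in_nbhd_def)+
      moreover have "real (card A) * ln (real n) ^ 5 \<le> real (card (out_nbhd G A \<inter> W))"
        "real (card A) * ln (real n) ^ 5 \<le> real (card (in_nbhd G A \<inter> W))" using ex A by blast+
      ultimately show "ln (real n) ^ 5 * real (card A) \<le> real (card (?E `` A \<inter> W)) \<and> ln (real n) ^ 5 * real (card A) \<le> real (card (?E\<inverse> `` A \<inter> W))"
        by (simp add: mult.commute)
    next
      fix A B assume "A \<subseteq> verts G" "B \<subseteq> verts G" "A \<inter> B = {}" "real n / (2 * ln (real n) ^ 5) \<le> real (card A)"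
        "real n / (2 * ln (real n) ^ 5) \<le> real (card B)"
      then show "\<exists>a\<in>A. \<exists>b\<in>B. (a, b) \<in> ?E" using joined by blast
    qed
    then obtain P where P: "\<And>i. i \<in> {1..?N} \<Longrightarrow> walk ?E (P i) \<and> distinct (P i) \<and> length (P i) = k \<and> hd (P i) = x i \<and> last (P i) = y i"
      "disjoint_family_on (\<lambda>i. set (P i)) {1..?N}" "(\<Union>i\<in>{1..?N}. set (P i)) = verts G" by blast
    have k0: "0 < k"
    proof -
      have "10 \<le> ln (real n)" using n0[OF n] by blast
      then have "0 < 10 ^ 3 * ln (real n) ^ 3" by simp
      then show ?thesis using k(1) by (cases k) auto
    qed
    have "vpath (P i) G \<and> vwalk_length (P i) = k - 1 \<and> hd (P i) = x i \<and> last (P i) = y i" if i: "i \<in> {1..?N}" for i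
    proof -
      have "P i \<noteq> []" using P(1)[OF i] k0 by auto
      moreover have "set (P i) \<subseteq> verts G" using P(3) i by auto
      ultimately show ?thesis using P(1)[OF i] walk_imp_vwalk_arcs[of ?E "P i"] by (auto simp: vpath_def vwalk_def)
    qed
    then show "\<exists>P :: nat \<Rightarrow> 'a list.
      (\<forall>i\<in>{1..n div k}. vpath (P i) G \<and> vwalk_length (P i) = k - 1 \<and> hd (P i) = x i \<and> last (P i) = y i) \<and>
      (\<forall>i\<in>{1..n div k}. \<forall>j\<in>{1..n div k}. i \<noteq> j \<longrightarrow> set (P i) \<inter> set (P j) = {}) \<and>
      (\<Union>i\<in>{1..n div k}. set (P i)) = verts G"
      using P(2,3) unfolding disjoint_family_on_def by blast
  qed
qed

end
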